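(* There is an algorithm which, given $\varepsilon>0$ and access to $\mathrm{Samp}(f)$ and $\mathrm{MQ}(f)$ for an unknown $f:\{0,1\}^n\to\{0,1\}$, is an $\varepsilon$-relative-error tester for the class of decision lists over $\{0,1\}^n$, and which makes $\tilde{O}(1/\varepsilon)$ calls in total to $\mathrm{Samp}(f)$ and $\mathrm{MQ}(f)$.
   Context: A decision list over $\{0,1\}^n$ is given by a list of rules $(x_{i_1},b_1,v_1),\dots,(x_{i_k},b_k,v_k),v_{\mathrm{default}}$ with $i_j\in[n]$ and $b_j,v_j,v_{\mathrm{default}}\in\{0,1\}$; $f(x)=v_j$ for the smallest $j$ with $x_{i_j}=b_j$, and $f(x)=v_{\mathrm{default}}$ if there is no such $j$. $\mathrm{MQ}(f)$ returns $f(x)$ on query $x$; $\mathrm{Samp}(f)$ returns on each call an independent uniformly random element of $f^{-1}(1)$. For $f^{-1}(1)\ne\emptyset$, $\mathrm{rel}\text{-}\mathrm{dist}(f,g)=|f^{-1}(1)\triangle g^{-1}(1)|/|f^{-1}(1)|$ and $\mathrm{rel}\text{-}\mathrm{dist}(f,\mathcal{C})=\min_{g\in\mathcal{C}}\mathrm{rel}\text{-}\mathrm{dist}(f,g)$. An $\varepsilon$-relative-error tester for $\mathcal{C}$ accepts with probability at least $2/3$ if $f\in\mathcal{C}$ and rejects with probability at least $2/3$ if $\mathrm{rel}\text{-}\mathrm{dist}(f,\mathcal{C})\ge\varepsilon$. $\tilde{O}(\cdot)$ hides polylogarithmic factors. *)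

theory Defs
  imports "HOL-Probability.Probability_Mass_Function" "HOL-Library.FuncSet"
begin

text \<open>
  Points of the cube are Boolean lists, so that the dimension \<open>n\<close> can be quantified inside a
  formula; coordinates are numbered \<open>0, \<dots>, n - 1\<close>. A function on the cube is an extensional one
  (\<open>undefined\<close> off the cube), so equality of functions is equality on the cube.
\<close>

definition cube :: "nat \<Rightarrow> bool list set" where
  "cube n = {x. length x = n}"

definition bool_funs :: "nat \<Rightarrow> (bool list \<Rightarrow> bool) set" where
  "bool_funs n = cube n \<rightarrow>\<^sub>E UNIV"

definition ones :: "nat \<Rightarrow> (bool list \<Rightarrow> bool) \<Rightarrow> bool list set" where
  "ones n f = {x \<in> cube n. f x}"

type_synonym rule = "nat \<times> bool \<times> bool"

primrec eval_list :: "rule list \<Rightarrow> bool \<Rightarrow> bool list \<Rightarrow> bool" where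
  "eval_list [] d x = d"
| "eval_list (r # rs) d x = (case r of (i, b, v) \<Rightarrow> if x ! i = b then v else eval_list rs d x)"

definition decision_lists :: "nat \<Rightarrow> (bool list \<Rightarrow> bool) set" where
  "decision_lists n =
     {restrict (eval_list rs d) (cube n) | rs d. \<forall>(i, b, v) \<in> set rs. i < n}"

definition rel_dist :: "nat \<Rightarrow> (bool list \<Rightarrow> bool) \<Rightarrow> (bool list \<Rightarrow> bool) \<Rightarrow> real" where
  "rel_dist n f g = real (card (sym_diff (ones n f) (ones n g))) / real (card (ones n f))"

text \<open>Meaningful for nonempty \<open>C \<subseteq> bool_funs n\<close>; such a \<open>C\<close> is finite, so the minimum exists.\<close>

definition rel_dist_class ::
  "nat \<Rightarrow> (bool list \<Rightarrow> bool) \<Rightarrow> (bool list \<Rightarrow> bool) set \<Rightarrow> real" where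
  "rel_dist_class n f C = (MIN g\<in>C. rel_dist n f g)"

lemma finite_cube: "finite (cube n)"
  using finite_lists_length_eq[of "UNIV :: bool set" n] by (simp add: cube_def)

lemma finite_bool_funs: "finite (bool_funs n)"
  unfolding bool_funs_def by (intro finite_PiE finite_cube) simp

lemma decision_lists_subset: "decision_lists n \<subseteq> bool_funs n"
  unfolding decision_lists_def bool_funs_def by auto

lemma finite_decision_lists: "finite (decision_lists n)"
  using decision_lists_subset finite_bool_funs by (rule finite_subset)

lemma decision_lists_nonempty: "decision_lists n \<noteq> {}"
proof -
  have "restrict (eval_list [] d) (cube n) \<in> decision_lists n" for d
    unfolding decision_lists_def by (intro CollectI exI[of _ "[]"] exI[of _ d]) simp
  then show ?thesis by blast
qed

text \<open>
  Adaptive algorithms as well-founded trees: \<open>Output\<close> halts with a verdict (\<open>True\<close> is accept),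
  \<open>MQ x\<close> and \<open>Samp\<close> call the oracles and continue according to the answer, and \<open>Rand k\<close> is
  internal randomness, a uniform draw from \<open>{0, \<dots>, k}\<close>, which is not charged as a call.
  The tree does not depend on the unknown function, which enters only through \<open>run\<close>.
\<close>

datatype query_alg =
    Output bool
  | MQ "bool list" "bool \<Rightarrow> query_alg"
  | Samp "bool list \<Rightarrow> query_alg"
  | Rand nat "nat \<Rightarrow> query_alg"

text \<open>
  The joint distribution of the verdict and the number of oracle calls made. Each \<open>Samp\<close> node
  makes a fresh draw; this presupposes \<open>ones n f \<noteq> {}\<close>.
\<close>

primrec run :: "nat \<Rightarrow> (bool list \<Rightarrow> bool) \<Rightarrow> query_alg \<Rightarrow> (bool \<times> nat) pmf" where
  "run n f (Output b) = return_pmf (b, 0)"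
| "run n f (MQ x c) = map_pmf (apsnd Suc) (run n f (c (f x)))"
| "run n f (Samp c) =
     bind_pmf (pmf_of_set (ones n f)) (\<lambda>x. map_pmf (apsnd Suc) (run n f (c x)))"
| "run n f (Rand k c) = bind_pmf (pmf_of_set {..k}) (\<lambda>r. run n f (c r))"

definition verdict :: "nat \<Rightarrow> (bool list \<Rightarrow> bool) \<Rightarrow> query_alg \<Rightarrow> bool pmf" where
  "verdict n f A = map_pmf fst (run n f A)"

definition rel_error_tester ::
  "nat \<Rightarrow> real \<Rightarrow> (bool list \<Rightarrow> bool) set \<Rightarrow> query_alg \<Rightarrow> bool" where
  "rel_error_tester n \<epsilon> C A \<longleftrightarrow>
     (\<forall>f \<in> bool_funs n. ones n f \<noteq> {} \<longrightarrow>
        (f \<in> C \<longrightarrow> pmf (verdict n f A) True \<ge> 2 / 3) \<and>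
        (rel_dist_class n f C \<ge> \<epsilon> \<longrightarrow> pmf (verdict n f A) False \<ge> 2 / 3))"

text \<open>A worst-case bound, over all functions and all random outcomes.\<close>

definition calls_at_most :: "nat \<Rightarrow> query_alg \<Rightarrow> real \<Rightarrow> bool" where
  "calls_at_most n A T \<longleftrightarrow>
     (\<forall>f \<in> bool_funs n. ones n f \<noteq> {} \<longrightarrow> (\<forall>(b, q) \<in> set_pmf (run n f A). real q \<le> T))"

text \<open>
  \<open>T\<close> is \<open>O(1/\<epsilon>)\<close> up to a power of \<open>log (1/\<epsilon>)\<close>, on the whole range \<open>\<epsilon> > 0\<close>; the summand \<open>2\<close>
  keeps the logarithm positive and bounded away from \<open>0\<close> also for large \<open>\<epsilon>\<close>.
\<close>

definition soft_O_inverse :: "(real \<Rightarrow> real) \<Rightarrow> bool" where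
  "soft_O_inverse T \<longleftrightarrow>
     (\<exists>(c :: real) (k :: nat). \<forall>\<epsilon> > 0. T \<epsilon> \<le> c * (1 / \<epsilon>) * ln (2 + 1 / \<epsilon>) ^ k)"

end

theory Submission
  imports Defs
begin

text \<open>
  A decision list with a satisfying point vanishes off a subcube \<open>C\<close> (the rules before the first
  one with value \<open>True\<close>), and on \<open>C\<close> it is a decision list of density at least \<open>1/2\<close> which, up to
  measure \<open>2\<^sup>-\<^sup>K\<close>, depends on its first \<open>K = O(log (1/\<epsilon>))\<close> variables. These variables cannot be
  named without paying \<open>log n\<close>, so they are handled implicitly. The coordinates are hashed into
  \<open>O(K\<^sup>2)\<close> blocks. A pair \<open>a, x\<close> of samples such that overwriting a block of \<open>a\<close> by that of \<open>x\<close>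
  turns the value to \<open>0\<close> reveals a relevant variable in the block: its literal at \<open>w\<close> is the value
  of \<open>f\<close> at \<open>a\<close> overwritten by \<open>w\<close>, and adding \<open>a \<oplus> x\<close> on the block flips it and stays in \<open>C\<close>.
  Flipping the revealed literals of a sample at random yields a nearly uniform point of \<open>C\<close>.

  The tester draws such points and accepts if a single decision list over the revealed literals
  is consistent with \<open>f\<close> on all of them, and if sums and mixtures of them stay in \<open>C\<close> and the literals
  are additive and respect mixtures. There are only \<open>exp (O(K log K))\<close> such lists, so a union bound
  applies. Conversely, if some list passes a test with probability at least \<open>1 - \<delta>\<close>, then the law
  \<open>P\<close> of the random points is, up to a constant factor, uniform on the set \<open>T\<close> of points whose
  flips satisfy \<open>f\<close> at least a quarter of the time. A linearity test relative to the graph of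
  the literals over \<open>T\<close> makes \<open>T\<close> an affine space with linear literals, up to \<open>O(\<delta>)\<close>; the
  mixtures force the space to be a subcube and each literal to be a coordinate.
\<close>

section \<open>Probabilities of events\<close>

text \<open>Soundness has to work for an arbitrary \<open>f\<close>, for which witnesses and
  literals carry no meaning. Only algebra survives: \<open>shift\<close> is additive whatever the
  witnesses are, and \<open>hash\<close> takes values in \<open>Pow {..<m}\<close>. A base point
  \<open>y\<close> enters because a subcube is affine rather than linear. Hypotheses must accept
  half of all literal patterns, so that a point whose flips rarely satisfy \<open>f\<close> is
  caught by a random flip. Completeness meets one obstacle. A variable that no pair reveals should
  be too weak to be noticed at any tested point, but the first variable of the list can be strong
  and stay hidden, because nearly all samples carry its accepting value. Then the base point and the
  samples in the tests carry it too, hence so do the tested points, and the first rule decides them.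
  The block map, \<open>y\<close> and the pairs are drawn before the tests, so for a fixed
  hypothesis the tests are independent, as the union bound requires.\<close>

abbreviation Pr :: "'a pmf \<Rightarrow> ('a \<Rightarrow> bool) \<Rightarrow> real" where
  "Pr p Q \<equiv> measure_pmf.prob p {x. Q x}"

lemma Pr_mono:
  assumes "\<And>x. x \<in> set_pmf p \<Longrightarrow> Q x \<Longrightarrow> R x"
  shows "Pr p Q \<le> Pr p R"
proof -
  have "Pr p Q = measure_pmf.prob p ({x. Q x} \<inter> set_pmf p)"
    by (simp add: measure_Int_set_pmf)
  also have "\<dots> \<le> Pr p R"
    using assms by (intro measure_pmf.finite_measure_mono) auto
  finally show ?thesis .
qed

lemma Pr_cong:
  assumes "\<And>x. x \<in> set_pmf p \<Longrightarrow> Q x \<longleftrightarrow> R x"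
  shows "Pr p Q = Pr p R"
  using assms by (intro antisym Pr_mono) auto

lemma Pr_disj: "Pr p (\<lambda>x. Q x \<or> R x) \<le> Pr p Q + Pr p R"
  using measure_Un_le[of "{x. Q x}" p "{x. R x}"]
  by (simp add: Collect_disj_eq)

lemma Pr_ex_finite:
  assumes "finite A"
  shows "Pr p (\<lambda>x. \<exists>a\<in>A. Q a x) \<le> (\<Sum>a\<in>A. Pr p (Q a))"
  using assms
proof (induction A rule: finite_induct)
  case (insert a A)
  have "Pr p (\<lambda>x. \<exists>b\<in>insert a A. Q b x) \<le> Pr p (Q a) + Pr p (\<lambda>x. \<exists>b\<in>A. Q b x)"
    using Pr_disj[of p "Q a"] by simp
  with insert show ?case by simp
qed simp

lemma Pr_ex_finite_le:
  fixes c :: real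
  assumes "finite A" "\<And>a. a \<in> A \<Longrightarrow> Pr p (Q a) \<le> c"
  shows "Pr p (\<lambda>x. \<exists>a\<in>A. Q a x) \<le> card A * c"
proof -
  have "Pr p (\<lambda>x. \<exists>a\<in>A. Q a x) \<le> (\<Sum>a\<in>A. Pr p (Q a))"
    using assms(1) by (rule Pr_ex_finite)
  also have "\<dots> \<le> card A * c"
    using assms(2) by (rule sum_bounded_above)
  finally show ?thesis .
qed

lemma Pr_not: "Pr p (\<lambda>x. \<not> Q x) = 1 - Pr p Q"
  using measure_pmf.prob_compl[of "{x. Q x}" p] by (simp add: Compl_eq_Diff_UNIV[symmetric] Collect_neg_eq)

lemma Pr_map: "Pr (map_pmf g p) Q = Pr p (\<lambda>x. Q (g x))"
  by (simp add: vimage_def)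

lemma Pr_return: "Pr (return_pmf a) Q = of_bool (Q a)"
  by (simp add: measure_return_pmf indicator_def)

lemma Pr_uniform:
  assumes "finite S" "S \<noteq> {}"
  shows "Pr (pmf_of_set S) Q = card {x \<in> S. Q x} / card S"
proof -
  have "S \<inter> {x. Q x} = {x \<in> S. Q x}" by auto
  with assms show ?thesis by (simp add: measure_pmf_of_set)
qed

lemma Pr_bind: "Pr (bind_pmf p f) Q = (\<integral>x. Pr (f x) Q \<partial>measure_pmf p)"
proof -
  have "ennreal (Pr (bind_pmf p f) Q) = (\<integral>\<^sup>+x. ennreal (Pr (f x) Q) \<partial>measure_pmf p)"
    by (simp add: measure_pmf.emeasure_eq_measure[symmetric])
  also have "\<dots> = ennreal (\<integral>x. Pr (f x) Q \<partial>measure_pmf p)"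
    by (intro nn_integral_eq_integral measure_pmf.integrable_const_bound[of _ 1]) auto
  finally show ?thesis by simp
qed

lemma integrable_Pr: "integrable (measure_pmf p) (\<lambda>x. Pr (f x) (Q x))"
  by (intro measure_pmf.integrable_const_bound[of _ 1]) auto

lemma Pr_bind_le:
  assumes "\<And>x. x \<in> set_pmf p \<Longrightarrow> Pr (f x) Q \<le> c"
  shows "Pr (bind_pmf p f) Q \<le> c"
  unfolding Pr_bind using assms
  by (intro measure_pmf.integral_le_const integrable_Pr) (auto simp: AE_measure_pmf_iff)

lemma Pr_bind_ge:
  assumes "\<And>x. x \<in> set_pmf p \<Longrightarrow> R x \<Longrightarrow> c \<le> Pr (f x) Q"
  shows "c * Pr p R \<le> Pr (bind_pmf p f) Q"
proof -
  have "c * Pr p R = (\<integral>x. c * indicator {x. R x} x \<partial>measure_pmf p)" by simp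
  also have "\<dots> \<le> (\<integral>x. Pr (f x) Q \<partial>measure_pmf p)"
    using assms
    by (intro integral_mono_AE integrable_Pr measure_pmf.integrable_const_bound[of _ "\<bar>c\<bar>"])
       (auto simp: AE_measure_pmf_iff indicator_def)
  finally show ?thesis unfolding Pr_bind .
qed

lemma pair_pmf_alt: "pair_pmf p q = bind_pmf p (\<lambda>x. map_pmf (Pair x) q)"
  unfolding pair_pmf_def map_pmf_def by simp

lemma Pr_pair_le:
  assumes "\<And>x. x \<in> set_pmf p \<Longrightarrow> Pr q (\<lambda>y. Q (x, y)) \<le> c"
  shows "Pr (pair_pmf p q) Q \<le> c"
  unfolding pair_pmf_alt by (rule Pr_bind_le) (use assms in \<open>simp add: Pr_map\<close>)

lemma Pr_pair_ge:
  assumes "\<And>x. x \<in> set_pmf p \<Longrightarrow> R x \<Longrightarrow> c \<le> Pr q (\<lambda>y. Q (x, y))"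
  shows "c * Pr p R \<le> Pr (pair_pmf p q) Q"
  unfolding pair_pmf_alt by (rule Pr_bind_ge) (use assms in \<open>simp add: Pr_map\<close>)

lemma Pr_pair_swap: "Pr (pair_pmf p q) Q = Pr (pair_pmf q p) (\<lambda>(y, x). Q (x, y))"
  by (subst pair_commute_pmf) (simp add: Pr_map case_prod_unfold)

lemma Pr_pair_fst: "Pr (pair_pmf p q) (\<lambda>x. Q (fst x)) = Pr p Q"
  by (simp flip: Pr_map add: map_fst_pair_pmf)

lemma Pr_pair_snd: "Pr (pair_pmf p q) (\<lambda>x. Q (snd x)) = Pr q Q"
  by (simp flip: Pr_map add: map_snd_pair_pmf)

lemma Pr_replicate_ex: "Pr (replicate_pmf k p) (\<lambda>xs. \<exists>x\<in>set xs. Q x) \<le> k * Pr p Q"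
proof (induction k)
  case 0
  show ?case by (simp add: Pr_return)
next
  case (Suc k)
  have eq: "replicate_pmf (Suc k) p = map_pmf (\<lambda>(x, xs). x # xs) (pair_pmf p (replicate_pmf k p))"
    by (simp add: pair_pmf_def map_bind_pmf)
  have "Pr (replicate_pmf (Suc k) p) (\<lambda>xs. \<exists>x\<in>set xs. Q x)
      = Pr (pair_pmf p (replicate_pmf k p)) (\<lambda>x. Q (fst x) \<or> (\<exists>y\<in>set (snd x). Q y))"
    unfolding eq Pr_map by (simp add: case_prod_unfold)
  also have "\<dots> \<le> Pr p Q + Pr (replicate_pmf k p) (\<lambda>xs. \<exists>x\<in>set xs. Q x)"
    using Pr_disj[of "pair_pmf p (replicate_pmf k p)" "\<lambda>x. Q (fst x)" "\<lambda>x. \<exists>y\<in>set (snd x). Q y"]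
    by (simp add: Pr_pair_fst Pr_pair_snd[where Q = "\<lambda>xs. \<exists>y\<in>set xs. Q y"])
  also have "\<dots> \<le> Suc k * Pr p Q" using Suc.IH by (simp add: algebra_simps)
  finally show ?case .
qed

lemma Pr_replicate_all: "Pr (replicate_pmf k p) (\<lambda>xs. \<forall>x\<in>set xs. Q x) = Pr p Q ^ k"
proof (induction k)
  case 0
  show ?case by (simp add: Pr_return)
next
  case (Suc k)
  have "Pr (replicate_pmf (Suc k) p) (\<lambda>xs. \<forall>x\<in>set xs. Q x)
     = (\<integral>x. Pr (map_pmf ((#) x) (replicate_pmf k p)) (\<lambda>xs. \<forall>x\<in>set xs. Q x) \<partial>measure_pmf p)"
    by (simp add: Pr_bind[symmetric] map_pmf_def)
  also have "\<dots> = (\<integral>x. indicator {x. Q x} x * Pr p Q ^ k \<partial>measure_pmf p)"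
    unfolding Pr_map by (intro Bochner_Integration.integral_cong) (auto simp: Suc.IH indicator_def)
  also have "\<dots> = Pr p Q ^ Suc k" by simp
  finally show ?case .
qed

section \<open>A linearity test relative to a set\<close>

text \<open>Sets of coordinates are vectors over the field with two elements, and this is their
  addition.\<close>

definition xor :: "'a set \<Rightarrow> 'a set \<Rightarrow> 'a set" (infixl "\<oplus>" 65) where
  "A \<oplus> B = sym_diff A B"

lemma mem_xor [simp]: "x \<in> A \<oplus> B \<longleftrightarrow> (x \<in> A) \<noteq> (x \<in> B)"
  by (auto simp: xor_def)

lemma xor_commute: "A \<oplus> B = B \<oplus> A"
  by (auto simp: xor_def)

lemma xor_assoc: "(A \<oplus> B) \<oplus> C = A \<oplus> (B \<oplus> C)"
  by (auto simp: set_eq_iff)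

lemma xor_left_commute: "A \<oplus> (B \<oplus> C) = B \<oplus> (A \<oplus> C)"
  by (auto simp: set_eq_iff)

lemma xor_self [simp]: "A \<oplus> A = {}" "A \<oplus> (A \<oplus> B) = B" "A \<oplus> {} = A" "{} \<oplus> A = A"
  by (auto simp: set_eq_iff)

lemmas xor_ac = xor_assoc xor_commute xor_left_commute

lemma xor_eq_iff: "A \<oplus> B = C \<longleftrightarrow> A = C \<oplus> B"
  by (auto simp: set_eq_iff)

lemma xor_eq_empty [simp]: "A \<oplus> B = {} \<longleftrightarrow> A = B"
  by (auto simp: set_eq_iff)

lemma xor_subset: "A \<subseteq> N \<Longrightarrow> B \<subseteq> N \<Longrightarrow> A \<oplus> B \<subseteq> N"
  by (auto simp: xor_def)

lemma inj_xor: "inj_on (\<lambda>x. x \<oplus> a) X"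
  by (rule inj_on_inverseI[where g = "\<lambda>x. x \<oplus> a"]) (simp add: xor_ac)

lemma card_xor_image [simp]: "card ((\<lambda>x. x \<oplus> a) ` X) = card X"
  by (intro card_image inj_xor)

text \<open>Markov's inequality for counting measure.\<close>

lemma sum_le_split:
  fixes f :: "'a \<Rightarrow> real"
  assumes "finite X" "\<And>x. x \<in> X \<Longrightarrow> 0 \<le> f x" "(\<Sum>x\<in>X. f x) \<le> s" "0 < c"
  shows "card {x \<in> X. c < f x} \<le> s / c"
proof -
  have "c * card {x \<in> X. c < f x} = (\<Sum>x\<in>{x \<in> X. c < f x}. c)" by simp
  also have "\<dots> \<le> (\<Sum>x\<in>{x \<in> X. c < f x}. f x)" by (intro sum_mono) auto
  also have "\<dots> \<le> (\<Sum>x\<in>X. f x)" using assms(1,2) by (intro sum_mono2) auto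
  finally show ?thesis using assms(3,4) by (simp add: field_simps)
qed

lemma card_sum_fibers:
  assumes "finite X" "finite Y"
  shows "card {(x, y) \<in> X \<times> Y. R x y} = (\<Sum>x\<in>X. card {y \<in> Y. R x y})"
proof -
  have "{(x, y) \<in> X \<times> Y. R x y} = (SIGMA x:X. {y \<in> Y. R x y})" by auto
  then show ?thesis using assms by simp
qed

text \<open>
  \<open>V\<close> consists of the \<open>v\<close> whose translation maps a non-negligible part of \<open>X\<close> into \<open>X\<close>. Each such
  \<open>v\<close> is a sum of two elements that move almost all of \<open>X\<close> into itself, so it moves at least \<open>3/4\<close>
  of \<open>X\<close> into itself; this gap makes \<open>V\<close> closed under addition.
\<close>

lemma relative_linearity:
  fixes X :: "'a set set" and \<kappa> :: real
  assumes fin: "finite X"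
    and bad: "card {(x, x') \<in> X \<times> X. x \<oplus> x' \<notin> X} \<le> \<kappa> * (card X)\<^sup>2"
    and \<kappa>: "0 < \<kappa>" "\<kappa> \<le> 1 / 100" and ne: "X \<noteq> {}"
  obtains V where "finite V" "V \<subseteq> {x \<oplus> x' | x x'. x \<in> X \<and> x' \<in> X}" "{} \<in> V"
    "\<And>u v. u \<in> V \<Longrightarrow> v \<in> V \<Longrightarrow> u \<oplus> v \<in> V"
    "card (X - V) \<le> 8 * \<kappa> * card X" "card (V - X) \<le> 2 * \<kappa> * card X"
proof -
  define c where "c = real (card X)"
  have c: "c > 0" using fin ne by (simp add: c_def card_gt_0_iff)
  define \<mu> where "\<mu> v = card {x \<in> X. x \<oplus> v \<in> X}" for v
  define \<nu> where "\<nu> v = card {x \<in> X. x \<oplus> v \<notin> X}" for v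
  have \<mu>\<nu>: "\<mu> v + \<nu> v = card X" for v
    unfolding \<mu>_def \<nu>_def using fin
    by (subst card_Un_disjoint[symmetric]) (auto intro!: arg_cong[where f = card])
  \<comment> \<open>The threshold \<open>c / 8\<close> leaves room for doubling twice:
    \<open>\<nu>\<close> is at most \<open>c / 4\<close> on sums of two elements of
    \<open>T\<close>, and at most \<open>c / 2\<close>, the threshold of \<open>V1\<close>, on sums
    of two of those.\<close>
  define T where "T = {x \<in> X. \<nu> x \<le> c / 8}"
  have "{(x, x') \<in> X \<times> X. x' \<oplus> x \<notin> X} = {(x, x') \<in> X \<times> X. x \<oplus> x' \<notin> X}"
    by (simp add: xor_commute)
  then have "(\<Sum>x\<in>X. real (\<nu> x)) = card {(x, x') \<in> X \<times> X. x \<oplus> x' \<notin> X}"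
    unfolding \<nu>_def using card_sum_fibers[OF fin fin, of "\<lambda>x x'. x' \<oplus> x \<notin> X"] by simp
  then have "(\<Sum>x\<in>X. real (\<nu> x)) \<le> \<kappa> * c\<^sup>2" using bad by (simp add: c_def)
  from sum_le_split[OF fin _ this, of "c / 8"] c
  have "card {x \<in> X. c / 8 < \<nu> x} \<le> 8 * \<kappa> * c"
    by (simp add: field_simps power2_eq_square)
  moreover have "X - T = {x \<in> X. c / 8 < \<nu> x}" by (auto simp: T_def)
  ultimately have XT: "card (X - T) \<le> 8 * \<kappa> * c" by simp
  \<comment> \<open>The threshold is twice the bound on \<open>X - T\<close>: above it, some
    \<open>x\<close> has both \<open>x\<close> and \<open>x \<oplus> v\<close> in \<open>T\<close>,
    and \<open>v\<close> is their sum.\<close>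
  define V where "V = {v. 16 * \<kappa> * c < \<mu> v}"
  have sub: "\<nu> (v \<oplus> w) \<le> \<nu> v + \<nu> w" for v w
  proof -
    have "{x \<in> X. x \<oplus> (v \<oplus> w) \<notin> X}
        \<subseteq> {x \<in> X. x \<oplus> v \<notin> X} \<union> (\<lambda>x. x \<oplus> v) ` {x \<in> X. x \<oplus> w \<notin> X}"
    proof
      fix x assume x: "x \<in> {x \<in> X. x \<oplus> (v \<oplus> w) \<notin> X}"
      show "x \<in> {x \<in> X. x \<oplus> v \<notin> X} \<union> (\<lambda>x. x \<oplus> v) ` {x \<in> X. x \<oplus> w \<notin> X}"
      proof (cases "x \<oplus> v \<in> X")
        case True
        then have "x \<oplus> v \<in> {x \<in> X. x \<oplus> w \<notin> X}" using x by (simp add: xor_assoc)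
        moreover have "x = (x \<oplus> v) \<oplus> v" by (simp add: xor_ac)
        ultimately show ?thesis by blast
      qed (use x in auto)
    qed
    then have "\<nu> (v \<oplus> w) \<le> card ({x \<in> X. x \<oplus> v \<notin> X} \<union> (\<lambda>x. x \<oplus> v) ` {x \<in> X. x \<oplus> w \<notin> X})"
      unfolding \<nu>_def using fin by (intro card_mono) auto
    also have "\<dots> \<le> \<nu> v + \<nu> w"
      unfolding \<nu>_def by (rule order.trans[OF card_Un_le]) simp
    finally show ?thesis .
  qed
  have gap: "\<nu> v \<le> c / 4" if "v \<in> V" for v
  proof -
    let ?A = "{x \<in> X. x \<oplus> v \<in> X}"
    have "\<exists>x\<in>?A. x \<in> T \<and> x \<oplus> v \<in> T"
    proof (rule ccontr)
      assume neg: "\<not> ?thesis"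
      have "?A \<subseteq> (X - T) \<union> (\<lambda>x. x \<oplus> v) ` (X - T)"
      proof -
        have "x \<in> (\<lambda>x. x \<oplus> v) ` (X - T)" if "x \<oplus> v \<in> X - T" for x
          using that by (intro image_eqI[of _ _ "x \<oplus> v"]) (auto simp: xor_ac)
        with neg show ?thesis by blast
      qed
      then have "card ?A \<le> card ((X - T) \<union> (\<lambda>x. x \<oplus> v) ` (X - T))"
        using fin by (intro card_mono) auto
      also have "\<dots> \<le> card (X - T) + card (X - T)"
        by (rule order.trans[OF card_Un_le]) simp
      finally have "real (\<mu> v) \<le> 16 * \<kappa> * c" using XT unfolding \<mu>_def by linarith
      with that show False by (simp add: V_def)
    qed
    then obtain x where "x \<in> T" "x \<oplus> v \<in> T" by blast
    moreover have "v = x \<oplus> (x \<oplus> v)" by simp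
    ultimately show ?thesis using sub[of x "x \<oplus> v"] by (auto simp: T_def)
  qed
  have V1: "v \<in> V" if "\<nu> v \<le> c / 2" for v
  proof -
    have "real (\<mu> v) \<ge> c / 2" using that \<mu>\<nu>[of v] by (simp add: c_def)
    moreover have "16 * \<kappa> * c < c / 2" using \<kappa> c by simp
    ultimately show ?thesis by (simp add: V_def)
  qed
  have V0: "{} \<in> V" using c by (intro V1) (simp add: \<nu>_def)
  have Vadd: "u \<oplus> v \<in> V" if "u \<in> V" "v \<in> V" for u v
    using sub[of u v] gap[OF that(1)] gap[OF that(2)] by (intro V1) linarith
  have TV: "T \<subseteq> V" using c by (auto simp: T_def intro!: V1)
  have Vsub: "V \<subseteq> {x \<oplus> x' | x x'. x \<in> X \<and> x' \<in> X}"
  proof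
    fix v assume "v \<in> V"
    moreover have "0 < 16 * \<kappa> * c" using \<kappa> c by simp
    ultimately have "\<mu> v \<noteq> 0" unfolding V_def by auto
    then have "{x \<in> X. x \<oplus> v \<in> X} \<noteq> {}" unfolding \<mu>_def by (metis card.empty)
    then obtain x where "x \<in> X" "x \<oplus> v \<in> X" by blast
    then show "v \<in> {x \<oplus> x' | x x'. x \<in> X \<and> x' \<in> X}"
      by (intro CollectI exI[of _ x] exI[of _ "x \<oplus> v"]) simp
  qed
  have finV: "finite V"
  proof (rule finite_subset[OF Vsub])
    have "{x \<oplus> x' | x x'. x \<in> X \<and> x' \<in> X} = (\<lambda>(x, x'). x \<oplus> x') ` (X \<times> X)" by auto
    then show "finite {x \<oplus> x' | x x'. x \<in> X \<and> x' \<in> X}" using fin by simp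
  qed
  have XV: "card (X - V) \<le> 8 * \<kappa> * c"
    using card_mono[of "X - T" "X - V"] fin TV XT by force
  \<comment> \<open>Double counting: each \<open>v\<close> in \<open>V\<close> is the sum of at
    least \<open>3 / 4 * c\<close> ordered pairs from \<open>X\<close>, and a pair determines its
    sum, so \<open>V\<close> has at most \<open>4 / 3 * c\<close> elements.\<close>
  have "card V * (3 / 4 * c) = (\<Sum>v\<in>V. 3 / 4 * c)" by simp
  also have "\<dots> \<le> (\<Sum>v\<in>V. real (\<mu> v))"
  proof (rule sum_mono)
    fix v assume "v \<in> V"
    then show "3 / 4 * c \<le> \<mu> v" using gap[of v] \<mu>\<nu>[of v] by (simp add: c_def)
  qed
  also have "\<dots> = card {(v, x) \<in> V \<times> X. x \<oplus> v \<in> X}"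
    unfolding \<mu>_def using card_sum_fibers[OF finV fin, of "\<lambda>v x. x \<oplus> v \<in> X"] by simp
  also have "\<dots> \<le> real (card (X \<times> X))"
  proof -
    have "inj_on (\<lambda>(v, x). (x, x \<oplus> v)) {(v, x) \<in> V \<times> X. x \<oplus> v \<in> X}"
      by (rule inj_on_inverseI[where g = "\<lambda>(x, w). (x \<oplus> w, x)"]) auto
    then have "card {(v, x) \<in> V \<times> X. x \<oplus> v \<in> X}
      = card ((\<lambda>(v, x). (x, x \<oplus> v)) ` {(v, x) \<in> V \<times> X. x \<oplus> v \<in> X})"
      by (simp add: card_image)
    also have "\<dots> \<le> card (X \<times> X)" using fin by (intro card_mono) auto
    finally show ?thesis by simp
  qed
  finally have "card V * (3 / 4 * c) \<le> c * c" by (simp add: c_def card_cartesian_product)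
  then have cV: "card V \<le> 4 / 3 * c" using c by simp
  have XcV: "card (X \<inter> V) + card (X - V) = card X" "card (X \<inter> V) + card (V - X) = card V"
    using card_Int_Diff[OF fin, of V] card_Int_Diff[OF finV, of X] by (auto simp: Int_commute)
  define B where "B = {(x, x') \<in> X \<times> X. x \<oplus> x' \<in> V - X}"
  have Bfin: "finite B"
    unfolding B_def by (rule finite_subset[of _ "X \<times> X"]) (use fin in auto)
  \<comment> \<open>\<open>X \<inter> V\<close> and its translate by \<open>w\<close> both lie in
    \<open>V\<close> and have at least \<open>0.92 * c\<close> elements, while \<open>V\<close> has
    at most \<open>4 / 3 * c\<close>; so they overlap in at least \<open>c / 2\<close>. Hence each
    \<open>w\<close> in \<open>V - X\<close> is the sum of at least \<open>c / 2\<close> bad pairs,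
    and the number of bad pairs bounds \<open>V - X\<close>.\<close>
  have many: "c / 2 \<le> card {x \<in> X. x \<oplus> w \<in> X}" if w: "w \<in> V - X" for w
  proof -
    let ?Y = "X \<inter> V"
    have "(\<lambda>x. x \<oplus> w) ` ?Y \<subseteq> V" using w Vadd by auto
    then have "card (?Y \<union> (\<lambda>x. x \<oplus> w) ` ?Y) \<le> card V" using finV by (intro card_mono) auto
    moreover have "card ?Y + card ((\<lambda>x. x \<oplus> w) ` ?Y)
      = card (?Y \<union> (\<lambda>x. x \<oplus> w) ` ?Y) + card (?Y \<inter> (\<lambda>x. x \<oplus> w) ` ?Y)"
      using fin by (intro card_Un_Int) auto
    moreover have "card (?Y \<inter> (\<lambda>x. x \<oplus> w) ` ?Y) \<le> card {x \<in> X. x \<oplus> w \<in> X}"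
      using fin by (intro card_mono) (auto simp: xor_ac)
    ultimately have "2 * card ?Y \<le> card V + card {x \<in> X. x \<oplus> w \<in> X}" by simp
    then have "2 * real (card ?Y) \<le> card V + card {x \<in> X. x \<oplus> w \<in> X}" by linarith
    moreover have "real (card ?Y) \<ge> c - 8 * \<kappa> * c" using XV XcV(1) by (simp add: c_def)
    moreover have "8 * \<kappa> * c \<le> 8 / 100 * c" using \<kappa> c by simp
    ultimately show ?thesis using cV c by linarith
  qed
  have "card (V - X) * (c / 2) = (\<Sum>w\<in>V - X. c / 2)" by simp
  also have "\<dots> \<le> (\<Sum>w\<in>V - X. real (card {x \<in> X. x \<oplus> w \<in> X}))"
    by (rule sum_mono) (rule many)
  also have "\<dots> = card {(w, x) \<in> (V - X) \<times> X. x \<oplus> w \<in> X}"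
    using card_sum_fibers[of "V - X" X "\<lambda>w x. x \<oplus> w \<in> X"] finV fin by simp
  also have "\<dots> \<le> real (card {(x, x') \<in> X \<times> X. x \<oplus> x' \<notin> X})"
  proof -
    have "inj_on (\<lambda>(w, x). (x, x \<oplus> w)) {(w, x) \<in> (V - X) \<times> X. x \<oplus> w \<in> X}"
      by (rule inj_on_inverseI[where g = "\<lambda>(x, w). (x \<oplus> w, x)"]) auto
    then have "card {(w, x) \<in> (V - X) \<times> X. x \<oplus> w \<in> X}
      = card ((\<lambda>(w, x). (x, x \<oplus> w)) ` {(w, x) \<in> (V - X) \<times> X. x \<oplus> w \<in> X})"
      by (simp add: card_image)
    also have "\<dots> \<le> card {(x, x') \<in> X \<times> X. x \<oplus> x' \<notin> X}"
    proof (rule card_mono)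
      show "finite {(x, x') \<in> X \<times> X. x \<oplus> x' \<notin> X}"
        by (rule finite_subset[of _ "X \<times> X"]) (use fin in auto)
    qed auto
    finally show ?thesis by simp
  qed
  also have "\<dots> \<le> \<kappa> * c\<^sup>2" using bad by (simp add: c_def)
  also have "\<dots> = (2 * \<kappa> * c) * (c / 2)" by (simp add: power2_eq_square)
  finally have "card (V - X) \<le> 2 * \<kappa> * c"
    by (rule mult_right_le_imp_le) (use c in simp)
  then show ?thesis using XV by (intro that[OF finV Vsub V0 Vadd]) (simp_all add: c_def)
qed

section \<open>Product distributions, and disjoint sums of sets as direct sums of vector
  spaces\<close>

lemma Pr_pair_scale:
  assumes "\<And>x. x \<in> set_pmf p \<Longrightarrow> c * Pr q (\<lambda>y. R (x, y)) \<le> Pr q' (\<lambda>y. Q (x, y))"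
  shows "c * Pr (pair_pmf p q) R \<le> Pr (pair_pmf p q') Q"
proof -
  have "c * Pr (pair_pmf p q) R = (\<integral>x. c * Pr q (\<lambda>y. R (x, y)) \<partial>measure_pmf p)"
    unfolding pair_pmf_alt Pr_bind Pr_map by simp
  also have "\<dots> \<le> (\<integral>x. Pr q' (\<lambda>y. Q (x, y)) \<partial>measure_pmf p)"
    using assms by (intro integral_mono_AE integrable_Pr integrable_mult_right) (auto simp: AE_measure_pmf_iff)
  finally show ?thesis unfolding pair_pmf_alt Pr_bind Pr_map .
qed

lemma Pr_finite_set:
  assumes "finite A"
  shows "Pr p (\<lambda>x. x \<in> A) = (\<Sum>x\<in>A. pmf p x)"
  using assms by (simp add: measure_measure_pmf_finite)

lemma pair_pmf_of_set:
  assumes "finite A" "A \<noteq> {}" "finite B" "B \<noteq> {}"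
  shows "pair_pmf (pmf_of_set A) (pmf_of_set B) = pmf_of_set (A \<times> B)"
proof (rule pmf_eqI)
  fix x :: "'a \<times> 'b"
  show "pmf (pair_pmf (pmf_of_set A) (pmf_of_set B)) x = pmf (pmf_of_set (A \<times> B)) x"
    using assms by (cases x) (simp add: pmf_pair indicator_def card_cartesian_product)
qed

lemma mem_Plus [simp]: "Inl a \<in> A <+> B \<longleftrightarrow> a \<in> A" "Inr b \<in> A <+> B \<longleftrightarrow> b \<in> B"
  by auto

text \<open>A subset of a disjoint sum is a vector of the direct sum. In this way the graph of a map
  between two spaces becomes a set of vectors to which \<open>relative_linearity\<close>
  applies.\<close>

lemma xor_Plus: "(A <+> B) \<oplus> (C <+> D) = (A \<oplus> C) <+> (B \<oplus> D)"
proof (rule set_eqI)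
  fix x
  show "x \<in> (A <+> B) \<oplus> (C <+> D) \<longleftrightarrow> x \<in> (A \<oplus> C) <+> (B \<oplus> D)"
    by (cases x) (simp_all only: mem_Plus mem_xor)
qed

lemma Plus_eq_iff: "A <+> B = C <+> D \<longleftrightarrow> A = C \<and> B = D"
proof
  assume eq: "A <+> B = C <+> D"
  have "a \<in> A \<longleftrightarrow> a \<in> C" for a using mem_Plus(1)[of a] eq by metis
  moreover have "b \<in> B \<longleftrightarrow> b \<in> D" for b using mem_Plus(2)[of b] eq by metis
  ultimately show "A = C \<and> B = D" by auto
qed simp

lemma Plus_exhaust: obtains A B where "x = A <+> B"
proof
  show "x = {a. Inl a \<in> x} <+> {b. Inr b \<in> x}"
  proof (rule set_eqI)
    fix z show "z \<in> x \<longleftrightarrow> z \<in> {a. Inl a \<in> x} <+> {b. Inr b \<in> x}"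
      by (cases z) (simp_all only: mem_Plus mem_Collect_eq)
  qed
qed

lemma card_Pow_xor:
  assumes "a \<subseteq> N"
  shows "card {x \<in> Pow N. R (a \<oplus> x)} = card {x \<in> Pow N. R x}"
proof -
  have "{x \<in> Pow N. R x} = (\<lambda>x. x \<oplus> a) ` {x \<in> Pow N. R (a \<oplus> x)}"
  proof (intro equalityI subsetI)
    fix x assume x: "x \<in> {x \<in> Pow N. R x}"
    show "x \<in> (\<lambda>x. x \<oplus> a) ` {x \<in> Pow N. R (a \<oplus> x)}"
      by (rule image_eqI[of _ _ "x \<oplus> a"]) (use x assms in \<open>simp_all add: xor_ac xor_subset\<close>)
  next
    fix x assume "x \<in> (\<lambda>x. x \<oplus> a) ` {x \<in> Pow N. R (a \<oplus> x)}"
    then obtain u where "u \<subseteq> N" "R (a \<oplus> u)" "x = u \<oplus> a" by auto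
    then show "x \<in> {x \<in> Pow N. R x}"
      using assms by (simp add: xor_subset xor_commute)
  qed
  then show ?thesis by (metis card_xor_image)
qed

section \<open>Soundness of a single test\<close>

text \<open>
  One test, at the base point \<open>y\<close>: \<open>h w\<close> is the set of blocks whose literal holds at \<open>w\<close>,
  \<open>D \<beta>\<close> the translation that flips the literals of the blocks in \<open>\<beta>\<close>, \<open>G\<close> the hypothesis, and
  \<open>w'\<close> is \<open>z'\<close> with the mask \<open>r\<close> of \<open>z \<oplus> y\<close> added. The last conjunct says that a literal on which
  \<open>z\<close> and \<open>y\<close> agree is not changed by that mask, as is the case for a coordinate.
\<close>

definition passes where
  "passes F D h y G = (\<lambda>(z, r, z', \<beta>).
     let w = z \<oplus> z' \<oplus> y; w' = z' \<oplus> ((z \<oplus> y) \<inter> r)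
     in F z = G (h z) \<and> (\<forall>x\<in>{z, w, w'}. F (x \<oplus> D \<beta>) = G (h x \<oplus> \<beta>)) \<and>
        h w = h z \<oplus> h z' \<oplus> h y \<and> h w' \<oplus> h z' \<subseteq> h z \<oplus> h y)"

text \<open>The properties of \<open>D\<close> and \<open>h\<close> assumed here hold for
  \<open>shift\<close> and \<open>hash\<close> of any function whatsoever. \<open>P\<close> is the
  law of a sample with randomly flipped literals, and the distribution in \<open>fail\<close> is
  that of a single test.\<close>

locale tester_run =
  fixes n m :: nat and F :: "nat set \<Rightarrow> bool" and D h :: "nat set \<Rightarrow> nat set"
    and y :: "nat set" and G :: "nat set \<Rightarrow> bool" and S P and \<delta> :: real
  defines "S \<equiv> {A \<in> Pow {..<n}. F A}"
  defines "P \<equiv> map_pmf (\<lambda>(s, b). s \<oplus> D b) (pair_pmf (pmf_of_set S) (pmf_of_set (Pow {..<m})))"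
  assumes D_add: "\<And>b b'. D (b \<oplus> b') = D b \<oplus> D b'" and D_sub: "\<And>b. D b \<subseteq> {..<n}"
    and y_sub: "y \<subseteq> {..<n}" and h_sub: "\<And>w. h w \<subseteq> {..<m}"
    and S_ne: "S \<noteq> {}" and G_half: "2 ^ m \<le> 2 * card {b \<in> Pow {..<m}. G b}"
    and \<delta>: "0 < \<delta>" "\<delta> \<le> 1 / 10 ^ 7"
    and fail: "Pr (pair_pmf P (pair_pmf (pmf_of_set (Pow {..<n}))
                 (pair_pmf P (pmf_of_set (Pow {..<m}))))) (\<lambda>x. \<not> passes F D h y G x) \<le> \<delta>"
begin

abbreviation "UR \<equiv> pmf_of_set (Pow {..<n})"
abbreviation "UM \<equiv> pmf_of_set (Pow {..<m})"
abbreviation "Q \<equiv> pair_pmf P (pair_pmf UR (pair_pmf P UM))"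

lemma finite_S [simp]: "finite S"
  by (simp add: S_def)

lemma card_S: "0 < card S"
  using S_ne by (simp add: card_gt_0_iff)

text \<open>Adding \<open>D b\<close> is an involution, so \<open>cnt w\<close> also counts the
  pairs of a sample and a flip that lead to \<open>w\<close>: it is the density of \<open>P\<close>
  up to normalisation.\<close>

definition cnt where "cnt w = card {b \<in> Pow {..<m}. w \<oplus> D b \<in> S}"

definition T where "T = {w \<in> Pow {..<n}. 2 ^ m \<le> 4 * cnt w}"

lemma finite_T [simp]: "finite T"
  by (simp add: T_def)

lemma pmf_P: "pmf P z = cnt z / (card S * 2 ^ m)"
proof -
  have ne: "S \<times> Pow {..<m} \<noteq> {}" using S_ne by auto
  have "pmf P z = Pr P (\<lambda>x. x = z)" by (simp add: measure_pmf_single)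
  also have "\<dots> = Pr (pmf_of_set (S \<times> Pow {..<m})) (\<lambda>(s, b). s \<oplus> D b = z)"
    unfolding P_def Pr_map using S_ne
    by (subst pair_pmf_of_set) (auto simp: case_prod_unfold)
  also have "\<dots> = card {x \<in> S \<times> Pow {..<m}. case x of (s, b) \<Rightarrow> s \<oplus> D b = z} / card (S \<times> Pow {..<m})"
    using ne by (intro Pr_uniform) auto
  also have "card {x \<in> S \<times> Pow {..<m}. case x of (s, b) \<Rightarrow> s \<oplus> D b = z} = cnt z"
  proof -
    have eq: "{x \<in> S \<times> Pow {..<m}. case x of (s, b) \<Rightarrow> s \<oplus> D b = z}
      = (\<lambda>b. (z \<oplus> D b, b)) ` {b \<in> Pow {..<m}. z \<oplus> D b \<in> S}"
      by (auto simp: xor_ac)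
    show ?thesis unfolding cnt_def eq by (intro card_image inj_onI) auto
  qed
  finally show ?thesis by (simp add: card_cartesian_product card_Pow)
qed

lemma cnt_le: "cnt w \<le> 2 ^ m"
  unfolding cnt_def by (rule order.trans[OF card_mono[of "Pow {..<m}"]]) (auto simp: card_Pow)

lemma P_le:
  assumes "finite A"
  shows "Pr P (\<lambda>w. w \<in> A) \<le> card A / card S"
proof -
  have "Pr P (\<lambda>w. w \<in> A) = (\<Sum>w\<in>A. pmf P w)" using assms by (rule Pr_finite_set)
  also have "\<dots> \<le> (\<Sum>w\<in>A. 1 / card S)"
  proof (rule sum_mono)
    fix w
    have "real (cnt w) \<le> 2 ^ m" using of_nat_mono[OF cnt_le[of w], where 'a = real] by simp
    then show "pmf P w \<le> 1 / card S" unfolding pmf_P using card_S by (simp add: field_simps)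
  qed
  finally show ?thesis by simp
qed

lemma P_shift_le:
  assumes "finite A"
  shows "Pr P (\<lambda>w. w \<oplus> a \<in> A) \<le> card A / card S"
proof -
  have "Pr P (\<lambda>w. w \<oplus> a \<in> A) = Pr P (\<lambda>w. w \<in> (\<lambda>x. x \<oplus> a) ` A)"
  proof (rule Pr_cong)
    fix w show "w \<oplus> a \<in> A \<longleftrightarrow> w \<in> (\<lambda>x. x \<oplus> a) ` A"
      by (auto simp: xor_ac intro: image_eqI[of _ _ "w \<oplus> a"])
  qed
  also have "\<dots> \<le> card ((\<lambda>x. x \<oplus> a) ` A) / card S" using assms by (intro P_le) simp
  finally show ?thesis by simp
qed

lemma P_ge:
  assumes "A \<subseteq> T"
  shows "card A / (4 * card S) \<le> Pr P (\<lambda>w. w \<in> A)"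
proof -
  have fin: "finite A" using assms finite_T finite_subset by blast
  have "card A / (4 * card S) = (\<Sum>w\<in>A. 1 / (4 * card S))" by simp
  also have "\<dots> \<le> (\<Sum>w\<in>A. pmf P w)"
  proof (rule sum_mono)
    fix w assume "w \<in> A"
    then have "2 ^ m \<le> 4 * cnt w" using assms by (auto simp: T_def)
    from of_nat_mono[OF this, where 'a = real] have "(2::real) ^ m \<le> 4 * cnt w" by simp
    then show "1 / (4 * card S) \<le> pmf P w" unfolding pmf_P using card_S by (simp add: field_simps)
  qed
  also have "\<dots> = Pr P (\<lambda>w. w \<in> A)" using fin by (rule Pr_finite_set[symmetric])
  finally show ?thesis .
qed

lemma set_P:
  assumes "w \<in> set_pmf P"
  shows "w \<subseteq> {..<n}"
proof -
  obtain s b where "w = s \<oplus> D b" "s \<in> S"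
    using assms S_ne by (auto simp: P_def set_pmf_of_set)
  then show ?thesis using D_sub[of b] xor_subset[of s "{..<n}" "D b"] by (simp add: S_def)
qed

lemma set_UR [simp]: "set_pmf UR = Pow {..<n}"
  by (simp add: set_pmf_of_set Pow_not_empty)

text \<open>Outside \<open>T\<close> fewer than a quarter of the flips satisfy \<open>F\<close>,
  whereas \<open>G\<close> accepts at least half of the patterns
  \<open>h w \<oplus> \<beta>\<close>; they disagree on the difference.\<close>

lemma not_T:
  assumes "w \<notin> T" "w \<subseteq> {..<n}"
  shows "1 / 4 \<le> Pr UM (\<lambda>\<beta>. F (w \<oplus> D \<beta>) \<noteq> G (h w \<oplus> \<beta>))"
proof -
  let ?U = "Pow {..<m}"
  have "card {\<beta> \<in> ?U. G (h w \<oplus> \<beta>)} = card {b \<in> ?U. G b}"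
    by (rule card_Pow_xor[where R = G]) (rule h_sub)
  then have 1: "2 ^ m \<le> 2 * card {\<beta> \<in> ?U. G (h w \<oplus> \<beta>)}" using G_half by simp
  have "{\<beta> \<in> ?U. F (w \<oplus> D \<beta>)} = {b \<in> ?U. w \<oplus> D b \<in> S}"
    using xor_subset[OF assms(2) D_sub] by (simp add: S_def)
  then have 2: "4 * card {\<beta> \<in> ?U. F (w \<oplus> D \<beta>)} < 2 ^ m"
    using assms by (simp add: T_def cnt_def)
  have "card {\<beta> \<in> ?U. G (h w \<oplus> \<beta>)}
      \<le> card ({\<beta> \<in> ?U. F (w \<oplus> D \<beta>) \<noteq> G (h w \<oplus> \<beta>)} \<union> {\<beta> \<in> ?U. F (w \<oplus> D \<beta>)})"
    by (intro card_mono) auto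
  also have "\<dots> \<le> card {\<beta> \<in> ?U. F (w \<oplus> D \<beta>) \<noteq> G (h w \<oplus> \<beta>)} + card {\<beta> \<in> ?U. F (w \<oplus> D \<beta>)}"
    by (rule card_Un_le)
  finally have "2 ^ m \<le> 4 * card {\<beta> \<in> ?U. F (w \<oplus> D \<beta>) \<noteq> G (h w \<oplus> \<beta>)}" using 1 2 by linarith
  from of_nat_mono[OF this, where 'a = real]
  have "(2::real) ^ m \<le> 4 * card {\<beta> \<in> ?U. F (w \<oplus> D \<beta>) \<noteq> G (h w \<oplus> \<beta>)}"
    by simp
  then show ?thesis by (subst Pr_uniform) (auto simp: card_Pow field_simps)
qed

text \<open>The flip \<open>\<beta>\<close> is independent of \<open>z\<close>, \<open>r\<close>,
  \<open>z'\<close>, so a tested point outside \<open>T\<close> is caught with conditional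
  probability at least \<open>1 / 4\<close>; this is the factor 4.\<close>

lemma point_not_T:
  assumes "\<And>z r z'. z \<subseteq> {..<n} \<Longrightarrow> r \<subseteq> {..<n} \<Longrightarrow> z' \<subseteq> {..<n} \<Longrightarrow> W z r z' \<subseteq> {..<n}"
    and "\<And>z r z' \<beta>. passes F D h y G (z, r, z', \<beta>) \<Longrightarrow> F (W z r z' \<oplus> D \<beta>) = G (h (W z r z') \<oplus> \<beta>)"
  shows "Pr Q (\<lambda>(z, r, z', \<beta>). W z r z' \<notin> T) \<le> 4 * \<delta>"
proof -
  have "1 / 4 * Pr Q (\<lambda>(z, r, z', \<beta>). W z r z' \<notin> T)
      \<le> Pr Q (\<lambda>(z, r, z', \<beta>). F (W z r z' \<oplus> D \<beta>) \<noteq> G (h (W z r z') \<oplus> \<beta>))"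
  proof (intro Pr_pair_scale, goal_cases)
    case (1 z r z')
    then have "W z r z' \<subseteq> {..<n}" using assms(1) set_P by auto
    then show ?case using not_T[of "W z r z'"] by (cases "W z r z' \<in> T") auto
  qed
  also have "\<dots> \<le> Pr Q (\<lambda>x. \<not> passes F D h y G x)"
    using assms(2) by (intro Pr_mono) auto
  also have "\<dots> \<le> \<delta>" by (rule fail)
  finally show ?thesis by simp
qed

lemma Q_fst: "Pr Q (\<lambda>(z, r, z', \<beta>). R z) = Pr P R"
  using Pr_pair_fst[of P _ R] by (simp add: case_prod_unfold)

lemma Q_third: "Pr Q (\<lambda>(z, r, z', \<beta>). R z') = Pr P R"
proof -
  have "Pr Q (\<lambda>(z, r, z', \<beta>). R z') = Pr (pair_pmf UR (pair_pmf P UM)) (\<lambda>x. R (fst (snd x)))"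
    using Pr_pair_snd[of P "pair_pmf UR (pair_pmf P UM)" "\<lambda>x. R (fst (snd x))"]
    by (simp add: case_prod_unfold)
  also have "\<dots> = Pr (pair_pmf P UM) (\<lambda>x. R (fst x))"
    using Pr_pair_snd[of UR "pair_pmf P UM" "\<lambda>x. R (fst x)"] by simp
  also have "\<dots> = Pr P R" by (rule Pr_pair_fst)
  finally show ?thesis .
qed

lemma Q_13: "Pr (pair_pmf P P) R \<le> Pr Q (\<lambda>(z, r, z', \<beta>). R (z, z'))"
proof -
  have "1 * Pr (pair_pmf P P) R \<le> Pr Q (\<lambda>(z, r, z', \<beta>). R (z, z'))"
  proof (rule Pr_pair_scale)
    fix z
    have "Pr (pair_pmf UR (pair_pmf P UM)) (\<lambda>(r, z', \<beta>). R (z, z'))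
       = Pr (pair_pmf P UM) (\<lambda>x. R (z, fst x))"
      using Pr_pair_snd[of UR "pair_pmf P UM" "\<lambda>x. R (z, fst x)"] by (simp add: case_prod_unfold)
    also have "\<dots> = Pr P (\<lambda>z'. R (z, z'))" by (rule Pr_pair_fst)
    finally show "1 * Pr P (\<lambda>y. R (z, y)) \<le>
      Pr (pair_pmf UR (pair_pmf P UM)) (\<lambda>y. case (z, y) of (z, r, z', \<beta>) \<Rightarrow> R (z, z'))" by simp
  qed
  then show ?thesis by simp
qed

lemma Q_12: "Pr (pair_pmf P UR) R \<le> Pr Q (\<lambda>(z, r, z', \<beta>). R (z, r))"
proof -
  have "1 * Pr (pair_pmf P UR) R \<le> Pr Q (\<lambda>(z, r, z', \<beta>). R (z, r))"
  proof (rule Pr_pair_scale)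
    fix z
    show "1 * Pr UR (\<lambda>y. R (z, y)) \<le>
      Pr (pair_pmf UR (pair_pmf P UM)) (\<lambda>y. case (z, y) of (z, r, z', \<beta>) \<Rightarrow> R (z, r))"
      using Pr_pair_fst[of UR "pair_pmf P UM" "\<lambda>r. R (z, r)"] by (simp add: case_prod_unfold)
  qed
  then show ?thesis by simp
qed

lemma Q_third_le:
  assumes "\<And>z r. z \<subseteq> {..<n} \<Longrightarrow> r \<subseteq> {..<n} \<Longrightarrow> Pr P (\<lambda>z'. R z r z') \<le> c"
  shows "Pr Q (\<lambda>(z, r, z', \<beta>). R z r z') \<le> c"
proof (rule Pr_pair_le, rule Pr_pair_le, goal_cases)
  case (1 z r)
  have "Pr (pair_pmf P UM) (\<lambda>x. R z r (fst x)) = Pr P (R z r)" by (rule Pr_pair_fst)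
  then show ?case using assms[of z r] 1 set_P by (simp add: case_prod_unfold)
qed

lemma P_not_T: "Pr P (\<lambda>z. z \<notin> T) \<le> 4 * \<delta>"
  using point_not_T[of "\<lambda>z r z'. z"] Q_fst[of "\<lambda>z. z \<notin> T"]
  by (simp add: passes_def Let_def)

text \<open>\<open>P\<close> has density at most \<open>1 / card S\<close> everywhere and at least a
  quarter of that on \<open>T\<close>, and by \<open>P_not_T\<close> it puts nearly all its mass on
  \<open>T\<close>.\<close>

lemma card_T_S: "card S \<le> 2 * card T" "card T \<le> 4 * card S"
proof -
  have "1 - 4 * \<delta> \<le> Pr P (\<lambda>z. z \<in> T)" using P_not_T Pr_not[of P "\<lambda>z. z \<in> T"] by simp
  also have "\<dots> \<le> card T / card S" by (rule P_le) simp
  finally have "1 / 2 \<le> card T / card S" using \<delta> by simp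
  then show "card S \<le> 2 * card T" using card_S by (simp add: field_simps)
  have "card T / (4 * card S) \<le> 1" using P_ge[of T] measure_pmf.prob_le_1 order.trans by blast
  then show "card T \<le> 4 * card S" using card_S by (simp add: field_simps)
qed

end

section \<open>Approximate linearity of the typical points and their literals\<close>

context tester_run
begin

text \<open>\<open>320 = 5 * 16 * 4\<close>: a random pair is bad with probability at most
  \<open>4 * \<delta> + \<delta>\<close>, passing from \<open>P\<close> to counting loses 4 in each
  component, and passing from \<open>card S\<close> to \<open>card T\<close> loses 2 in each
  component.\<close>

definition "\<kappa> = 320 * \<delta>"

lemma \<kappa>: "0 < \<kappa>" "\<kappa> \<le> 1 / 10 ^ 4"
  using \<delta> by (simp_all add: \<kappa>_def)

lemma T_ne: "0 < card T"
  using card_T_S(1) card_S by linarith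

lemma real_card_T_S: "real (card S) \<le> 2 * real (card T)" "real (card T) \<le> 4 * real (card S)"
  using card_T_S by linarith+

lemma bad_pairs:
  "card {(w, w') \<in> T \<times> T. w \<oplus> w' \<oplus> y \<notin> T \<or> h (w \<oplus> w' \<oplus> y) \<noteq> h w \<oplus> h w' \<oplus> h y}
     \<le> \<kappa> * (card T)\<^sup>2"
proof -
  let ?bad = "\<lambda>w w'. w \<oplus> w' \<oplus> y \<notin> T \<or> h (w \<oplus> w' \<oplus> y) \<noteq> h w \<oplus> h w' \<oplus> h y"
  let ?B = "{(w, w') \<in> T \<times> T. ?bad w w'}"
  have fin: "finite ?B" by (rule finite_subset[of _ "T \<times> T"]) auto
  have ge: "1 / (4 * card S) \<le> pmf P w" if "w \<in> T" for w
    using P_ge[of "{w}"] that by (simp add: measure_pmf_single)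
  have "card ?B * (1 / (16 * (card S)\<^sup>2)) = (\<Sum>x\<in>?B. 1 / (16 * (card S)\<^sup>2))" by simp
  also have "\<dots> \<le> (\<Sum>x\<in>?B. pmf (pair_pmf P P) x)"
  proof (rule sum_mono)
    fix x assume "x \<in> ?B"
    then obtain w w' where x: "x = (w, w')" "w \<in> T" "w' \<in> T" by auto
    have "1 / (4 * card S) * (1 / (4 * card S)) \<le> pmf P w * pmf P w'"
      using ge x by (intro mult_mono) auto
    then show "1 / (16 * (card S)\<^sup>2) \<le> pmf (pair_pmf P P) x"
      by (simp add: x pmf_pair power2_eq_square)
  qed
  also have "\<dots> = Pr (pair_pmf P P) (\<lambda>x. x \<in> ?B)" using fin by (rule Pr_finite_set[symmetric])
  also have "\<dots> \<le> Pr Q (\<lambda>(z, r, z', \<beta>). (z, z') \<in> ?B)" by (rule Q_13)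
  also have "\<dots> \<le> Pr Q (\<lambda>x. (case x of (z, r, z', \<beta>) \<Rightarrow> z \<oplus> z' \<oplus> y \<notin> T) \<or>
      (case x of (z, r, z', \<beta>) \<Rightarrow> h (z \<oplus> z' \<oplus> y) \<noteq> h z \<oplus> h z' \<oplus> h y))"
    by (intro Pr_mono) auto
  also have "\<dots> \<le> Pr Q (\<lambda>(z, r, z', \<beta>). z \<oplus> z' \<oplus> y \<notin> T) +
      Pr Q (\<lambda>(z, r, z', \<beta>). h (z \<oplus> z' \<oplus> y) \<noteq> h z \<oplus> h z' \<oplus> h y)"
    by (rule Pr_disj)
  also have "\<dots> \<le> 4 * \<delta> + \<delta>"
  proof (rule add_mono)
    show "Pr Q (\<lambda>(z, r, z', \<beta>). z \<oplus> z' \<oplus> y \<notin> T) \<le> 4 * \<delta>"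
      using y_sub by (intro point_not_T) (auto simp: passes_def Let_def xor_def)
    show "Pr Q (\<lambda>(z, r, z', \<beta>). h (z \<oplus> z' \<oplus> y) \<noteq> h z \<oplus> h z' \<oplus> h y) \<le> \<delta>"
      by (rule order.trans[OF Pr_mono fail]) (auto simp: passes_def Let_def)
  qed
  finally have "real (card ?B) / (16 * (card S)\<^sup>2) \<le> 5 * \<delta>" by simp
  moreover have "0 < real (16 * (card S)\<^sup>2)" using S_ne by simp
  ultimately have "card ?B \<le> 5 * \<delta> * (16 * (card S)\<^sup>2)"
    by (simp only: pos_divide_le_eq)
  also have "\<dots> = 80 * \<delta> * (real (card S))\<^sup>2" by simp
  also have "\<dots> \<le> 80 * \<delta> * (2 * real (card T))\<^sup>2"
    using \<delta> real_card_T_S(1) by (intro mult_left_mono power_mono) simp_all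
  also have "\<dots> = \<kappa> * (card T)\<^sup>2" by (simp add: \<kappa>_def power2_eq_square)
  finally show ?thesis .
qed

lemma linear_structure:
  obtains V L where "finite V" "V \<subseteq> Pow {..<n}" "{} \<in> V"
    "\<And>u v. u \<in> V \<Longrightarrow> v \<in> V \<Longrightarrow> u \<oplus> v \<in> V"
    "\<And>u v. u \<in> V \<Longrightarrow> v \<in> V \<Longrightarrow> L (u \<oplus> v) = L u \<oplus> L v"
    "card {w \<in> T. w \<oplus> y \<notin> V \<or> h w \<oplus> h y \<noteq> L (w \<oplus> y)} \<le> 8 * \<kappa> * card T"
    "card {v \<in> V. v \<oplus> y \<notin> T \<or> h (v \<oplus> y) \<oplus> h y \<noteq> L v} \<le> 2 * \<kappa> * card T"
proof -
  \<comment> \<open>Relative to the base point the affine relation becomes linear: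
    \<open>e w \<oplus> e w'\<close> is again a value of \<open>e\<close> exactly when the literals
    are additive at \<open>w\<close>, \<open>w'\<close>, \<open>y\<close>.\<close>
  define e where "e w = (w \<oplus> y) <+> (h w \<oplus> h y)" for w
  define X where "X = e ` T"
  have inj_e: "w = w'" if "e w = e w'" for w w'
    using that by (simp add: e_def Plus_eq_iff xor_eq_iff xor_ac)
  have e_xor: "e w \<oplus> e w' = e (w \<oplus> w' \<oplus> y) \<longleftrightarrow> h (w \<oplus> w' \<oplus> y) = h w \<oplus> h w' \<oplus> h y" for w w'
  proof -
    have "h w \<oplus> h y \<oplus> (h w' \<oplus> h y) = h (w \<oplus> w' \<oplus> y) \<oplus> h y
        \<longleftrightarrow> h (w \<oplus> w' \<oplus> y) = h w \<oplus> h w' \<oplus> h y"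
      by (auto simp: set_eq_iff)
    moreover have "w \<oplus> y \<oplus> (w' \<oplus> y) = w \<oplus> w' \<oplus> y \<oplus> y" by (simp add: xor_ac)
    ultimately show ?thesis by (simp only: e_def xor_Plus Plus_eq_iff) simp
  qed
  have finX: "finite X" by (simp add: X_def)
  have cX: "card X = card T"
    unfolding X_def by (intro card_image inj_onI inj_e)
  have Xne: "X \<noteq> {}" using T_ne by (auto simp: X_def)
  let ?bad = "\<lambda>w w'. w \<oplus> w' \<oplus> y \<notin> T \<or> h (w \<oplus> w' \<oplus> y) \<noteq> h w \<oplus> h w' \<oplus> h y"
  have "{(x, x') \<in> X \<times> X. x \<oplus> x' \<notin> X} \<subseteq> (\<lambda>(w, w'). (e w, e w')) ` {(w, w') \<in> T \<times> T. ?bad w w'}"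
  proof
    fix p assume "p \<in> {(x, x') \<in> X \<times> X. x \<oplus> x' \<notin> X}"
    then obtain x x' where p: "p = (x, x')" "x \<in> X" "x' \<in> X" "x \<oplus> x' \<notin> X"
      by (cases p) simp
    from p(2,3) obtain w w' where w: "w \<in> T" "w' \<in> T" "x = e w" "x' = e w'"
      unfolding X_def by blast
    have "?bad w w'"
    proof (rule ccontr)
      assume "\<not> ?bad w w'"
      then have "w \<oplus> w' \<oplus> y \<in> T" "e w \<oplus> e w' = e (w \<oplus> w' \<oplus> y)"
        using e_xor[of w w'] by blast+
      then have "x \<oplus> x' \<in> X" unfolding w(3,4) X_def by (metis imageI)
      with p(4) show False by blast
    qed
    then show "p \<in> (\<lambda>(w, w'). (e w, e w')) ` {(w, w') \<in> T \<times> T. ?bad w w'}"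
      using p(1) w by (intro image_eqI[of _ _ "(w, w')"]) (unfold case_prod_conv, blast+)
  qed
  then have "card {(x, x') \<in> X \<times> X. x \<oplus> x' \<notin> X} \<le> card {(w, w') \<in> T \<times> T. ?bad w w'}"
    by (rule surj_card_le[rotated]) (rule finite_subset[of _ "T \<times> T"], auto)
  then have bd: "card {(x, x') \<in> X \<times> X. x \<oplus> x' \<notin> X} \<le> \<kappa> * (card X)\<^sup>2"
    using bad_pairs unfolding cX by linarith
  have \<kappa>100: "\<kappa> \<le> 1 / 100" using \<kappa> by simp
  obtain W where W: "finite W" "W \<subseteq> {x \<oplus> x' | x x'. x \<in> X \<and> x' \<in> X}" "{} \<in> W"
    "\<And>u v. u \<in> W \<Longrightarrow> v \<in> W \<Longrightarrow> u \<oplus> v \<in> W"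
    "card (X - W) \<le> 8 * \<kappa> * card X" "card (W - X) \<le> 2 * \<kappa> * card X"
    by (rule relative_linearity[OF finX bd \<kappa>(1) \<kappa>100 Xne]) (rule that; (assumption | iprover))
  \<comment> \<open>A nonzero vector of \<open>W\<close> with first component \<open>{}\<close>
    would move every point of a graph off the graph, hence \<open>X \<inter> W\<close> injectively
    into \<open>W - X\<close>; but the former is nearly all of \<open>X\<close> and the latter a
    small fraction of it.\<close>
  have graph: "u = {}" if u: "{} <+> u \<in> W" for u
  proof (rule ccontr)
    assume "u \<noteq> {}"
    have "(\<lambda>x. x \<oplus> ({} <+> u)) ` (X \<inter> W) \<subseteq> W - X"
    proof (rule image_subsetI)
      fix x assume "x \<in> X \<inter> W"
      then have x: "x \<in> X" "x \<in> W" by blast+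
      from x(1) obtain w where w: "x = e w" unfolding X_def by blast
      have "x \<oplus> ({} <+> u) \<notin> X"
      proof
        assume "x \<oplus> ({} <+> u) \<in> X"
        then obtain w' where "e w \<oplus> ({} <+> u) = e w'" unfolding w X_def by blast
        then have "w \<oplus> y = w' \<oplus> y" and hu: "h w \<oplus> h y \<oplus> u = h w' \<oplus> h y"
          by (simp_all add: e_def xor_Plus Plus_eq_iff)
        then have "w = w'" by (metis xor_commute xor_self(2))
        with hu have "u = {}" by (metis xor_self(2,3))
        with \<open>u \<noteq> {}\<close> show False by blast
      qed
      with x W(4)[OF x(2) u] show "x \<oplus> ({} <+> u) \<in> W - X" by simp
    qed
    then have "card ((\<lambda>x. x \<oplus> ({} <+> u)) ` (X \<inter> W)) \<le> card (W - X)"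
      using W(1) by (intro card_mono) auto
    then have "real (card (X \<inter> W)) \<le> 2 * \<kappa> * card X" using W(6) by simp
    moreover have "real (card (X \<inter> W)) + real (card (X - W)) = card X"
      using card_Int_Diff[OF finX, of W] by simp
    ultimately have "card X \<le> 10 * \<kappa> * card X" using W(5) by linarith
    moreover have "10 * \<kappa> * real (card X) < 1 * real (card X)"
      using \<kappa> T_ne by (intro mult_strict_right_mono) (simp_all add: cX)
    ultimately show False by simp
  qed
  define V where "V = {v. \<exists>u. v <+> u \<in> W}"
  \<comment> \<open>By \<open>graph\<close> the choice is unique, so \<open>W\<close> is the graph
    of \<open>L\<close>, and additivity of \<open>L\<close> is closure of \<open>W\<close>.\<close>
  define L where "L v = (SOME u. v <+> u \<in> W)" for v
  have L: "v <+> L v \<in> W" if "v \<in> V" for v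
    using someI_ex[of "\<lambda>u. v <+> u \<in> W"] that unfolding V_def L_def by simp
  have uniq: "u = L v" if "v <+> u \<in> W" for u v
  proof -
    have "v \<in> V" using that by (auto simp: V_def)
    from W(4)[OF that L[OF this]] have "{} <+> (u \<oplus> L v) \<in> W" by (simp add: xor_Plus)
    from graph[OF this] show ?thesis by simp
  qed
  have Vadd: "u \<oplus> v \<in> V \<and> L (u \<oplus> v) = L u \<oplus> L v" if "u \<in> V" "v \<in> V" for u v
  proof -
    have "(u \<oplus> v) <+> (L u \<oplus> L v) \<in> W"
      using W(4)[OF L[OF that(1)] L[OF that(2)]] by (simp add: xor_Plus)
    then show ?thesis using uniq by (auto simp: V_def)
  qed
  have inj: "inj_on (\<lambda>v. v <+> L v) V" by (intro inj_onI) (simp add: Plus_eq_iff)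
  have WV: "W = (\<lambda>v. v <+> L v) ` V"
  proof (intro equalityI subsetI)
    fix x assume x: "x \<in> W"
    obtain v u where "x = v <+> u" by (rule Plus_exhaust)
    with x uniq show "x \<in> (\<lambda>v. v <+> L v) ` V" by (auto simp: V_def)
  qed (auto intro: L)
  have finV: "finite V" using W(1) finite_imageD[OF _ inj] by (simp add: WV)
  have "{} <+> {} \<in> W" using W(3) by (simp add: Plus_def)
  then have V0: "{} \<in> V" unfolding V_def by blast
  have eW: "e w \<in> W \<longleftrightarrow> w \<oplus> y \<in> V \<and> h w \<oplus> h y = L (w \<oplus> y)" for w
    using uniq L by (auto simp: e_def V_def)
  have Vsub: "V \<subseteq> Pow {..<n}"
  proof
    fix v assume "v \<in> V"
    then have "v <+> L v \<in> {x \<oplus> x' | x x'. x \<in> X \<and> x' \<in> X}" using L W(2) by blast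
    then obtain w w' where "w \<in> T" "w' \<in> T" "v <+> L v = e w \<oplus> e w'" unfolding X_def by blast
    then have "v = w \<oplus> y \<oplus> (w' \<oplus> y)" "w \<subseteq> {..<n}" "w' \<subseteq> {..<n}"
      by (simp_all add: e_def xor_Plus Plus_eq_iff T_def)
    then show "v \<in> Pow {..<n}" using y_sub by (simp add: xor_subset)
  qed
  show ?thesis
  proof (rule that[OF finV Vsub V0])
    show "u \<oplus> v \<in> V" "L (u \<oplus> v) = L u \<oplus> L v" if "u \<in> V" "v \<in> V" for u v
      using Vadd[OF that] by auto
    have "e ` {w \<in> T. w \<oplus> y \<notin> V \<or> h w \<oplus> h y \<noteq> L (w \<oplus> y)} = X - W"
      unfolding X_def using eW by blast
    moreover have "card (e ` {w \<in> T. w \<oplus> y \<notin> V \<or> h w \<oplus> h y \<noteq> L (w \<oplus> y)})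
       = card {w \<in> T. w \<oplus> y \<notin> V \<or> h w \<oplus> h y \<noteq> L (w \<oplus> y)}"
      by (intro card_image inj_onI inj_e)
    ultimately show "card {w \<in> T. w \<oplus> y \<notin> V \<or> h w \<oplus> h y \<noteq> L (w \<oplus> y)} \<le> 8 * \<kappa> * card T"
      using W(5) by (simp add: cX)
    have "(\<lambda>v. v <+> L v) ` {v \<in> V. v \<oplus> y \<notin> T \<or> h (v \<oplus> y) \<oplus> h y \<noteq> L v} \<subseteq> W - X"
    proof (rule image_subsetI)
      fix v assume "v \<in> {v \<in> V. v \<oplus> y \<notin> T \<or> h (v \<oplus> y) \<oplus> h y \<noteq> L v}"
      then have v: "v \<in> V" "v \<oplus> y \<notin> T \<or> h (v \<oplus> y) \<oplus> h y \<noteq> L v" by blast+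
      have "v <+> L v \<notin> X"
      proof
        assume "v <+> L v \<in> X"
        then obtain w where w: "w \<in> T" "v = w \<oplus> y" "L v = h w \<oplus> h y"
          unfolding X_def e_def Plus_eq_iff image_iff by blast
        then have "v \<oplus> y = w" by (simp add: xor_ac)
        with w v(2) show False by metis
      qed
      then show "v <+> L v \<in> W - X" using L[OF v(1)] by simp
    qed
    then have "card ((\<lambda>v. v <+> L v) ` {v \<in> V. v \<oplus> y \<notin> T \<or> h (v \<oplus> y) \<oplus> h y \<noteq> L v})
       \<le> card (W - X)"
      using W(1) by (intro card_mono) auto
    moreover have "card ((\<lambda>v. v <+> L v) ` {v \<in> V. v \<oplus> y \<notin> T \<or> h (v \<oplus> y) \<oplus> h y \<noteq> L v})
       = card {v \<in> V. v \<oplus> y \<notin> T \<or> h (v \<oplus> y) \<oplus> h y \<noteq> L v}"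
      by (intro card_image inj_on_subset[OF inj]) auto
    ultimately show "card {v \<in> V. v \<oplus> y \<notin> T \<or> h (v \<oplus> y) \<oplus> h y \<noteq> L v} \<le> 2 * \<kappa> * card T"
      using W(6) by (simp add: cX)
  qed
qed

end

section \<open>From a linear space to a subcube, from linear literals to coordinates\<close>

context tester_run
begin

text \<open>Since \<open>D\<close> is additive, translation by a flip merely permutes the flips
  counted by \<open>cnt\<close>.\<close>

lemma pmf_P_shift:
  assumes "b \<subseteq> {..<m}"
  shows "pmf P (w \<oplus> D b) = pmf P w"
proof -
  have "cnt (w \<oplus> D b) = card {b' \<in> Pow {..<m}. w \<oplus> D (b \<oplus> b') \<in> S}"
    by (simp add: cnt_def D_add xor_assoc)
  also have "\<dots> = cnt w"
    unfolding cnt_def by (rule card_Pow_xor[OF assms, of "\<lambda>b'. w \<oplus> D b' \<in> S"])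
  finally show ?thesis by (simp add: pmf_P)
qed

text \<open>
  If the space \<open>V\<close> contains \<open>v\<close> but not \<open>{i}\<close> for some \<open>i \<in> v\<close>, then at most one of \<open>v \<inter> r\<close> and
  \<open>v \<inter> (r \<oplus> {i})\<close> lies in \<open>V\<close>, so half of the masks leave \<open>V\<close>. Likewise a literal that is the parity
  of two or more coordinates vanishes at many \<open>v\<close> without vanishing at \<open>v \<inter> r\<close>.
\<close>

lemma close_to_literals:
  obtains I A where "I \<subseteq> {..<n}" "\<And>j. A j \<subseteq> I" "\<And>j a a'. a \<in> A j \<Longrightarrow> a' \<in> A j \<Longrightarrow> a = a'"
    "card (sym_diff S {w \<in> Pow {..<n}. w \<oplus> y \<subseteq> I \<and> G ({j. A j \<inter> (w \<oplus> y) \<noteq> {}} \<oplus> h y)})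
       \<le> 12808 * \<delta> * card S"
proof -
  obtain V L where V: "finite V" "V \<subseteq> Pow {..<n}" "{} \<in> V"
    and Vadd: "\<And>u v. u \<in> V \<Longrightarrow> v \<in> V \<Longrightarrow> u \<oplus> v \<in> V"
    and Ladd: "\<And>u v. u \<in> V \<Longrightarrow> v \<in> V \<Longrightarrow> L (u \<oplus> v) = L u \<oplus> L v"
    and TG: "card {w \<in> T. w \<oplus> y \<notin> V \<or> h w \<oplus> h y \<noteq> L (w \<oplus> y)} \<le> 8 * \<kappa> * card T"
    and VG: "card {v \<in> V. v \<oplus> y \<notin> T \<or> h (v \<oplus> y) \<oplus> h y \<noteq> L v} \<le> 2 * \<kappa> * card T"
    by (rule linear_structure) (rule that; (assumption | iprover))
  define Gd where "Gd = {w \<in> T. w \<oplus> y \<in> V \<and> h w \<oplus> h y = L (w \<oplus> y)}"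
  define X where "X = {w \<in> T. w \<oplus> y \<notin> V \<or> h w \<oplus> h y \<noteq> L (w \<oplus> y)}"
  define Y where "Y = {w. w \<oplus> y \<in> V \<and> w \<notin> Gd}"
  have finX [simp]: "finite X" by (simp add: X_def)
  have finG [simp]: "finite Gd" by (simp add: Gd_def)
  have T_split: "T - Gd = X" by (auto simp: Gd_def X_def)
  have Vcancel: "u \<oplus> v \<in> V \<longleftrightarrow> v \<in> V" if "u \<in> V" for u v
    using Vadd[OF that, of v] Vadd[OF that, of "u \<oplus> v"] by (auto simp: xor_ac)
  have xyy: "w \<oplus> y \<oplus> y = w" for w by (simp add: xor_assoc)
  have Y_eq: "Y = (\<lambda>v. v \<oplus> y) ` {v \<in> V. v \<oplus> y \<notin> T \<or> h (v \<oplus> y) \<oplus> h y \<noteq> L v}"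
  proof (intro equalityI subsetI)
    fix w assume "w \<in> Y"
    then show "w \<in> (\<lambda>v. v \<oplus> y) ` {v \<in> V. v \<oplus> y \<notin> T \<or> h (v \<oplus> y) \<oplus> h y \<noteq> L v}"
      by (intro image_eqI[of _ _ "w \<oplus> y"]) (auto simp: Y_def Gd_def xyy)
  next
    fix w assume "w \<in> (\<lambda>v. v \<oplus> y) ` {v \<in> V. v \<oplus> y \<notin> T \<or> h (v \<oplus> y) \<oplus> h y \<noteq> L v}"
    then obtain v where "v \<in> V" "v \<oplus> y \<notin> T \<or> h (v \<oplus> y) \<oplus> h y \<noteq> L v" "w = v \<oplus> y" by blast
    then show "w \<in> Y" by (auto simp: Y_def Gd_def xyy)
  qed
  have finY [simp]: "finite Y" unfolding Y_eq using V(1) by simp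
  have ratio: "real k / card S \<le> 4 * c * \<kappa>" if "real k \<le> c * \<kappa> * card T" "0 \<le> c" for k :: nat and c
  proof -
    have "c * \<kappa> * card T \<le> c * \<kappa> * (4 * card S)"
      using real_card_T_S(2) \<kappa> that(2) by (intro mult_left_mono) auto
    with that(1) have "real k \<le> 4 * c * \<kappa> * card S" by simp
    then show ?thesis using card_S by (simp add: pos_divide_le_eq)
  qed
  have X_le: "card X / card S \<le> 32 * \<kappa>" using ratio[of "card X" 8] TG by (simp add: X_def)
  have Xc: "card X \<le> 8 * \<kappa> * card T" using TG by (simp only: X_def)
  have Yc: "card Y \<le> 2 * \<kappa> * card T" using VG by (simp add: Y_eq)
  then have Y_le: "card Y / card S \<le> 8 * \<kappa>" using ratio[of "card Y" 2] by simp
  \<comment> \<open>\<open>4 * \<delta>\<close> accounts for points outside \<open>T\<close>,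
    \<open>32 * \<kappa>\<close> for the exceptions \<open>X\<close> inside
    \<open>T\<close>.\<close>
  define e where "e = 4 * \<delta> + 32 * \<kappa>"
  have e: "2 * e < 1 / 128" using \<delta> \<kappa> by (simp add: e_def)
  have notG: "Pr P (\<lambda>w. w \<notin> Gd) \<le> e"
  proof -
    have "Pr P (\<lambda>w. w \<notin> Gd) \<le> Pr P (\<lambda>w. w \<notin> T \<or> w \<in> X)"
      using T_split by (intro Pr_mono) auto
    also have "\<dots> \<le> Pr P (\<lambda>w. w \<notin> T) + Pr P (\<lambda>w. w \<in> X)" by (rule Pr_disj)
    also have "\<dots> \<le> 4 * \<delta> + card X / card S" using P_le[of X] P_not_T by simp
    finally show ?thesis using X_le by (simp add: e_def)
  qed
  \<comment> \<open>Translation by a vector outside \<open>V\<close> takes the coset of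
    \<open>V\<close> through \<open>y\<close> off itself, so a good point that stays in
    \<open>T\<close> becomes an exception in \<open>X\<close>. For a vector in \<open>V\<close>, in
    the bound after this one, a good point can only become an exception in \<open>Y\<close>.\<close>
  have out: "Pr P (\<lambda>z. z \<in> Gd \<and> z \<oplus> u \<in> T) \<le> 32 * \<kappa>" if "u \<notin> V" for u
  proof -
    have "Pr P (\<lambda>z. z \<in> Gd \<and> z \<oplus> u \<in> T) \<le> Pr P (\<lambda>z. z \<oplus> u \<in> X)"
    proof (rule Pr_mono)
      fix z assume z: "z \<in> Gd \<and> z \<oplus> u \<in> T"
      have "z \<oplus> u \<oplus> y = (z \<oplus> y) \<oplus> u" by (simp add: xor_ac)
      moreover have "(z \<oplus> y) \<oplus> u \<notin> V" using z that Vcancel[of "z \<oplus> y" u] by (simp add: Gd_def)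
      ultimately show "z \<oplus> u \<in> X" using z by (simp add: X_def)
    qed
    also have "\<dots> \<le> card X / card S" by (rule P_shift_le) simp
    finally show ?thesis using X_le by simp
  qed
  have inside: "Pr P (\<lambda>z. z \<in> Gd \<and> z \<oplus> u \<notin> Gd) \<le> 8 * \<kappa>" if "u \<in> V" for u
  proof -
    have "Pr P (\<lambda>z. z \<in> Gd \<and> z \<oplus> u \<notin> Gd) \<le> Pr P (\<lambda>z. z \<oplus> u \<in> Y)"
    proof (rule Pr_mono)
      fix z assume z: "z \<in> Gd \<and> z \<oplus> u \<notin> Gd"
      have "z \<oplus> u \<oplus> y = (z \<oplus> y) \<oplus> u" by (simp add: xor_ac)
      moreover have "(z \<oplus> y) \<oplus> u \<in> V" using z that Vadd[of "z \<oplus> y" u] by (simp add: Gd_def)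
      ultimately show "z \<oplus> u \<in> Y" using z by (simp add: Y_def)
    qed
    also have "\<dots> \<le> card Y / card S" by (rule P_shift_le) simp
    finally show ?thesis using Y_le by simp
  qed
  define U where "U z r = (z \<oplus> y) \<inter> r" for z r
  \<comment> \<open>The point \<open>z'\<close> is independent of the mask, so the bound
    \<open>out\<close> applies for each mask outside \<open>V\<close>; on the other hand the tests
    rarely let \<open>z' \<oplus> U z r\<close> leave \<open>T\<close>. The sum
    \<open>4 * \<delta> + e + 32 * \<kappa>\<close> is \<open>2 * e\<close>.\<close>
  have U_out: "Pr Q (\<lambda>(z, r, z', \<beta>). U z r \<notin> V) \<le> 2 * e"
  proof -
    have "Pr Q (\<lambda>(z, r, z', \<beta>). U z r \<notin> V)
      \<le> Pr Q (\<lambda>x. (case x of (z, r, z', \<beta>) \<Rightarrow> z' \<oplus> U z r \<notin> T) \<or>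
         ((case x of (z, r, z', \<beta>) \<Rightarrow> z' \<notin> Gd) \<or>
          (case x of (z, r, z', \<beta>) \<Rightarrow> U z r \<notin> V \<and> z' \<in> Gd \<and> z' \<oplus> U z r \<in> T)))"
      by (rule Pr_mono) auto
    also have "\<dots> \<le> Pr Q (\<lambda>(z, r, z', \<beta>). z' \<oplus> U z r \<notin> T) +
        (Pr Q (\<lambda>(z, r, z', \<beta>). z' \<notin> Gd) +
         Pr Q (\<lambda>(z, r, z', \<beta>). U z r \<notin> V \<and> z' \<in> Gd \<and> z' \<oplus> U z r \<in> T))"
      by (rule order.trans[OF Pr_disj]) (intro add_left_mono Pr_disj)
    also have "\<dots> \<le> 4 * \<delta> + (e + 32 * \<kappa>)"
    proof (intro add_mono)
      show "Pr Q (\<lambda>(z, r, z', \<beta>). z' \<oplus> U z r \<notin> T) \<le> 4 * \<delta>"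
        using y_sub by (intro point_not_T) (auto simp: passes_def Let_def xor_def U_def)
      show "Pr Q (\<lambda>(z, r, z', \<beta>). z' \<notin> Gd) \<le> e" using notG by (simp add: Q_third)
      show "Pr Q (\<lambda>(z, r, z', \<beta>). U z r \<notin> V \<and> z' \<in> Gd \<and> z' \<oplus> U z r \<in> T) \<le> 32 * \<kappa>"
      proof (rule Q_third_le)
        fix z r
        show "Pr P (\<lambda>z'. U z r \<notin> V \<and> z' \<in> Gd \<and> z' \<oplus> U z r \<in> T) \<le> 32 * \<kappa>"
          using out[of "U z r"] \<kappa> by (cases "U z r \<in> V") simp_all
      qed
    qed
    finally show ?thesis by (simp add: e_def)
  qed
  \<comment> \<open>The exceptions cost at most half of \<open>card T\<close>, so a quarter of
    \<open>V\<close> yields at least \<open>card T / 8\<close>, hence at least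
    \<open>card S / 16\<close> good points, each of probability at least
    \<open>1 / (4 * card S)\<close>.\<close>
  have many: "1 / 64 \<le> Pr P (\<lambda>z. z \<in> Gd \<and> z \<oplus> y \<in> B)" if B: "B \<subseteq> V" "card V \<le> 4 * card B" for B
  proof -
    define C where "C = {w \<in> Gd. w \<oplus> y \<in> B}"
    have finB: "finite B" using B(1) V(1) by (rule finite_subset)
    have "(\<lambda>v. v \<oplus> y) ` B \<subseteq> C \<union> Y" using B(1) by (auto simp: C_def Y_def xyy)
    then have "card ((\<lambda>v. v \<oplus> y) ` B) \<le> card (C \<union> Y)" by (intro card_mono) (simp_all add: C_def)
    then have 1: "card B \<le> card C + card Y" using card_Un_le[of C Y] by simp
    have "card ((\<lambda>w. w \<oplus> y) ` Gd) \<le> card V" using V(1) by (intro card_mono) (auto simp: Gd_def)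
    then have 2: "card Gd \<le> card V" by simp
    have "T = Gd \<union> X" by (auto simp: Gd_def X_def)
    then have 3: "card T \<le> card Gd + card X" using card_Un_le[of Gd X] by simp
    have "card T \<le> card V + card X" using 2 3 by (meson add_le_mono1 order.trans)
    also have "card V \<le> 4 * (card C + card Y)" using 1 B(2) by (meson mult_le_mono2 order.trans)
    finally have "card T \<le> 4 * (card C + card Y) + card X" by simp
    from of_nat_mono[OF this, where 'a = real]
    have "real (card T) - card X \<le> 4 * (real (card C) + card Y)" by simp
    then have "(1 - 16 * \<kappa>) * card T \<le> 4 * card C"
      using Xc Yc by (simp add: algebra_simps)
    moreover have "1 / 2 * card T \<le> (1 - 16 * \<kappa>) * card T"
      using \<kappa> by (intro mult_right_mono) auto
    ultimately have "card S \<le> 16 * real (card C)" using real_card_T_S(1) by linarith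
    then have "1 / 64 \<le> card C / (4 * card S)" using card_S by (simp add: field_simps)
    also have "\<dots> \<le> Pr P (\<lambda>z. z \<in> C)" by (rule P_ge) (auto simp: C_def Gd_def)
    finally show ?thesis by (simp add: C_def)
  qed
  \<comment> \<open>Toggling \<open>i\<close> in the mask toggles \<open>i\<close> in
    \<open>v \<inter> r\<close>, so the masks that miss \<open>R\<close> inject into those that
    satisfy it.\<close>
  have half: "1 / 2 \<le> Pr UR (\<lambda>r. R (v \<inter> r))"
    if i: "i \<in> v" "v \<subseteq> {..<n}" and R: "\<And>u. u \<subseteq> v \<Longrightarrow> \<not> R u \<Longrightarrow> R (u \<oplus> {i})" for v i R
  proof -
    let ?A = "{r \<in> Pow {..<n}. R (v \<inter> r)}" and ?B = "{r \<in> Pow {..<n}. \<not> R (v \<inter> r)}"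
    have "(\<lambda>r. r \<oplus> {i}) ` ?B \<subseteq> ?A"
    proof (rule image_subsetI)
      fix r assume r: "r \<in> ?B"
      have "v \<inter> (r \<oplus> {i}) = (v \<inter> r) \<oplus> {i}" using i by (auto simp: set_eq_iff)
      moreover have "R ((v \<inter> r) \<oplus> {i})" using r by (intro R) auto
      moreover have "r \<oplus> {i} \<subseteq> {..<n}" using r i by (intro xor_subset) auto
      ultimately show "r \<oplus> {i} \<in> ?A" by simp
    qed
    then have "card ((\<lambda>r. r \<oplus> {i}) ` ?B) \<le> card ?A" by (intro card_mono) auto
    then have le: "card ?B \<le> card ?A" by simp
    have "card (Pow {..<n}) = card (?A \<union> ?B)" by (rule arg_cong[where f = card]) auto
    also have "\<dots> \<le> card ?A + card ?B" by (rule card_Un_le)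
    finally have "2 ^ n \<le> card ?A + card ?B" by (simp add: card_Pow)
    with le have "2 ^ n \<le> 2 * card ?A" by linarith
    from of_nat_mono[OF this, where 'a = real] have "2 ^ n \<le> 2 * real (card ?A)" by simp
    then show ?thesis by (subst Pr_uniform) (auto simp: card_Pow field_simps)
  qed
  define I where "I = {i. {i} \<in> V}"
  have I_sub: "I \<subseteq> {..<n}" using V(2) by (auto simp: I_def)
  have finI: "finite I" using I_sub by (rule finite_subset) simp
  have ins: "insert i v = v \<oplus> {i}" if "i \<notin> v" for i :: nat and v using that by (auto simp: set_eq_iff)
  have PowI: "v \<in> V" if "v \<subseteq> I" for v
  proof -
    have "finite v" using that finI by (rule finite_subset)
    then show ?thesis using that
    proof (induction v rule: finite_induct)
      case (insert i v)
      then have "v \<oplus> {i} \<in> V" by (intro Vadd) (simp_all add: I_def)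
      then show ?case unfolding ins[OF insert.hyps(2)] .
    qed (rule V(3))
  qed
  \<comment> \<open>One vector of \<open>V\<close> outside \<open>Pow I\<close> forces at least half
    of \<open>V\<close> outside, since translation by it maps \<open>Pow I\<close> into the rest.
    Then \<open>z \<oplus> y\<close> is such a vector with probability at least
    \<open>1 / 64\<close>, and half of the masks lead out of \<open>V\<close>, against
    \<open>U_out\<close>.\<close>
  have VI: "v \<subseteq> I" if "v \<in> V" for v
  proof (rule ccontr)
    assume v: "\<not> v \<subseteq> I"
    define B where "B = {u \<in> V. \<not> u \<subseteq> I}"
    have finB: "finite B" using V(1) by (simp add: B_def)
    have "(\<lambda>u. u \<oplus> v) ` Pow I \<subseteq> B"
    proof (rule image_subsetI)
      fix u assume "u \<in> Pow I"
      then have "u \<in> V" "u \<subseteq> I" using PowI by auto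
      moreover from this have "\<not> u \<oplus> v \<subseteq> I"
        using v xor_subset[of u I "u \<oplus> v"] by auto
      ultimately show "u \<oplus> v \<in> B" using that Vadd by (simp add: B_def)
    qed
    then have "card ((\<lambda>u. u \<oplus> v) ` Pow I) \<le> card B" using finB by (intro card_mono)
    then have "card (Pow I) \<le> card B" by simp
    moreover have "V \<subseteq> Pow I \<union> B" by (auto simp: B_def)
    then have "card V \<le> card (Pow I \<union> B)" using finB finI by (intro card_mono) auto
    moreover have "card (Pow I \<union> B) \<le> card (Pow I) + card B" by (rule card_Un_le)
    ultimately have "card V \<le> 4 * card B" by linarith
    then have "1 / 64 \<le> Pr P (\<lambda>z. z \<in> Gd \<and> z \<oplus> y \<in> B)" by (intro many) (auto simp: B_def)
    then have "1 / 128 \<le> 1 / 2 * Pr P (\<lambda>z. z \<in> Gd \<and> z \<oplus> y \<in> B)" by simp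
    also have "\<dots> \<le> Pr (pair_pmf P UR) (\<lambda>(z, r). U z r \<notin> V)"
    proof (rule Pr_pair_ge)
      fix z assume "z \<in> Gd \<and> z \<oplus> y \<in> B"
      then have z: "z \<oplus> y \<in> V" "\<not> z \<oplus> y \<subseteq> I" by (auto simp: B_def)
      then obtain i where i: "i \<in> z \<oplus> y" "{i} \<notin> V" unfolding I_def by blast
      have "1 / 2 \<le> Pr UR (\<lambda>r. (z \<oplus> y) \<inter> r \<notin> V)"
      proof (rule half[OF i(1)])
        show "z \<oplus> y \<subseteq> {..<n}" using z(1) V(2) by blast
        show "u \<oplus> {i} \<notin> V" if "\<not> u \<notin> V" for u using that i(2) Vcancel[of u "{i}"] by simp
      qed
      then show "1 / 2 \<le> Pr UR (\<lambda>r. case (z, r) of (z, r) \<Rightarrow> U z r \<notin> V)" by (simp add: U_def)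
    qed
    also have "\<dots> \<le> Pr Q (\<lambda>(z, r, z', \<beta>). U z r \<notin> V)"
      using Q_12[of "\<lambda>(z, r). U z r \<notin> V"] by simp
    finally show False using U_out e by simp
  qed
  have V_eq: "V = Pow I" using PowI VI by auto
  have UV: "U z r \<in> V" if "z \<in> Gd" for z r
    using that by (auto simp: V_eq U_def Gd_def)
  \<comment> \<open>The support of the linear form \<open>j \<in> L v\<close> on
    \<open>V = Pow I\<close>.\<close>
  define A where "A j = {i \<in> I. j \<in> L {i}}" for j
  have A_one: "i = i'" if i: "i \<in> A j" "i' \<in> A j" for i i' j
  proof (rule ccontr)
    assume ne: "i \<noteq> i'"
    have iV: "{i} \<in> V" "{i'} \<in> V" "j \<in> L {i}" "j \<in> L {i'}" using i by (auto simp: A_def I_def)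
    define B where "B = {v \<in> V. i \<in> v \<and> j \<notin> L v}"
    have finB: "finite B" using V(1) by (simp add: B_def)
    have flip: "v \<oplus> {a} \<in> V \<and> (j \<in> L (v \<oplus> {a}) \<longleftrightarrow> j \<notin> L v)" if "v \<in> V" "a \<in> {i, i'}" for v a
    proof -
      have a: "{a} \<in> V" "j \<in> L {a}" using that(2) iV by blast+
      show ?thesis using Vadd[OF that(1) a(1)] Ladd[OF that(1) a(1)] a(2) by simp
    qed
    \<comment> \<open>Four translates of \<open>B\<close> cover \<open>V\<close>: toggling
      \<open>i\<close> changes both the bit \<open>i\<close> and the literal \<open>j\<close>,
      toggling \<open>i'\<close> changes only the literal. So \<open>B\<close> has at least a
      quarter of \<open>V\<close>, as \<open>many\<close> requires.\<close>
    have "V \<subseteq> (B \<union> (\<lambda>v. v \<oplus> {i}) ` B) \<union> ((\<lambda>v. v \<oplus> {i'}) ` B \<union> (\<lambda>v. v \<oplus> ({i'} \<oplus> {i})) ` B)"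
    proof
      fix v assume v: "v \<in> V"
      consider "j \<notin> L v" "i \<in> v" | "j \<in> L v" "i \<notin> v" | "j \<in> L v" "i \<in> v" | "j \<notin> L v" "i \<notin> v" by blast
      then show "v \<in> (B \<union> (\<lambda>v. v \<oplus> {i}) ` B) \<union> ((\<lambda>v. v \<oplus> {i'}) ` B \<union> (\<lambda>v. v \<oplus> ({i'} \<oplus> {i})) ` B)"
      proof cases
        case 1
        with v show ?thesis by (simp add: B_def)
      next
        case 2
        then have "v \<oplus> {i} \<in> B" using flip[OF v, of i] by (simp add: B_def)
        moreover have "v = (v \<oplus> {i}) \<oplus> {i}" by (simp add: xor_ac)
        ultimately show ?thesis by blast
      next
        case 3
        then have "v \<oplus> {i'} \<in> B" using flip[OF v, of i'] ne by (simp add: B_def)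
        moreover have "v = (v \<oplus> {i'}) \<oplus> {i'}" by (simp add: xor_ac)
        ultimately show ?thesis by blast
      next
        case 4
        then have "v \<oplus> {i} \<in> V" "j \<in> L (v \<oplus> {i})" using flip[OF v, of i] by simp_all
        then have "v \<oplus> {i} \<oplus> {i'} \<in> B" using flip[of "v \<oplus> {i}" i'] ne 4 by (simp add: B_def)
        moreover have "v = (v \<oplus> {i} \<oplus> {i'}) \<oplus> ({i'} \<oplus> {i})" by (simp add: xor_ac)
        ultimately show ?thesis by blast
      qed
    qed
    then have "card V \<le> card ((B \<union> (\<lambda>v. v \<oplus> {i}) ` B) \<union> ((\<lambda>v. v \<oplus> {i'}) ` B \<union> (\<lambda>v. v \<oplus> ({i'} \<oplus> {i})) ` B))"
      using finB by (intro card_mono) auto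
    also have "\<dots> \<le> (card B + card B) + (card B + card B)"
      by (intro order.trans[OF card_Un_le] add_mono) simp_all
    finally have "card V \<le> 4 * card B" by simp
    then have "1 / 64 \<le> Pr P (\<lambda>z. z \<in> Gd \<and> z \<oplus> y \<in> B)" by (intro many) (auto simp: B_def)
    then have "1 / 128 \<le> 1 / 2 * Pr P (\<lambda>z. z \<in> Gd \<and> z \<oplus> y \<in> B)" by simp
    also have "\<dots> \<le> Pr (pair_pmf P UR) (\<lambda>(z, r). z \<in> Gd \<and> j \<notin> L (z \<oplus> y) \<and> j \<in> L (U z r))"
    proof (rule Pr_pair_ge)
      fix z assume "z \<in> Gd \<and> z \<oplus> y \<in> B"
      then have z: "z \<in> Gd" "z \<oplus> y \<in> V" "i \<in> z \<oplus> y" "j \<notin> L (z \<oplus> y)" by (auto simp: B_def)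
      have "1 / 2 \<le> Pr UR (\<lambda>r. j \<in> L ((z \<oplus> y) \<inter> r))"
      proof (rule half[OF z(3)])
        show "z \<oplus> y \<subseteq> {..<n}" using z(2) V(2) by blast
        show "j \<in> L (u \<oplus> {i})" if "u \<subseteq> z \<oplus> y" "j \<notin> L u" for u
          using flip[of u i] that z(2) by (auto simp: V_eq)
      qed
      then show "1 / 2 \<le> Pr UR (\<lambda>r. case (z, r) of (z, r) \<Rightarrow> z \<in> Gd \<and> j \<notin> L (z \<oplus> y) \<and> j \<in> L (U z r))"
        using z by (simp add: U_def)
    qed
    also have "\<dots> \<le> Pr Q (\<lambda>(z, r, z', \<beta>). z \<in> Gd \<and> j \<notin> L (z \<oplus> y) \<and> j \<in> L (U z r))"
      using Q_12[of "\<lambda>(z, r). z \<in> Gd \<and> j \<notin> L (z \<oplus> y) \<and> j \<in> L (U z r)"] by simp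
    also have "\<dots> \<le> Pr Q (\<lambda>x. \<not> passes F D h y G x \<or>
         ((case x of (z, r, z', \<beta>) \<Rightarrow> z' \<notin> Gd) \<or>
          (case x of (z, r, z', \<beta>) \<Rightarrow> U z r \<in> V \<and> z' \<in> Gd \<and> z' \<oplus> U z r \<notin> Gd)))"
    proof (rule Pr_mono)
      fix x :: "nat set \<times> nat set \<times> nat set \<times> nat set"
      assume x: "case x of (z, r, z', \<beta>) \<Rightarrow> z \<in> Gd \<and> j \<notin> L (z \<oplus> y) \<and> j \<in> L (U z r)"
      obtain z r z' \<beta> where x_eq: "x = (z, r, z', \<beta>)" by (cases x)
      then have 1: "z \<in> Gd" "j \<notin> L (z \<oplus> y)" "j \<in> L (U z r)" using x by auto
      \<comment> \<open>If both points are good, adding the mask changes their literals by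
        \<open>L (U z r)\<close>. The last conjunct of \<open>passes\<close> confines this to
        \<open>L (z \<oplus> y)\<close>, which lacks \<open>j\<close>.\<close>
      have "z' \<notin> Gd \<or> z' \<oplus> U z r \<notin> Gd" if p: "passes F D h y G (z, r, z', \<beta>)"
      proof (rule ccontr)
        assume "\<not> (z' \<notin> Gd \<or> z' \<oplus> U z r \<notin> Gd)"
        then have z': "z' \<in> Gd" and w: "z' \<oplus> U z r \<in> Gd" by auto
        have U: "U z r \<in> V" using 1 UV by blast
        have "h (z' \<oplus> U z r) \<oplus> h z' \<subseteq> h z \<oplus> h y" using p by (simp add: passes_def Let_def U_def)
        also have "h z \<oplus> h y = L (z \<oplus> y)" using 1 by (simp add: Gd_def)
        finally have "h (z' \<oplus> U z r) \<oplus> h z' \<subseteq> L (z \<oplus> y)" .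
        moreover have "h (z' \<oplus> U z r) \<oplus> h y = L ((z' \<oplus> y) \<oplus> U z r)"
          using w by (simp add: Gd_def xor_ac)
        moreover have "L ((z' \<oplus> y) \<oplus> U z r) = L (z' \<oplus> y) \<oplus> L (U z r)"
          using z' U by (intro Ladd) (auto simp: Gd_def)
        moreover have "h z' \<oplus> h y = L (z' \<oplus> y)" using z' by (simp add: Gd_def)
        ultimately have "L (U z r) \<subseteq> L (z \<oplus> y)"
          by (metis xor_assoc xor_commute xor_self(2))
        with 1 show False by blast
      qed
      then show "\<not> passes F D h y G x \<or> (case x of (z, r, z', \<beta>) \<Rightarrow> z' \<notin> Gd) \<or>
          (case x of (z, r, z', \<beta>) \<Rightarrow> U z r \<in> V \<and> z' \<in> Gd \<and> z' \<oplus> U z r \<notin> Gd)"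
        using UV[OF 1(1), of r] by (auto simp: x_eq)
    qed
    also have "\<dots> \<le> Pr Q (\<lambda>x. \<not> passes F D h y G x) +
        (Pr Q (\<lambda>(z, r, z', \<beta>). z' \<notin> Gd) +
         Pr Q (\<lambda>(z, r, z', \<beta>). U z r \<in> V \<and> z' \<in> Gd \<and> z' \<oplus> U z r \<notin> Gd))"
      by (rule order.trans[OF Pr_disj]) (intro add_left_mono Pr_disj)
    also have "\<dots> \<le> \<delta> + (e + 8 * \<kappa>)"
    proof (intro add_mono fail)
      show "Pr Q (\<lambda>(z, r, z', \<beta>). z' \<notin> Gd) \<le> e" using notG by (simp add: Q_third)
      show "Pr Q (\<lambda>(z, r, z', \<beta>). U z r \<in> V \<and> z' \<in> Gd \<and> z' \<oplus> U z r \<notin> Gd) \<le> 8 * \<kappa>"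
      proof (rule Q_third_le)
        fix z r
        show "Pr P (\<lambda>z'. U z r \<in> V \<and> z' \<in> Gd \<and> z' \<oplus> U z r \<notin> Gd) \<le> 8 * \<kappa>"
          using inside[of "U z r"] \<kappa> by (cases "U z r \<in> V") simp_all
      qed
    qed
    finally show False using e \<delta> \<kappa> by (simp add: e_def)
  qed
  have L_eq: "L v = {j. A j \<inter> v \<noteq> {}}" if "v \<subseteq> I" for v
  proof -
    have "finite v" using that finI by (rule finite_subset)
    then show ?thesis using that
    proof (induction v rule: finite_induct)
      case empty
      have "L {} = L {} \<oplus> L {}" using Ladd[OF V(3) V(3)] by simp
      then show ?case by simp
    next
      case (insert i v)
      have "v \<in> V" "{i} \<in> V" using insert.prems by (simp_all add: V_eq)
      then have "L (insert i v) = L v \<oplus> L {i}"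
        unfolding ins[OF insert.hyps(2)] by (rule Ladd)
      moreover have "L v = {j. A j \<inter> v \<noteq> {}}" using insert.prems by (intro insert.IH) blast
      ultimately have L1: "L (insert i v) = {j. A j \<inter> v \<noteq> {}} \<oplus> L {i}" by simp
      have "j \<in> L (insert i v) \<longleftrightarrow> A j \<inter> insert i v \<noteq> {}" for j
      proof (cases "i \<in> A j")
        case True
        then have "A j \<inter> v = {}" using A_one[OF True] insert.hyps(2) by blast
        with True show ?thesis unfolding L1 by (simp add: A_def)
      next
        case False
        then have "j \<notin> L {i}" using insert.prems by (simp add: A_def)
        with False show ?thesis unfolding L1 by simp
      qed
      then show ?case by blast
    qed
  qed
  \<comment> \<open>\<open>P\<close> is invariant under adding \<open>D b\<close>. If
    \<open>D b\<close> were outside \<open>V\<close>, then \<open>Gd\<close> and its translate would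
    be disjoint events of the same probability, which exceeds \<open>1 / 2\<close>.\<close>
  have DV: "D b \<in> V" if b: "b \<subseteq> {..<m}" for b
  proof (rule ccontr)
    assume nV: "D b \<notin> V"
    let ?G' = "(\<lambda>w. w \<oplus> D b) ` Gd"
    have "Gd \<inter> ?G' = {}"
    proof (rule ccontr)
      assume "Gd \<inter> ?G' \<noteq> {}"
      then obtain w where "w \<in> Gd" "w \<oplus> D b \<in> Gd" by blast
      then have "w \<oplus> y \<in> V" "w \<oplus> D b \<oplus> y \<in> V" by (simp_all add: Gd_def)
      moreover have "w \<oplus> D b \<oplus> y = (w \<oplus> y) \<oplus> D b" by (simp add: xor_ac)
      ultimately show False using Vcancel[of "w \<oplus> y" "D b"] nV by simp
    qed
    then have "Pr P (\<lambda>w. w \<in> Gd \<union> ?G') = (\<Sum>w\<in>Gd. pmf P w) + (\<Sum>w\<in>?G'. pmf P w)"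
      by (subst Pr_finite_set) (simp_all add: sum.union_disjoint)
    also have "(\<Sum>w\<in>?G'. pmf P w) = (\<Sum>w\<in>Gd. pmf P w)"
      by (subst sum.reindex[OF inj_xor]) (simp add: pmf_P_shift[OF b])
    also have "(\<Sum>w\<in>Gd. pmf P w) = Pr P (\<lambda>w. w \<in> Gd)" by (rule Pr_finite_set[symmetric]) simp
    finally have "2 * Pr P (\<lambda>w. w \<in> Gd) \<le> 1" using measure_pmf.prob_le_1[of P "{w. w \<in> Gd \<union> ?G'}"] by linarith
    then show False using notG e Pr_not[of P "\<lambda>w. w \<in> Gd"] by simp
  qed
  define g where "g w \<longleftrightarrow> w \<oplus> y \<subseteq> I \<and> G ({j. A j \<inter> (w \<oplus> y) \<noteq> {}} \<oplus> h y)" for w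
  have "sym_diff S {w \<in> Pow {..<n}. g w}
     \<subseteq> {s \<in> S. s \<oplus> y \<notin> V} \<union> ({w \<in> Gd. F w \<noteq> G (h w)} \<union> Y)"
  proof
    fix w assume w: "w \<in> sym_diff S {w \<in> Pow {..<n}. g w}"
    show "w \<in> {s \<in> S. s \<oplus> y \<notin> V} \<union> ({w \<in> Gd. F w \<noteq> G (h w)} \<union> Y)"
    proof (rule ccontr)
      assume neg: "\<not> ?thesis"
      have "w \<oplus> y \<in> V" using w neg by (auto simp: g_def V_eq)
      then have G: "w \<in> Gd" using neg by (auto simp: Y_def)
      then have "F w = G (h w)" using neg by auto
      also have "h w = L (w \<oplus> y) \<oplus> h y"
        using G xor_eq_iff[of "h w" "h y" "L (w \<oplus> y)"] by (simp add: Gd_def)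
      finally have "F w \<longleftrightarrow> g w" using \<open>w \<oplus> y \<in> V\<close> L_eq[of "w \<oplus> y"] by (simp add: g_def V_eq)
      moreover have "w \<in> Pow {..<n}" using G by (simp add: Gd_def T_def)
      ultimately show False using w by (auto simp: S_def)
    qed
  qed
  then have "card (sym_diff S {w \<in> Pow {..<n}. g w})
     \<le> card ({s \<in> S. s \<oplus> y \<notin> V} \<union> ({w \<in> Gd. F w \<noteq> G (h w)} \<union> Y))"
    by (intro card_mono) auto
  also have "\<dots> \<le> card {s \<in> S. s \<oplus> y \<notin> V} + (card {w \<in> Gd. F w \<noteq> G (h w)} + card Y)"
    by (rule order.trans[OF card_Un_le]) (intro add_left_mono card_Un_le)
  finally have "card (sym_diff S {w \<in> Pow {..<n}. g w})
     \<le> real (card {s \<in> S. s \<oplus> y \<notin> V}) + (real (card {w \<in> Gd. F w \<noteq> G (h w)}) + real (card Y))"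
    by linarith
  also have "\<dots> \<le> e * card S + (4 * \<delta> * card S + 8 * \<kappa> * card S)"
  proof (intro add_mono)
    \<comment> \<open>Flips stay in \<open>V\<close>, so they do not affect membership in the coset;
      hence the estimate for \<open>P\<close> carries over to the uniform law on
      \<open>S\<close>.\<close>
    have "Pr P (\<lambda>w. w \<oplus> y \<notin> V) = Pr (pair_pmf (pmf_of_set S) UM) (\<lambda>(s, b). s \<oplus> D b \<oplus> y \<notin> V)"
      unfolding P_def Pr_map by (simp add: case_prod_unfold)
    also have "\<dots> = Pr (pair_pmf (pmf_of_set S) UM) (\<lambda>x. fst x \<oplus> y \<notin> V)"
    proof (rule Pr_cong, clarify)
      fix s b assume "(s, b) \<in> set_pmf (pair_pmf (pmf_of_set S) UM)"
      then have "D b \<in> V" using DV by (simp add: set_pmf_of_set Pow_not_empty)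
      moreover have "s \<oplus> D b \<oplus> y = D b \<oplus> (s \<oplus> y)" by (simp add: xor_ac)
      ultimately show "s \<oplus> D b \<oplus> y \<notin> V \<longleftrightarrow> fst (s, b) \<oplus> y \<notin> V" using Vcancel by simp
    qed
    also have "\<dots> = Pr (pmf_of_set S) (\<lambda>s. s \<oplus> y \<notin> V)"
      by (rule Pr_pair_fst)
    also have "\<dots> = card {s \<in> S. s \<oplus> y \<notin> V} / card S" using S_ne by (intro Pr_uniform) auto
    finally have "card {s \<in> S. s \<oplus> y \<notin> V} / card S = Pr P (\<lambda>w. w \<oplus> y \<notin> V)" ..
    also have "\<dots> \<le> Pr P (\<lambda>w. w \<notin> Gd)" by (rule Pr_mono) (auto simp: Gd_def)
    also have "\<dots> \<le> e" by (rule notG)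
    finally show "card {s \<in> S. s \<oplus> y \<notin> V} \<le> e * card S" using card_S by (simp add: pos_divide_le_eq)
    have "card {w \<in> Gd. F w \<noteq> G (h w)} / (4 * card S) \<le> Pr P (\<lambda>w. w \<in> {w \<in> Gd. F w \<noteq> G (h w)})"
      by (rule P_ge) (auto simp: Gd_def)
    also have "\<dots> \<le> Pr P (\<lambda>w. F w \<noteq> G (h w))" by (rule Pr_mono) auto
    also have "\<dots> = Pr Q (\<lambda>(z, r, z', \<beta>). F z \<noteq> G (h z))" by (rule Q_fst[symmetric])
    also have "\<dots> \<le> \<delta>"
      by (rule order.trans[OF Pr_mono fail]) (auto simp: passes_def Let_def)
    finally show "card {w \<in> Gd. F w \<noteq> G (h w)} \<le> 4 * \<delta> * card S"
      using card_S by (simp add: pos_divide_le_eq)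
    show "card Y \<le> 8 * \<kappa> * card S" using Y_le card_S by (simp add: pos_divide_le_eq)
  qed
  \<comment> \<open>With \<open>e = 4 * \<delta> + 32 * \<kappa>\<close> the coefficients add up to
    \<open>8 * \<delta> + 40 * \<kappa>\<close>, and \<open>8 + 40 * 320 = 12808\<close>.\<close>
  also have "\<dots> = 12808 * \<delta> * card S" by (simp add: e_def \<kappa>_def algebra_simps)
  finally have "card (sym_diff S {w \<in> Pow {..<n}. g w}) \<le> 12808 * \<delta> * card S" .
  then show ?thesis
    by (intro that[of I A]) (use I_sub A_one in \<open>auto simp: A_def g_def\<close>)
qed

end

section \<open>Decision lists on sets of coordinates\<close>

primrec ev :: "rule list \<Rightarrow> bool \<Rightarrow> nat set \<Rightarrow> bool" where
  "ev [] d w = d"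
| "ev (r # rs) d w = (case r of (i, b, v) \<Rightarrow> if (i \<in> w) = b then v else ev rs d w)"

abbreviation vars :: "rule list \<Rightarrow> nat set" where
  "vars rs \<equiv> fst ` set rs"

definition misses :: "rule list \<Rightarrow> nat set \<Rightarrow> bool" where
  "misses rs w \<longleftrightarrow> (\<forall>(i, b, v)\<in>set rs. (i \<in> w) \<noteq> b)"

lemma misses_simps [simp]:
  "misses [] w" "misses ((i, b, v) # rs) w \<longleftrightarrow> (i \<in> w) \<noteq> b \<and> misses rs w"
  "misses (rs @ rs') w \<longleftrightarrow> misses rs w \<and> misses rs' w"
  unfolding misses_def by (simp_all add: ball_Un)

lemma missesD: "misses rs w \<Longrightarrow> (i, b, v) \<in> set rs \<Longrightarrow> (i \<in> w) \<noteq> b"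
  unfolding misses_def by fast

lemma misses_cong:
  assumes "w \<inter> vars rs = w' \<inter> vars rs"
  shows "misses rs w \<longleftrightarrow> misses rs w'"
proof -
  have "i \<in> w \<longleftrightarrow> i \<in> w'" if "(i, b, v) \<in> set rs" for i b v
    using assms that by (metis IntI IntD1 fst_conv imageI)
  then show ?thesis unfolding misses_def by fast
qed

lemma ev_append: "ev (rs @ rs') d w = (if misses rs w then ev rs' d w else ev rs d w)"
  by (induction rs) auto

lemma ev_take:
  assumes "\<not> (k < length rs \<and> misses (take k rs) w)"
  shows "ev (take k rs) d w = ev rs d w"
proof (cases "k < length rs")
  case True
  then show ?thesis using ev_append[of "take k rs" "drop k rs" d w] assms by simp
qed simp

lemma ev_cong:
  assumes "w \<inter> vars rs = w' \<inter> vars rs"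
  shows "ev rs d w = ev rs d w'"
  using assms
proof (induction rs)
  case (Cons r rs)
  obtain i b v where r: "r = (i, b, v)" by (cases r)
  have "i \<in> w \<longleftrightarrow> i \<in> w'" "w \<inter> vars rs = w' \<inter> vars rs" using Cons.prems r by auto
  with Cons.IH show ?case by (simp add: r)
qed simp

text \<open>Once the bit \<open>i\<close> is known, a rule on \<open>i\<close> either always fires
  and ends the list, or never fires and can be deleted.\<close>

lemma ev_restrict_variable:
  assumes "distinct (map fst rs)"
  shows "\<exists>rs' d'. distinct (map fst rs') \<and> i \<notin> vars rs' \<and> vars rs' \<subseteq> vars rs \<and>
           (\<forall>w. (i \<in> w) = c \<longrightarrow> ev rs' d' w = ev rs d w)"
  using assms
proof (induction rs)
  case Nil
  show ?case by (intro exI[of _ "[]"] exI[of _ d]) simp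
next
  case (Cons r rs)
  obtain i' b v where r: "r = (i', b, v)" by (cases r)
  obtain rs' d' where IH: "distinct (map fst rs')" "i \<notin> vars rs'" "vars rs' \<subseteq> vars rs"
    "\<And>w. (i \<in> w) = c \<Longrightarrow> ev rs' d' w = ev rs d w"
    using Cons by auto
  consider "i' \<noteq> i" | "i' = i" "b = c" | "i' = i" "b \<noteq> c" by blast
  then show ?case
  proof cases
    case 1
    have "i' \<notin> vars rs'" using Cons.prems IH(3) by (auto simp: r)
    with 1 IH show ?thesis by (intro exI[of _ "r # rs'"] exI[of _ d']) (auto simp: r)
  next
    case 2
    then show ?thesis by (intro exI[of _ "[]"] exI[of _ v]) (auto simp: r)
  next
    case 3
    with IH show ?thesis by (intro exI[of _ rs'] exI[of _ d']) (auto simp: r)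
  qed
qed

text \<open>After a rule on \<open>i\<close> has failed the bit \<open>i\<close> is known, so
  \<open>ev_restrict_variable\<close> removes \<open>i\<close> from the remaining rules.\<close>

lemma ev_distinct:
  "\<exists>rs' d'. distinct (map fst rs') \<and> vars rs' \<subseteq> vars rs \<and> (\<forall>w. ev rs' d' w = ev rs d w)"
proof (induction rs)
  case Nil
  show ?case by (intro exI[of _ "[]"] exI[of _ d]) simp
next
  case (Cons r rs)
  obtain i b v where r: "r = (i, b, v)" by (cases r)
  from Cons obtain rs1 d1 where IH: "distinct (map fst rs1)" "vars rs1 \<subseteq> vars rs"
    "\<And>w. ev rs1 d1 w = ev rs d w" by blast
  from ev_restrict_variable[OF IH(1), of i "\<not> b" d1] obtain rs2 d2
    where 2: "distinct (map fst rs2)" "i \<notin> vars rs2" "vars rs2 \<subseteq> vars rs1"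
    "\<And>w. (i \<in> w) = (\<not> b) \<Longrightarrow> ev rs2 d2 w = ev rs1 d1 w" by auto
  have "ev (r # rs2) d2 w = ev (r # rs) d w" for w
    using 2(4)[of w] IH(3)[of w] by (auto simp: r)
  moreover have "distinct (map fst (r # rs2))" "vars (r # rs2) \<subseteq> vars (r # rs)"
    using 2(1,2) order.trans[OF 2(3) IH(2)] by (simp_all add: r insert_mono) blast+
  ultimately show ?case by blast
qed

lemma ev_zero_prefix:
  assumes "\<And>i b v. (i, b, v) \<in> set pre \<Longrightarrow> \<not> v"
  shows "ev (pre @ rs) d w \<longleftrightarrow> misses pre w \<and> ev rs d w"
  using assms
proof (induction pre)
  case (Cons r pre)
  obtain i b v where r: "r = (i, b, v)" by (cases r)
  have "\<not> v" using Cons.prems[of i b v] by (simp add: r)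
  moreover have "ev (pre @ rs) d w \<longleftrightarrow> misses pre w \<and> ev rs d w"
  proof (rule Cons.IH)
    show "\<not> v" if "(i, b, v) \<in> set pre" for i b v using that by (intro Cons.prems[of i b]) simp
  qed
  ultimately show ?case by (simp add: r)
qed simp

text \<open>A satisfying point must miss every rule before the first one with value
  \<open>True\<close>, and each miss fixes a bit, so the prefix describes a subcube that can be read
  off from any one satisfying point \<open>w0\<close>. Distinct variables keep \<open>L\<close>
  independent of it.\<close>

lemma decision_list_structure:
  assumes "ev rs0 d0 w0"
  obtains R L d where "R \<subseteq> vars rs0" "vars L \<subseteq> vars rs0 - R" "distinct (map fst L)"
    "\<And>w. ev rs0 d0 w \<longleftrightarrow> w \<inter> R = w0 \<inter> R \<and> ev L d w"
    "L = [] \<and> d \<or> (\<exists>i b rs. L = (i, b, True) # rs)"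
proof -
  obtain rs d where rs: "distinct (map fst rs)" "vars rs \<subseteq> vars rs0" "\<And>w. ev rs d w = ev rs0 d0 w"
    using ev_distinct by blast
  define pre where "pre = takeWhile (\<lambda>(i, b, v). \<not> v) rs"
  define L where "L = dropWhile (\<lambda>(i, b, v). \<not> v) rs"
  have app: "rs = pre @ L" by (simp add: pre_def L_def)
  have pre: "\<not> v" if "(i, b, v) \<in> set pre" for i b v
    using set_takeWhileD[OF that[unfolded pre_def]] by simp
  have ev_rs: "ev rs0 d0 w \<longleftrightarrow> misses pre w \<and> ev L d w" for w
  proof -
    have "ev (pre @ L) d w \<longleftrightarrow> misses pre w \<and> ev L d w" by (rule ev_zero_prefix) (rule pre)
    then show ?thesis by (simp only: app[symmetric] rs(3))
  qed
  have w0: "misses pre w0" "ev L d w0" using assms ev_rs by auto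
  have iff: "misses pre w \<longleftrightarrow> w \<inter> vars pre = w0 \<inter> vars pre" for w
  proof
    assume m: "misses pre w"
    have "i \<in> w \<longleftrightarrow> i \<in> w0" if "i \<in> vars pre" for i
    proof -
      from that obtain r where "r \<in> set pre" "i = fst r" by blast
      then have "(i, fst (snd r), snd (snd r)) \<in> set pre" by simp
      then obtain b v where "(i, b, v) \<in> set pre" by blast
      then show ?thesis using missesD[OF m] missesD[OF w0(1)] by blast
    qed
    then show "w \<inter> vars pre = w0 \<inter> vars pre" by blast
  next
    assume "w \<inter> vars pre = w0 \<inter> vars pre"
    then show "misses pre w" using w0(1) misses_cong by blast
  qed
  show ?thesis
  proof (rule that)
    show "vars pre \<subseteq> vars rs0" using rs(2) by (auto simp: app)
    show "vars L \<subseteq> vars rs0 - vars pre" using rs(1,2) by (auto simp: app)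
    show "distinct (map fst L)" using rs(1) by (simp add: app)
    show "ev rs0 d0 w \<longleftrightarrow> w \<inter> vars pre = w0 \<inter> vars pre \<and> ev L d w" for w
      using ev_rs iff by simp
    show "L = [] \<and> d \<or> (\<exists>i b rs. L = (i, b, True) # rs)"
    proof (cases L)
      case Nil
      with w0(2) show ?thesis by simp
    next
      case (Cons r rs')
      then have "\<not> (case r of (i, b, v) \<Rightarrow> \<not> v)" using hd_dropWhile[of "\<lambda>(i, b, v). \<not> v" rs]
        by (simp add: L_def)
      with Cons show ?thesis by (cases r) auto
    qed
  qed
qed

text \<open>A literal whose support has at most one element is a coordinate up to negation, or a
  constant; a rule on a constant either ends the list or is dropped.\<close>

lemma ev_literal_map:
  assumes "\<And>j. A j \<subseteq> N" "\<And>j a a'. a \<in> A j \<Longrightarrow> a' \<in> A j \<Longrightarrow> a = a'"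
  shows "\<exists>rs' d'. vars rs' \<subseteq> N \<and> (\<forall>w. ev rs' d' w = ev rs d ({j. A j \<inter> (w \<oplus> y) \<noteq> {}} \<oplus> c))"
proof (induction rs)
  case Nil
  show ?case by (intro exI[of _ "[]"] exI[of _ d]) simp
next
  case (Cons r rs)
  obtain j b v where r: "r = (j, b, v)" by (cases r)
  from Cons obtain rs' d' where IH: "vars rs' \<subseteq> N"
    "\<And>w. ev rs' d' w = ev rs d ({j. A j \<inter> (w \<oplus> y) \<noteq> {}} \<oplus> c)" by blast
  consider a where "A j = {a}" | "A j = {}" "(j \<in> c) = b" | "A j = {}" "(j \<in> c) \<noteq> b"
    using assms(2)[where j = j] by blast
  then show ?case
  proof cases
    case 1
    then have "a \<in> N" using assms(1)[of j] by blast
    then show ?thesis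
      \<comment> \<open>The literal is the sum of the bits of \<open>w\<close> and \<open>y\<close>
        at \<open>a\<close> and of \<open>c\<close> at \<open>j\<close>; solving for the bit of
        \<open>w\<close> gives the bit of the new rule.\<close>
      using IH 1 by (intro exI[of _ "(a, b \<noteq> ((a \<in> y) \<noteq> (j \<in> c)), v) # rs'"] exI[of _ d']) (auto simp: r)
  next
    case 2
    then show ?thesis by (intro exI[of _ "[]"] exI[of _ v]) (auto simp: r)
  next
    case 3
    then show ?thesis using IH by (intro exI[of _ rs'] exI[of _ d']) (auto simp: r)
  qed
qed

lemma ev_subcube:
  assumes "finite N" "\<And>j. A j \<subseteq> N" "\<And>j a a'. a \<in> A j \<Longrightarrow> a' \<in> A j \<Longrightarrow> a = a'" "y \<subseteq> N"
  shows "\<exists>rs' d'. vars rs' \<subseteq> N \<and> (\<forall>w. w \<subseteq> N \<longrightarrow>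
     ev rs' d' w = (w \<oplus> y \<subseteq> I \<and> ev rs d ({j. A j \<inter> (w \<oplus> y) \<noteq> {}} \<oplus> c)))"
proof -
  have "\<exists>rs' d'. vars rs' \<subseteq> N \<and> (\<forall>w. ev rs' d' w = ev rs d ({j. A j \<inter> (w \<oplus> y) \<noteq> {}} \<oplus> c))"
    by (rule ev_literal_map) (fact assms(2), fact assms(3))
  then obtain rs' d' where *: "vars rs' \<subseteq> N"
    "\<And>w. ev rs' d' w = ev rs d ({j. A j \<inter> (w \<oplus> y) \<noteq> {}} \<oplus> c)" by blast
  \<comment> \<open>The rule for \<open>i\<close> fires exactly where \<open>w\<close> and
    \<open>y\<close> differ at \<open>i\<close>, so the prefix rejects everything outside the
    subcube through \<open>y\<close> with free coordinates \<open>I\<close>.\<close>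
  define pre where "pre = map (\<lambda>i. (i, i \<notin> y, False)) (sorted_list_of_set (N - I))"
  have set_pre: "set pre = (\<lambda>i. (i, i \<notin> y, False)) ` (N - I)"
    using assms(1) by (simp add: pre_def)
  have "ev (pre @ rs') d' w \<longleftrightarrow> misses pre w \<and> ev rs' d' w" for w
    by (rule ev_zero_prefix) (auto simp: set_pre)
  moreover have "misses pre w \<longleftrightarrow> w \<oplus> y \<subseteq> I" if "w \<subseteq> N" for w
  proof -
    have "misses pre w \<longleftrightarrow> (\<forall>i\<in>N - I. i \<notin> w \<oplus> y)" by (auto simp: misses_def set_pre)
    also have "\<dots> \<longleftrightarrow> w \<oplus> y \<subseteq> I" using xor_subset[OF that assms(4)] by blast
    finally show ?thesis .
  qed
  moreover have "vars (pre @ rs') \<subseteq> N" using *(1) by (auto simp: set_pre)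
  ultimately show ?thesis using *(2) by (intro exI[of _ "pre @ rs'"] exI[of _ d']) simp
qed

section \<open>Completeness\<close>

definition upd :: "nat set \<Rightarrow> nat set \<Rightarrow> nat set \<Rightarrow> nat set" where
  "upd a B w = (a - B) \<union> (w \<inter> B)"

lemma mem_upd [simp]: "i \<in> upd a B w \<longleftrightarrow> (if i \<in> B then i \<in> w else i \<in> a)"
  by (auto simp: upd_def)

lemma flip_Int: "i \<notin> V \<Longrightarrow> (w \<oplus> {i}) \<inter> V = w \<inter> V"
  by auto

text \<open>The normal form obtained in \<open>decision_list_structure\<close>: \<open>C\<close> is
  the subcube, \<open>L\<close> the rest of the list, which is free of the fixed coordinates
  \<open>R\<close>.\<close>

locale dl_target =
  fixes n :: nat and F :: "nat set \<Rightarrow> bool" and R w0 :: "nat set" and L :: "rule list" and d :: bool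
    and S C
  defines "S \<equiv> {A \<in> Pow {..<n}. F A}"
  defines "C \<equiv> {A \<in> Pow {..<n}. A \<inter> R = w0 \<inter> R}"
  assumes R_sub: "R \<subseteq> {..<n}" and w0_sub: "w0 \<subseteq> {..<n}" and L_sub: "vars L \<subseteq> {..<n} - R"
    and L_dist: "distinct (map fst L)"
    and F_iff: "\<And>w. w \<subseteq> {..<n} \<Longrightarrow> F w \<longleftrightarrow> w \<inter> R = w0 \<inter> R \<and> ev L d w"
    and L_first: "L = [] \<and> d \<or> (\<exists>i b rs. L = (i, b, True) # rs)"
begin

abbreviation "US \<equiv> pmf_of_set S"

lemma finite_C [simp]: "finite C" and finite_S [simp]: "finite S"
  by (simp_all add: C_def S_def)

lemma S_C: "S \<subseteq> C"
  using F_iff by (auto simp: S_def C_def)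

lemma F_C: "w \<in> C \<Longrightarrow> F w \<longleftrightarrow> ev L d w"
  using F_iff by (auto simp: C_def)

lemma S_iff: "w \<in> S \<longleftrightarrow> w \<in> C \<and> F w"
  using S_C by (auto simp: S_def C_def)

lemma C_xor:
  assumes "w \<in> C" "u \<subseteq> {..<n}" "u \<inter> R = {}"
  shows "w \<oplus> u \<in> C"
proof -
  have "(w \<oplus> u) \<inter> R = w \<inter> R" using assms(3) by (auto simp: xor_def)
  then show ?thesis using assms xor_subset[of w "{..<n}" u] by (simp add: C_def)
qed

lemma C_diff: "w \<in> C \<Longrightarrow> w' \<in> C \<Longrightarrow> (w \<oplus> w') \<inter> R = {}"
  by (auto simp: C_def xor_def)

lemma C_sub: "w \<in> C \<Longrightarrow> w \<subseteq> {..<n}"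
  by (simp add: C_def)

lemma C_upd:
  assumes "a \<in> C" "w \<in> C"
  shows "upd a B w \<in> C"
  using assms by (auto simp: C_def upd_def)

lemma card_C: "0 < card C"
proof -
  have "w0 \<in> C" using w0_sub by (simp add: C_def)
  then show ?thesis using card_gt_0_iff finite_C by blast
qed

text \<open>Toggling \<open>i\<close> is an involution of \<open>X\<close> that exchanges the points
  satisfying \<open>Q\<close> with the others.\<close>

lemma flip_half:
  assumes i: "i \<in> {..<n} - R" and X: "X \<subseteq> C" "\<And>w. w \<in> X \<Longrightarrow> w \<oplus> {i} \<in> X"
    and Q: "\<And>w. w \<in> X \<Longrightarrow> Q (w \<oplus> {i}) \<longleftrightarrow> \<not> Q w"
  shows "2 * card {w \<in> X. Q w} = card X"
proof -
  have fin: "finite X" using X(1) by (rule finite_subset) simp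
  have "{w \<in> X. \<not> Q w} = (\<lambda>w. w \<oplus> {i}) ` {w \<in> X. Q w}"
  proof (intro equalityI subsetI)
    fix w assume w: "w \<in> {w \<in> X. \<not> Q w}"
    then have "w \<oplus> {i} \<in> {w \<in> X. Q w}" using X(2) Q by simp
    moreover have "w = (w \<oplus> {i}) \<oplus> {i}" by (simp add: xor_ac)
    ultimately show "w \<in> (\<lambda>w. w \<oplus> {i}) ` {w \<in> X. Q w}" by (rule rev_image_eqI)
  next
    fix w assume "w \<in> (\<lambda>w. w \<oplus> {i}) ` {w \<in> X. Q w}"
    then obtain u where "u \<in> X" "Q u" "w = u \<oplus> {i}" by blast
    then show "w \<in> {w \<in> X. \<not> Q w}" using X(2) Q by simp
  qed
  then have "card {w \<in> X. \<not> Q w} = card {w \<in> X. Q w}" by simp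
  moreover have "card X = card ({w \<in> X. Q w} \<union> {w \<in> X. \<not> Q w})"
    by (rule arg_cong[where f = card]) auto
  moreover have "\<dots> = card {w \<in> X. Q w} + card {w \<in> X. \<not> Q w}"
    using fin by (intro card_Un_disjoint) auto
  ultimately show ?thesis by simp
qed

lemma C_flip: "i \<in> {..<n} - R \<Longrightarrow> w \<in> C \<Longrightarrow> w \<oplus> {i} \<in> C"
  by (rule C_xor) auto

lemma card_bit:
  assumes "i \<in> {..<n} - R"
  shows "2 * card {w \<in> C. (i \<in> w) = b} = card C"
  by (rule flip_half[OF assms]) (use C_flip[OF assms] in auto)

text \<open>Each rule tests a fresh free coordinate, so missing it halves the set.\<close>

lemma card_misses:
  assumes "distinct (map fst rs)" "vars rs \<subseteq> {..<n} - R"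
  shows "2 ^ length rs * card {w \<in> C. misses rs w} = card C"
  using assms
proof (induction rs)
  case (Cons r rs)
  obtain i b v where r: "r = (i, b, v)" by (cases r)
  have i: "i \<in> {..<n} - R" "i \<notin> vars rs" using Cons.prems by (auto simp: r)
  let ?X = "{w \<in> C. misses rs w}"
  have "2 * card {w \<in> ?X. (i \<in> w) \<noteq> b} = card ?X"
  proof (rule flip_half[OF i(1)])
    fix w assume w: "w \<in> ?X"
    have "(w \<oplus> {i}) \<inter> vars rs = w \<inter> vars rs" using i(2) by (rule flip_Int)
    then show "w \<oplus> {i} \<in> ?X" using w C_flip[OF i(1)] misses_cong[of "w \<oplus> {i}" rs w] by simp
  qed auto
  moreover have "{w \<in> ?X. (i \<in> w) \<noteq> b} = {w \<in> C. misses (r # rs) w}" by (auto simp: r)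
  ultimately have "2 * card {w \<in> C. misses (r # rs) w} = card ?X" by simp
  moreover have "2 ^ length rs * card ?X = card C" using Cons by simp
  ultimately have "2 ^ length rs * (2 * card {w \<in> C. misses (r # rs) w}) = card C" by metis
  then show ?case by (simp add: mult_ac)
qed simp

lemma first_bit_S: "L = (i, b, True) # rs \<Longrightarrow> {w \<in> C. (i \<in> w) = b} \<subseteq> S"
  using F_C by (auto simp: S_iff)

text \<open>The first rule has value \<open>True\<close> and by itself accepts half of
  \<open>C\<close>; without rules \<open>S\<close> is all of \<open>C\<close>.\<close>

lemma card_S: "card C \<le> 2 * card S" "0 < card S" "card S \<le> card C"
proof -
  show 1: "card C \<le> 2 * card S"
  proof (cases L)
    case Nil
    then have "S = C" using L_first F_C by (auto simp: S_iff)
    then show ?thesis by simp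
  next
    case (Cons r rs)
    then obtain i b where L: "L = (i, b, True) # rs" using L_first by (cases r) auto
    then have "i \<in> {..<n} - R" using L_sub by auto
    from card_bit[OF this, of b] have "card C = 2 * card {w \<in> C. (i \<in> w) = b}" by simp
    also have "\<dots> \<le> 2 * card S" using first_bit_S[OF L] by (intro mult_le_mono2 card_mono) auto
    finally show ?thesis .
  qed
  then show "0 < card S" using card_C by linarith
  show "card S \<le> card C" using S_C by (intro card_mono) auto
qed

lemma S_ne: "S \<noteq> {}"
  using card_S(2) by auto

lemma set_US [simp]: "set_pmf US = S"
  using S_ne by (simp add: set_pmf_of_set)

lemma US_eq: "Pr US Q = card {s \<in> S. Q s} / card S"
  using S_ne by (intro Pr_uniform) auto

lemma US_shift_le:
  assumes "finite B"
  shows "Pr US (\<lambda>s. s \<oplus> u \<in> B) \<le> 2 * card B / card C"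
proof -
  have "card ((\<lambda>s. s \<oplus> u) ` {s \<in> S. s \<oplus> u \<in> B}) \<le> card B" using assms by (intro card_mono) auto
  then have le: "card {s \<in> S. s \<oplus> u \<in> B} \<le> card B" by simp
  have "real (card {s \<in> S. s \<oplus> u \<in> B}) * card C \<le> real (card B) * (2 * card S)"
    using le card_S(1) by (intro mult_mono) linarith+
  then show ?thesis unfolding US_eq using card_S(2) card_C by (simp add: field_simps)
qed

lemma US_le:
  assumes "finite B"
  shows "Pr US (\<lambda>s. s \<in> B) \<le> 2 * card B / card C"
  using US_shift_le[OF assms, of "{}"] by simp

text \<open>Exchanging the block between \<open>a\<close> and \<open>x\<close> is an injective map
  on pairs from \<open>C\<close>, so at most \<open>card Z * card C\<close> pairs lead into
  \<open>Z\<close>; the factor 4 is a loss of 2 for each of the two samples.\<close>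

lemma US_upd_le:
  assumes "Z \<subseteq> C"
  shows "Pr (pair_pmf US US) (\<lambda>(a, x). upd a B x \<in> Z) \<le> 4 * card Z / card C"
proof -
  have finZ: "finite Z" using assms by (rule finite_subset) simp
  let ?X = "{p \<in> S \<times> S. case p of (a, x) \<Rightarrow> upd a B x \<in> Z}"
  have "inj_on (\<lambda>(a, x). (upd a B x, upd x B a)) ?X"
    by (rule inj_on_inverseI[where g = "\<lambda>(p, q). (upd p B q, upd q B p)"]) (auto simp: upd_def)
  then have "card ?X = card ((\<lambda>(a, x). (upd a B x, upd x B a)) ` ?X)" by (simp add: card_image)
  also have "\<dots> \<le> card (Z \<times> C)"
    using finZ subsetD[OF S_C] C_upd by (intro card_mono) auto
  finally have le: "card ?X \<le> card Z * card C" by (simp add: card_cartesian_product)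
  have "real (card ?X) * (card C * card C) \<le> real (card Z * card C) * ((2 * card S) * (2 * card S))"
    using le card_S(1) by (intro mult_mono of_nat_mono) simp_all
  then have *: "real (card ?X) * card C \<le> 4 * card Z * (card S * card S)"
    using card_C by (simp add: field_simps)
  have "Pr (pair_pmf US US) (\<lambda>(a, x). upd a B x \<in> Z) = card ?X / card (S \<times> S)"
    using S_ne by (simp add: pair_pmf_of_set Pr_uniform)
  also have "\<dots> \<le> 4 * card Z / card C"
    using * card_S(2) card_C by (simp add: card_cartesian_product field_simps)
  finally show ?thesis .
qed

definition Sens where "Sens i = {w \<in> C. F (w \<oplus> {i}) \<noteq> F w}"

text \<open>Only the coordinate \<open>i\<close> is overwritten here, so this does not depend on the
  hashing. When \<open>i\<close> is the only relevant variable of its block, overwriting the whole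
  block has the same effect outside a negligible set.\<close>

definition revealed where "revealed i = Pr (pair_pmf US US) (\<lambda>(a, x). \<not> F (upd a {i} x))"

lemma Sens_C: "Sens i \<subseteq> C"
  by (auto simp: Sens_def)

text \<open>Sensitive points come in pairs that differ at \<open>i\<close>, exactly one of which
  satisfies \<open>F\<close>.\<close>

lemma card_Sens_S:
  assumes "i \<in> {..<n} - R"
  shows "2 * card {a \<in> S. \<not> F (a \<oplus> {i})} = card (Sens i)"
proof -
  have "2 * card {w \<in> Sens i. F w} = card (Sens i)"
    by (rule flip_half[OF assms Sens_C]) (use C_flip[OF assms] in \<open>auto simp: Sens_def xor_ac\<close>)
  moreover have "{w \<in> Sens i. F w} = {a \<in> S. \<not> F (a \<oplus> {i})}"
    by (auto simp: Sens_def S_iff)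
  ultimately show "2 * card {a \<in> S. \<not> F (a \<oplus> {i})} = card (Sens i)" by simp
qed

lemma upd_single: "upd a {i} x = (if (i \<in> x) = (i \<in> a) then a else a \<oplus> {i})"
  by (auto simp: upd_def set_eq_iff)

text \<open>A sample \<open>a\<close> at which \<open>i\<close> is sensitive reveals
  \<open>i\<close> together with any \<open>x\<close> that differs from it at
  \<open>i\<close>.\<close>

lemma revealed_ge:
  assumes i: "i \<in> {..<n} - R"
    and p: "\<And>a. a \<in> S \<Longrightarrow> \<not> F (a \<oplus> {i}) \<Longrightarrow> p \<le> Pr US (\<lambda>x. (i \<in> x) \<noteq> (i \<in> a))"
  shows "p * (card (Sens i) / (2 * card S)) \<le> revealed i"
proof -
  have "card (Sens i) = 2 * real (card {a \<in> S. \<not> F (a \<oplus> {i})})"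
    using card_Sens_S[OF i] by linarith
  then have "p * (card (Sens i) / (2 * card S)) = p * Pr US (\<lambda>a. \<not> F (a \<oplus> {i}))"
    by (simp add: US_eq)
  also have "\<dots> \<le> revealed i"
    unfolding revealed_def
  proof (rule Pr_pair_ge)
    fix a assume a: "a \<in> set_pmf US" "\<not> F (a \<oplus> {i})"
    then have "p \<le> Pr US (\<lambda>x. (i \<in> x) \<noteq> (i \<in> a))" using p by simp
    also have "\<dots> \<le> Pr US (\<lambda>x. case (a, x) of (a, x) \<Rightarrow> \<not> F (upd a {i} x))"
      using a(2) by (intro Pr_mono) (simp add: upd_single)
    finally show "p \<le> Pr US (\<lambda>x. case (a, x) of (a, x) \<Rightarrow> \<not> F (upd a {i} x))" .
  qed
  finally show ?thesis .
qed

text \<open>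
  A value of a variable after the first one has probability at least \<open>1/4\<close> among the samples; only the
  first variable can be influential and yet nearly constant on them.
\<close>

lemma influential_revealed:
  fixes \<tau> :: real
  assumes i: "i \<in> vars L" and inf: "8 * \<tau> * card C \<le> card (Sens i)" and \<tau>: "0 \<le> \<tau>"
  shows "\<tau> \<le> revealed i \<or> (\<exists>b rs. L = (i, b, True) # rs \<and> Pr US (\<lambda>s. (i \<in> s) \<noteq> b) \<le> 4 * \<tau>)"
proof -
  have iN: "i \<in> {..<n} - R" using i L_sub by blast
  obtain i1 b1 rs where L: "L = (i1, b1, True) # rs" using i L_first by auto
  have i1: "i1 \<in> {..<n} - R" using L L_sub by auto
  define t where "t = real (card (Sens i))"
  define c where "c = real (card C)"
  define s where "s = real (card S)"
  have cs: "0 < c" "0 < s" "s \<le> c" "c \<le> 2 * s"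
    using card_C card_S by (simp_all add: c_def s_def)
  have t0: "0 \<le> t" by (simp add: t_def)
  show ?thesis
  proof (cases "i = i1")
    case False
    \<comment> \<open>The points of \<open>C\<close> where the first rule fires are half of
      \<open>C\<close>, lie in \<open>S\<close>, and are balanced in any other free
      variable.\<close>
    have "1 / 4 \<le> Pr US (\<lambda>x. (i \<in> x) \<noteq> \<beta>)" for \<beta>
    proof -
      let ?X = "{w \<in> C. (i1 \<in> w) = b1}"
      have "2 * card {w \<in> ?X. (i \<in> w) \<noteq> \<beta>} = card ?X"
        by (rule flip_half[OF iN]) (use C_flip[OF iN] False in auto)
      with card_bit[OF i1, of b1] have "card C = 4 * card {w \<in> ?X. (i \<in> w) \<noteq> \<beta>}" by simp
      also have "\<dots> \<le> 4 * card {x \<in> S. (i \<in> x) \<noteq> \<beta>}"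
        using first_bit_S[OF L] by (intro mult_le_mono2 card_mono) auto
      finally have "c \<le> 4 * card {x \<in> S. (i \<in> x) \<noteq> \<beta>}" unfolding c_def by linarith
      then show ?thesis using cs unfolding US_eq s_def[symmetric] by (simp add: field_simps)
    qed
    then have "1 / 4 * (card (Sens i) / (2 * card S)) \<le> revealed i" by (rule revealed_ge[OF iN])
    moreover have "\<tau> \<le> 1 / 4 * (t / (2 * s))"
    proof -
      have "8 * \<tau> * s \<le> 8 * \<tau> * c" using cs \<tau> by (intro mult_left_mono) auto
      also have "\<dots> \<le> t" using inf by (simp add: t_def c_def)
      finally show ?thesis using cs by (simp add: field_simps)
    qed
    ultimately show ?thesis by (simp add: t_def s_def)
  next
    case True
    note L = L[folded True]
    define p where "p = Pr US (\<lambda>s. (i \<in> s) \<noteq> b1)"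
    have "p * (card (Sens i) / (2 * card S)) \<le> revealed i"
    proof (rule revealed_ge[OF iN])
      fix a assume a: "a \<in> S" "\<not> F (a \<oplus> {i})"
      have "a \<oplus> {i} \<in> C" using a(1) S_C C_flip[OF iN] by blast
      then have "(i \<in> a) = b1" using a(2) first_bit_S[OF L] by (auto simp: S_iff)
      then show "p \<le> Pr US (\<lambda>x. (i \<in> x) \<noteq> (i \<in> a))" by (simp add: p_def)
    qed
    then have rev: "p * (t / (2 * s)) \<le> revealed i" by (simp add: t_def s_def)
    \<comment> \<open>At an unsatisfying point the first rule has not fired; toggling its variable
      makes it fire, so all such points are sensitive.\<close>
    have "{w \<in> Sens i. \<not> F w} = C - S"
    proof (intro equalityI subsetI)
      fix w assume w: "w \<in> C - S"
      then have "(i \<in> w) \<noteq> b1" using first_bit_S[OF L] by blast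
      then have "w \<oplus> {i} \<in> S" using w first_bit_S[OF L] C_flip[OF iN, of w] by auto
      then show "w \<in> {w \<in> Sens i. \<not> F w}" using w by (auto simp: Sens_def S_iff)
    qed (auto simp: Sens_def S_iff)
    moreover have "2 * card {w \<in> Sens i. \<not> F w} = card (Sens i)"
      by (rule flip_half[OF iN Sens_C]) (use C_flip[OF iN] in \<open>auto simp: Sens_def xor_ac\<close>)
    ultimately have "2 * card (C - S) = card (Sens i)" by simp
    moreover have "card C = card S + card (C - S)"
      using card_Diff_subset[OF _ S_C] card_S(3) by simp
    ultimately have "2 * card C = 2 * card S + card (Sens i)" by simp
    then have sc: "2 * c = 2 * s + t" unfolding c_def s_def t_def by linarith
    have "card S = card ({w \<in> C. (i \<in> w) = b1} \<union> {x \<in> S. (i \<in> x) \<noteq> b1})"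
      using first_bit_S[OF L] S_C by (intro arg_cong[where f = card]) auto
    also have "\<dots> = card {w \<in> C. (i \<in> w) = b1} + card {x \<in> S. (i \<in> x) \<noteq> b1}"
      by (intro card_Un_disjoint) auto
    finally have "2 * card S = card C + 2 * card {x \<in> S. (i \<in> x) \<noteq> b1}"
      using card_bit[OF iN, of b1] by simp
    then have "2 * s = c + 2 * real (card {x \<in> S. (i \<in> x) \<noteq> b1})"
      unfolding c_def s_def by linarith
    moreover have "p * s = real (card {x \<in> S. (i \<in> x) \<noteq> b1})"
      using card_S(2) by (simp add: p_def US_eq s_def)
    ultimately have ps: "2 * (p * s) = c - t" using sc by simp
    have tc: "t / (2 * c) \<le> t / (2 * s)" using cs t0 by (intro divide_left_mono) auto
    show ?thesis
    proof (cases "p \<le> 4 * \<tau>")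
      case True
      then show ?thesis using L by (auto simp: p_def)
    next
      case False
      \<comment> \<open>By \<open>ps\<close>, \<open>p\<close> is small only when nearly all of
        \<open>C\<close> is sensitive. If at least half of \<open>C\<close> is sensitive,
        \<open>p > 4 * \<tau>\<close> suffices; otherwise \<open>p\<close> is at least
        \<open>1 / 4\<close> and the influence suffices.\<close>
      have "\<tau> \<le> p * (t / (2 * s))"
      proof (cases "c \<le> 2 * t")
        case True
        then have "1 / 4 \<le> t / (2 * c)" using cs by (simp add: field_simps)
        then have "1 / 4 \<le> t / (2 * s)" using tc by linarith
        then have "p * (1 / 4) \<le> p * (t / (2 * s))" using False \<tau> by (intro mult_left_mono) auto
        then show ?thesis using False by linarith
      next
        case False
        then have "s / 4 \<le> p * s" using ps cs by linarith
        then have "1 / 4 \<le> p" using cs by (simp add: field_simps)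
        moreover have "4 * \<tau> \<le> t / (2 * c)"
          using inf cs by (simp add: t_def c_def field_simps)
        then have "4 * \<tau> \<le> t / (2 * s)" using tc by linarith
        ultimately have "1 / 4 * (4 * \<tau>) \<le> p * (t / (2 * s))"
          using \<tau> by (intro mult_mono) auto
        then show ?thesis by simp
      qed
      with rev show ?thesis by linarith
    qed
  qed
qed

end

section \<open>Seeds, block hashing and implicit literals\<close>

lemma Int_eqI: "(\<And>i. i \<in> V \<Longrightarrow> i \<in> A \<longleftrightarrow> i \<in> B) \<Longrightarrow> A \<inter> V = B \<inter> V"
  by blast

text \<open>\<open>((s, b), r, (s', b'), \<beta>)\<close> consists of two samples with the flips
  that randomise them, the mask, and the final flip.\<close>

type_synonym seed =
  "(nat set \<times> nat set) \<times> nat set \<times> (nat set \<times> nat set) \<times> nat set"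

definition block :: "(nat \<Rightarrow> nat) \<Rightarrow> nat \<Rightarrow> nat set" where
  "block \<phi> j = {i. \<phi> i = j}"

definition witness where
  "witness F \<phi> W j = find (\<lambda>(a, x). \<not> F (upd a (block \<phi> j) x)) W"

text \<open>A block without a witness gets the constantly false literal, and \<open>shift\<close>
  accordingly leaves its coordinates alone. The value of a literal costs one query for each block
  with a witness.\<close>

definition hash where
  "hash m F \<phi> W w = {j \<in> {..<m}. case witness F \<phi> W j of None \<Rightarrow> False
     | Some (a, x) \<Rightarrow> F (upd a (block \<phi> j) w)}"

definition shift where
  "shift n F \<phi> W b = {i \<in> {..<n}. \<phi> i \<in> b \<and> (case witness F \<phi> W (\<phi> i) of None \<Rightarrow> False
     | Some (a, x) \<Rightarrow> i \<in> a \<oplus> x)}"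

text \<open>The density condition concerns the list alone and costs no query. It is
  \<open>G_half\<close> in the soundness proof, and it holds automatically for a list whose first
  rule has value \<open>True\<close>.\<close>

definition hypotheses :: "nat \<Rightarrow> nat \<Rightarrow> (rule list \<times> bool) set" where
  "hypotheses m K = {(rs, d). set rs \<subseteq> {..<m} \<times> UNIV \<and> length rs \<le> K \<and>
     2 ^ m \<le> 2 * card {b \<in> Pow {..<m}. ev rs d b}}"

definition place :: "(nat set \<Rightarrow> nat set) \<Rightarrow> seed \<Rightarrow> nat set \<times> nat set \<times> nat set \<times> nat set" where
  "place D = (\<lambda>((s, b), r, (s', b'), \<beta>). (s \<oplus> D b, r, s' \<oplus> D b', \<beta>))"

text \<open>The points at which \<open>passes\<close> compares \<open>F\<close> with the
  hypothesis.\<close>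

definition points where
  "points D y = (\<lambda>(z, r, z', \<beta>). {z, z \<oplus> D \<beta>, z \<oplus> z' \<oplus> y \<oplus> D \<beta>, z' \<oplus> ((z \<oplus> y) \<inter> r) \<oplus> D \<beta>})"

definition accepts :: "nat \<Rightarrow> nat \<Rightarrow> nat \<Rightarrow> (nat set \<Rightarrow> bool) \<Rightarrow> (nat \<Rightarrow> nat) \<Rightarrow> nat set
    \<Rightarrow> (nat set \<times> nat set) list \<Rightarrow> seed list \<Rightarrow> bool" where
  "accepts n m K F \<phi> y W sds \<longleftrightarrow> (\<exists>(rs, d) \<in> hypotheses m K. \<forall>sd \<in> set sds.
     passes F (shift n F \<phi> W) (hash m F \<phi> W) y (ev rs d) (place (shift n F \<phi> W) sd))"

text \<open>Translates a list into literals and stops at the first variable without one, with that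
  rule's value as default. This is the right value at a point insensitive to that variable, even if
  the rule does not fire there: it fires after toggling the variable.\<close>

primrec cut :: "(nat \<Rightarrow> (nat \<times> bool) option) \<Rightarrow> rule list \<Rightarrow> bool \<Rightarrow> rule list \<times> bool" where
  "cut f [] d = ([], d)"
| "cut f (r # rs) d = (case r of (i, b, v) \<Rightarrow> case f i of None \<Rightarrow> ([], v)
     | Some (j, c) \<Rightarrow> ((j, b = c, v) # fst (cut f rs d), snd (cut f rs d)))"

lemma ev_cut:
  assumes "\<And>i j c. i \<in> vars rs \<Longrightarrow> f i = Some (j, c) \<Longrightarrow> j \<in> \<eta> \<longleftrightarrow> (i \<in> w) = c"
    and "\<And>pre i b v post. rs = pre @ (i, b, v) # post \<Longrightarrow> f i = None \<Longrightarrow> misses pre w \<Longrightarrow>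
           (i \<in> w) \<noteq> b \<Longrightarrow> ev post d w = v"
  shows "ev (fst (cut f rs d)) (snd (cut f rs d)) \<eta> = ev rs d w"
  using assms
proof (induction rs)
  case (Cons r rs)
  obtain i b v where r: "r = (i, b, v)" by (cases r)
  show ?case
  proof (cases "f i")
    case None
    then show ?thesis using Cons.prems(2)[of "[]" i b v rs] by (auto simp: r)
  next
    case (Some jc)
    obtain j c where jc: "f i = Some (j, c)" using Some by (cases jc) simp
    have j: "j \<in> \<eta> \<longleftrightarrow> (i \<in> w) = c" using Cons.prems(1)[OF _ jc] by (simp add: r)
    show ?thesis
    proof (cases "(i \<in> w) = b")
      case True
      with j show ?thesis by (auto simp: r jc)
    next
      case False
      have "ev (fst (cut f rs d)) (snd (cut f rs d)) \<eta> = ev rs d w"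
      proof (rule Cons.IH)
        show "j \<in> \<eta> \<longleftrightarrow> (i \<in> w) = c" if "i \<in> vars rs" "f i = Some (j, c)" for i j c
          using Cons.prems(1)[OF _ that(2)] that(1) by simp
        show "ev post d w = v'" if "rs = pre @ (i', b', v') # post" "f i' = None" "misses pre w"
          "(i' \<in> w) \<noteq> b'" for pre i' b' v' post
          using Cons.prems(2)[of "r # pre" i' b' v' post] that False by (simp add: r)
      qed
      with j False show ?thesis by (auto simp: r jc)
    qed
  qed
qed simp

lemma cut_wf:
  assumes "\<And>i j c. i \<in> vars rs \<Longrightarrow> f i = Some (j, c) \<Longrightarrow> j < m"
  shows "set (fst (cut f rs d)) \<subseteq> {..<m} \<times> UNIV \<and> length (fst (cut f rs d)) \<le> length rs"
  using assms
proof (induction rs)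
  case (Cons r rs)
  obtain i b v where r: "r = (i, b, v)" by (cases r)
  have IH: "set (fst (cut f rs d)) \<subseteq> {..<m} \<times> UNIV \<and> length (fst (cut f rs d)) \<le> length rs"
    by (rule Cons.IH) (rule Cons.prems, auto)
  show ?case
  proof (cases "f i")
    case (Some jc)
    obtain j c where jc: "f i = Some (j, c)" using Some by (cases jc) simp
    have "j < m" by (rule Cons.prems[OF _ jc]) (simp add: r)
    with IH show ?thesis by (auto simp: r jc)
  qed (simp add: r)
qed simp

lemma card_bit_cube:
  assumes "j < m"
  shows "2 ^ m = 2 * card {b \<in> Pow {..<m}. (j \<in> b) = c}"
proof -
  \<comment> \<open>The whole cube is a degenerate target: no fixed coordinate and no rule.\<close>
  interpret dl_target m "\<lambda>_. True" "{}" "{}" "[]" True "Pow {..<m}" "Pow {..<m}"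
    by unfold_locales (simp_all add: Pow_def)
  show ?thesis using card_bit[of j c] assms by (simp add: card_Pow)
qed

lemma half_first_rule:
  assumes "j < m"
  shows "2 ^ m \<le> 2 * card {b \<in> Pow {..<m}. ev ((j, c, True) # rs) d b}"
proof -
  have "card {b \<in> Pow {..<m}. (j \<in> b) = c} \<le> card {b \<in> Pow {..<m}. ev ((j, c, True) # rs) d b}"
    by (intro card_mono) auto
  then show ?thesis using card_bit_cube[OF assms, of c] by linarith
qed

section \<open>Acceptance of a decision list when no bad event occurs\<close>

context dl_target
begin

text \<open>The points left undecided by the first \<open>K\<close> rules; off this set the value of
  \<open>F\<close> depends on their variables only. The guard makes it empty when truncation loses
  nothing.\<close>

definition "Z K = {w \<in> C. K < length L \<and> misses (take K L) w}"

lemma Z_agree: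
  assumes "w \<in> C" "w' \<in> C" "w \<inter> vars (take K L) = w' \<inter> vars (take K L)"
  shows "w \<in> Z K \<longleftrightarrow> w' \<in> Z K" "w \<notin> Z K \<Longrightarrow> F w = F w'"
proof -
  show iff: "w \<in> Z K \<longleftrightarrow> w' \<in> Z K" using assms misses_cong[OF assms(3)] by (simp add: Z_def)
  assume w: "w \<notin> Z K"
  with iff have w': "w' \<notin> Z K" by simp
  have "F w = ev (take K L) d w"
    using F_C[OF assms(1)] ev_take[of K L w d] w assms(1) by (simp add: Z_def)
  also have "\<dots> = ev (take K L) d w'" by (rule ev_cong[OF assms(3)])
  also have "\<dots> = F w'"
    using F_C[OF assms(2)] ev_take[of K L w' d] w' assms(2) by (simp add: Z_def)
  finally show "F w = F w'" .
qed

text \<open>The deterministic half of completeness: its assumptions are the favourable conditions on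
  the random choices, to be bounded one by one in \<open>accepts_probably\<close>. The accepted
  hypothesis is the truncated list translated by \<open>cut\<close>.\<close>

lemma accepts_if:
  fixes K m :: nat and \<phi> :: "nat \<Rightarrow> nat" and W :: "(nat set \<times> nat set) list"
  assumes K: "0 < K" and \<phi>: "\<And>i. i < n \<Longrightarrow> \<phi> i < m" and inj: "inj_on \<phi> (vars (take K L))"
    and W: "\<And>a x. (a, x) \<in> set W \<Longrightarrow> a \<in> S \<and> x \<in> S \<and> a \<notin> Z K"
    and W_block: "\<And>a x j. (a, x) \<in> set W \<Longrightarrow> j < m \<Longrightarrow> upd a (block \<phi> j) x \<notin> Z K"
    and W_bit: "\<And>a x i. (a, x) \<in> set W \<Longrightarrow> i \<in> vars (take K L) \<Longrightarrow> upd a {i} x \<notin> Z K"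
    and y: "y \<in> S"
    and sds: "\<And>s b r s' b' \<beta>. ((s, b), r, (s', b'), \<beta>) \<in> set sds \<Longrightarrow> s \<in> S \<and> s' \<in> S"
    and D: "D = shift n F \<phi> W"
    and pts: "\<And>sd p. sd \<in> set sds \<Longrightarrow> p \<in> points D y (place D sd) \<Longrightarrow> p \<notin> Z K"
    and vis: "\<And>i. i \<in> vars (take K L) \<Longrightarrow> (\<exists>(a, x)\<in>set W. \<not> F (upd a {i} x)) \<or>
      (\<forall>sd\<in>set sds. \<forall>p\<in>points D y (place D sd). p \<notin> Sens i) \<or>
      (\<exists>c rs. L = (i, c, True) # rs \<and> (i \<in> y) = c \<and>
        (\<forall>((s, b), r, (s', b'), \<beta>)\<in>set sds. (i \<in> s) = c \<and> (i \<in> s') = c))"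
  shows "accepts n m K F \<phi> y W sds"
proof -
  define h where "h = hash m F \<phi> W"
  define Lk where "Lk = take K L"
  have Lk_sub: "i \<in> {..<n} - R" if "i \<in> vars Lk" for i
    using that L_sub set_take_subset[of K L] unfolding Lk_def by blast
  have WC: "a \<in> C" "x \<in> C" "F a" "a \<notin> Z K" if "(a, x) \<in> set W" for a x
    using W[OF that] S_C by (auto simp: S_iff)
  have wit: "(a, x) \<in> set W \<and> \<not> F (upd a (block \<phi> j) x)" if "witness F \<phi> W j = Some (a, x)" for j a x
    using that unfolding witness_def find_Some_iff by (metis case_prod_conv nth_mem)
  \<comment> \<open>The sample \<open>a\<close> lies off \<open>Z K\<close>, so by
    \<open>Z_agree\<close> overwriting can change the value only by touching one of the first
    \<open>K\<close> variables.\<close>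
  have wit_var: "\<exists>i\<in>vars Lk. \<phi> i = j" if w: "witness F \<phi> W j = Some (a, x)" for j a x
  proof (rule ccontr)
    assume "\<not> ?thesis"
    then have "a \<inter> vars Lk = upd a (block \<phi> j) x \<inter> vars Lk" by (auto simp: block_def)
    then have "F a = F (upd a (block \<phi> j) x)"
      using wit[OF w] WC[of a x] C_upd by (intro Z_agree(2)[of _ _ K]) (auto simp: Lk_def)
    then show False using wit[OF w] WC[of a x] by blast
  qed
  \<comment> \<open>By injectivity \<open>i\<close> is the only relevant variable in its block, so
    the overwritten value depends on \<open>w\<close> only through the bit \<open>i\<close>: it is
    true when this bit agrees with \<open>a\<close> and false when it agrees with
    \<open>x\<close>.\<close>
  have lit: "(i \<in> a) \<noteq> (i \<in> x) \<and> (\<forall>w\<in>C. F (upd a (block \<phi> (\<phi> i)) w) \<longleftrightarrow> (i \<in> w) = (i \<in> a))"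
    if i: "i \<in> vars Lk" and w: "witness F \<phi> W (\<phi> i) = Some (a, x)" for i a x
  proof -
    let ?B = "block \<phi> (\<phi> i)"
    have only: "i' = i" if "i' \<in> vars Lk" "i' \<in> ?B" for i'
      using inj_onD[OF inj] i that by (simp add: block_def Lk_def)
    have iB: "i \<in> ?B" by (simp add: block_def)
    have ax: "(a, x) \<in> set W" "\<not> F (upd a ?B x)" using wit[OF w] by auto
    note C = WC[OF ax(1)]
    have nZ: "upd a ?B x \<notin> Z K" using W_block[OF ax(1)] \<phi> Lk_sub[OF i] by simp
    have same: "F (upd a ?B w)" if "w \<in> C" "(i \<in> w) = (i \<in> a)" for w
    proof -
      have "a \<inter> vars Lk = upd a ?B w \<inter> vars Lk"
      proof (rule Int_eqI)
        fix i' assume "i' \<in> vars Lk"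
        from only[OF this] that(2) show "i' \<in> a \<longleftrightarrow> i' \<in> upd a ?B w" by auto
      qed
      then have "F a = F (upd a ?B w)"
        using C C_upd that(1) by (intro Z_agree(2)[of _ _ K]) (auto simp: Lk_def)
      with C(3) show ?thesis by simp
    qed
    have diff: "\<not> F (upd a ?B w)" if "w \<in> C" "(i \<in> w) = (i \<in> x)" for w
    proof -
      have "upd a ?B x \<inter> vars Lk = upd a ?B w \<inter> vars Lk"
      proof (rule Int_eqI)
        fix i' assume "i' \<in> vars Lk"
        from only[OF this] that(2) show "i' \<in> upd a ?B x \<longleftrightarrow> i' \<in> upd a ?B w" by auto
      qed
      then have "F (upd a ?B x) = F (upd a ?B w)"
        using C C_upd that(1) nZ by (intro Z_agree(2)[of _ _ K]) (auto simp: Lk_def)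
      with ax(2) show ?thesis by simp
    qed
    have "(i \<in> a) \<noteq> (i \<in> x)" using same[OF C(2)] ax(2) by blast
    with same diff show ?thesis by blast
  qed
  have h_lit: "\<phi> i \<in> h w \<longleftrightarrow> (i \<in> w) = (i \<in> a)"
    if "i \<in> vars Lk" "witness F \<phi> W (\<phi> i) = Some (a, x)" "w \<in> C" for i a x w
    using lit[OF that(1,2)] that \<phi>[of i] Lk_sub[OF that(1)] by (simp add: h_def hash_def)
  \<comment> \<open>On \<open>C\<close> each literal is a possibly negated coordinate or constantly
    false. Both tests on the literals alone follow from this.\<close>
  have h_cases: "(\<forall>w\<in>C. j \<notin> h w) \<or> (\<exists>i c. \<forall>w\<in>C. j \<in> h w \<longleftrightarrow> (i \<in> w) = c)" for j
  proof (cases "witness F \<phi> W j")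
    case None
    then show ?thesis by (simp add: h_def hash_def)
  next
    case (Some ax)
    then obtain a x where ax: "witness F \<phi> W j = Some (a, x)" by (cases ax) simp
    from wit_var[OF this] obtain i where i: "i \<in> vars Lk" "\<phi> i = j" by blast
    have "\<forall>w\<in>C. j \<in> h w \<longleftrightarrow> (i \<in> w) = (i \<in> a)"
      using h_lit[OF i(1), unfolded i(2), OF ax] by blast
    then show ?thesis by blast
  qed
  \<comment> \<open>Both samples of a witness lie in \<open>C\<close> and agree on \<open>R\<close>,
    so adding their difference stays in the subcube.\<close>
  have D_R: "D b \<inter> R = {}" "D b \<subseteq> {..<n}" for b
  proof -
    show "D b \<subseteq> {..<n}" by (auto simp: D shift_def)
    have False if "i \<in> D b" "i \<in> R" for i
    proof -
      have "case witness F \<phi> W (\<phi> i) of None \<Rightarrow> False | Some (a, x) \<Rightarrow> i \<in> a \<oplus> x"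
        using that(1) by (simp add: D shift_def)
      then obtain a x where ax: "witness F \<phi> W (\<phi> i) = Some (a, x)" "i \<in> a \<oplus> x"
        by (cases "witness F \<phi> W (\<phi> i)") auto
      then have "a \<in> C" "x \<in> C" using wit WC by blast+
      then show False using C_diff ax(2) that(2) by blast
    qed
    then show "D b \<inter> R = {}" by blast
  qed
  have C_D: "w \<oplus> D b \<in> C" if "w \<in> C" for w b
    using C_xor[OF that] D_R by blast
  have D_bit: "i \<in> D b \<longleftrightarrow> \<phi> i \<in> b"
    if "i \<in> vars Lk" "witness F \<phi> W (\<phi> i) = Some (a, x)" for i a x b
    using lit[OF that] that(2) Lk_sub[OF that(1)] by (auto simp: D shift_def)
  define f where "f i = map_option (\<lambda>(a, x). (\<phi> i, i \<in> a)) (witness F \<phi> W (\<phi> i))" for i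
  have f_Some: "\<exists>a x. witness F \<phi> W (\<phi> i) = Some (a, x) \<and> j = \<phi> i \<and> c = (i \<in> a)" if "f i = Some (j, c)" for i j c
    using that by (auto simp: f_def)
  have f_None: "witness F \<phi> W (\<phi> i) = None" if "f i = None" for i
    using that by (auto simp: f_def)
  define G where "G = ev (fst (cut f Lk d)) (snd (cut f Lk d))"
  have main: "F (w \<oplus> D \<beta>) = G (h w \<oplus> \<beta>)"
    if w: "w \<in> C" and nZ: "w \<oplus> D \<beta> \<notin> Z K"
      and unw: "\<And>i. i \<in> vars Lk \<Longrightarrow> f i = None \<Longrightarrow> w \<oplus> D \<beta> \<notin> Sens i \<or>
         (\<exists>c rs. L = (i, c, True) # rs \<and> (i \<in> w \<oplus> D \<beta>) = c)" for w \<beta>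
  proof -
    define w' where "w' = w \<oplus> D \<beta>"
    have w'C: "w' \<in> C" using C_D[OF w] by (simp add: w'_def)
    have Fw': "F w' = ev Lk d w'"
      using F_C[OF w'C] ev_take[of K L w' d] nZ w'C by (simp add: Z_def w'_def Lk_def)
    have "G (h w \<oplus> \<beta>) = ev Lk d w'"
      unfolding G_def
    proof (rule ev_cut)
      fix i j c assume i: "i \<in> vars Lk" "f i = Some (j, c)"
      obtain a x where ax: "witness F \<phi> W (\<phi> i) = Some (a, x)" "j = \<phi> i" "c = (i \<in> a)"
        using f_Some[OF i(2)] by blast
      show "j \<in> h w \<oplus> \<beta> \<longleftrightarrow> (i \<in> w') = c"
        using h_lit[OF i(1) ax(1) w] D_bit[OF i(1) ax(1)] by (auto simp: ax(2,3) w'_def)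
    next
      fix pre i b v post
      assume app: "Lk = pre @ (i, b, v) # post" and None: "f i = None"
        and mis: "misses pre w'" and nb: "(i \<in> w') \<noteq> b"
      have i: "i \<in> vars Lk" by (simp add: app)
      have in_L: "(i, b, v) \<in> set L" using app set_take_subset[of K L] unfolding Lk_def by auto
      obtain rest where L_app: "L = pre @ (i, b, v) # (post @ rest)"
        using app append_take_drop_id[of K L] unfolding Lk_def by (metis append.assoc append_Cons)
      consider "w' \<notin> Sens i" | c rs where "L = (i, c, True) # rs" "(i \<in> w') = c"
        using unw[OF i None] unfolding w'_def by blast
      then show "ev post d w' = v"
      proof cases
        case 1
        \<comment> \<open>Toggling \<open>i\<close> makes this rule fire, while the prefix, which
          does not contain \<open>i\<close>, is still missed; insensitivity carries the value
          \<open>v\<close> back to \<open>w'\<close>.\<close>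
        have "i \<notin> vars pre" using L_dist by (auto simp: L_app)
        then have "misses pre (w' \<oplus> {i})"
          using misses_cong[OF flip_Int, of i pre w'] mis by simp
        then have "ev L d (w' \<oplus> {i}) = v" using nb by (auto simp: L_app ev_append)
        then have "F (w' \<oplus> {i}) = v" using F_C[OF C_flip[OF Lk_sub[OF i] w'C]] by simp
        then have "F w' = v" using 1 w'C by (auto simp: Sens_def)
        then show ?thesis using Fw' mis nb by (simp add: app ev_append)
      next
        case 2
        \<comment> \<open>Distinct variables make this the first rule itself, which fires at
          \<open>w'\<close>, contrary to \<open>nb\<close>.\<close>
        have "(i, c, True) \<in> set L" by (simp add: 2(1))
        from eq_key_imp_eq_value[OF L_dist in_L this] have "b = c" by simp
        with 2 nb show ?thesis by simp
      qed
    qed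
    with Fw' show ?thesis by (simp add: w'_def)
  qed
  have hyp: "(fst (cut f Lk d), snd (cut f Lk d)) \<in> hypotheses m K"
  proof -
    have "set (fst (cut f Lk d)) \<subseteq> {..<m} \<times> UNIV \<and> length (fst (cut f Lk d)) \<le> length Lk"
    proof (rule cut_wf)
      fix i j c assume i: "i \<in> vars Lk" "f i = Some (j, c)"
      then show "j < m" using f_Some[OF i(2)] \<phi> Lk_sub[OF i(1)] by auto
    qed
    moreover have "length Lk \<le> K" by (simp add: Lk_def)
    \<comment> \<open>\<open>0 < K\<close> keeps the first rule, whose value is \<open>True\<close>.
      If its variable is revealed, that rule accepts half of the patterns; if not,
      \<open>cut\<close> returns the constant \<open>True\<close>.\<close>
    moreover have "2 ^ m \<le> 2 * card {b \<in> Pow {..<m}. ev (fst (cut f Lk d)) (snd (cut f Lk d)) b}"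
    proof (cases L)
      case Nil
      then have "Lk = []" "d" using L_first by (auto simp: Lk_def)
      then show ?thesis by (simp add: card_Pow flip: Pow_def)
    next
      case (Cons r rs)
      then obtain i c where L: "L = (i, c, True) # rs" using L_first by (cases r) auto
      obtain k where k: "K = Suc k" using K by (cases K) auto
      have Lk: "Lk = (i, c, True) # take k rs" by (simp add: Lk_def L k)
      have "i < n" using Lk_sub[of i] by (simp add: Lk)
      show ?thesis
      proof (cases "f i")
        case None
        then show ?thesis by (simp add: Lk card_Pow flip: Pow_def)
      next
        case (Some jc)
        obtain j e where je: "f i = Some (j, e)" using Some by (cases jc) simp
        have "j < m" using f_Some[OF je] \<phi> \<open>i < n\<close> by auto
        from half_first_rule[OF this] show ?thesis by (simp only: Lk cut.simps je prod.case option.case fst_conv snd_conv)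
      qed
    qed
    ultimately show ?thesis unfolding hypotheses_def by (simp add: case_prod_unfold)
  qed
  have "passes F D h y G (place D sd)" if sd: "sd \<in> set sds" for sd
  proof -
    obtain s b r s' b' \<beta> where sd_eq: "sd = ((s, b), r, (s', b'), \<beta>)" by (cases sd) auto
    define z where "z = s \<oplus> D b"
    define z' where "z' = s' \<oplus> D b'"
    define w2 where "w2 = z \<oplus> z' \<oplus> y"
    define w3 where "w3 = z' \<oplus> ((z \<oplus> y) \<inter> r)"
    have pl: "place D sd = (z, r, z', \<beta>)" by (simp add: sd_eq place_def z_def z'_def)
    have ss: "s \<in> S" "s' \<in> S" using sds[of s b r s' b' \<beta>] sd by (simp_all add: sd_eq)
    then have zC: "z \<in> C" "z' \<in> C" using C_D S_C by (auto simp: z_def z'_def)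
    have yC: "y \<in> C" using y S_C by blast
    have d1: "(z' \<oplus> y) \<inter> R = {}" "(z \<oplus> y) \<inter> R = {}" using C_diff zC yC by blast+
    have sub: "z' \<oplus> y \<subseteq> {..<n}" "z \<oplus> y \<subseteq> {..<n}" using C_sub zC yC by (simp_all add: xor_subset)
    have w2C: "w2 \<in> C" unfolding w2_def xor_assoc by (rule C_xor[OF zC(1) sub(1) d1(1)])
    have w3C: "w3 \<in> C" unfolding w3_def by (rule C_xor[OF zC(2)]) (use sub d1 in auto)
    \<comment> \<open>Overwriting the block and overwriting \<open>i\<close> alone agree on all
      relevant variables, so a pair revealing \<open>i\<close> would be a witness for its
      block.\<close>
    have wits: "\<not> (\<exists>(a, x)\<in>set W. \<not> F (upd a {i} x))" if i: "i \<in> vars Lk" and N: "f i = None" for i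
    proof
      assume "\<exists>(a, x)\<in>set W. \<not> F (upd a {i} x)"
      then obtain a x where ax: "(a, x) \<in> set W" "\<not> F (upd a {i} x)" by blast
      have "F (upd a (block \<phi> (\<phi> i)) x)"
        using f_None[OF N] ax(1) unfolding witness_def find_None_iff by auto
      moreover have "upd a (block \<phi> (\<phi> i)) x \<inter> vars Lk = upd a {i} x \<inter> vars Lk"
      proof (rule Int_eqI)
        fix i' assume "i' \<in> vars Lk"
        then have "\<phi> i' = \<phi> i \<Longrightarrow> i' = i" using inj_onD[OF inj] i by (simp add: Lk_def)
        then show "i' \<in> upd a (block \<phi> (\<phi> i)) x \<longleftrightarrow> i' \<in> upd a {i} x" by (auto simp: block_def)
      qed
      then have "F (upd a (block \<phi> (\<phi> i)) x) = F (upd a {i} x)"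
        using WC[OF ax(1)] C_upd W_block[OF ax(1)] \<phi> Lk_sub[OF i]
        by (intro Z_agree(2)[of _ _ K]) (auto simp: Lk_def)
      ultimately show False using ax(2) by simp
    qed
    have unw: "p \<notin> Sens i \<or> (\<exists>c rs. L = (i, c, True) # rs \<and> (i \<in> p) = c)"
      if i: "i \<in> vars Lk" and N: "f i = None" and p: "p \<in> points D y (place D sd)" for i p
    proof -
      have nD: "i \<notin> D b" for b using f_None[OF N] by (simp add: D shift_def)
      from vis[of i] wits[OF i N] i
      consider "\<forall>sd\<in>set sds. \<forall>p\<in>points D y (place D sd). p \<notin> Sens i"
        | c rs where "L = (i, c, True) # rs" "(i \<in> y) = c"
          "\<forall>((s, b), r, (s', b'), \<beta>)\<in>set sds. (i \<in> s) = c \<and> (i \<in> s') = c"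
        unfolding Lk_def by blast
      then show ?thesis
      proof cases
        case 1
        with p sd show ?thesis by blast
      next
        case 2
        have "(i \<in> s) = c \<and> (i \<in> s') = c" using 2(3) sd by (auto simp: sd_eq)
        \<comment> \<open>\<open>D\<close> does not touch \<open>i\<close>, and sums of three
          points, or masked combinations, of points with bit \<open>c\<close> at \<open>i\<close>
          have this bit again.\<close>
        then have "(i \<in> p) = c" using p 2(2) nD by (auto simp: points_def pl z_def z'_def)
        with 2(1) show ?thesis by blast
      qed
    qed
    have check: "F (w \<oplus> D \<gamma>) = G (h w \<oplus> \<gamma>)" if "w \<in> C" "w \<oplus> D \<gamma> \<in> points D y (place D sd)" for w \<gamma>
      using pts[OF sd that(2)] unw[OF _ _ that(2)] by (intro main[OF that(1)])
    have "D {} = {}" by (simp add: D shift_def)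
    then have k0: "F z = G (h z)" using check[OF zC(1), of "{}"] by (simp add: pl points_def)
    have k1: "F (w \<oplus> D \<beta>) = G (h w \<oplus> \<beta>)" if "w \<in> {z, w2, w3}" for w
      using that zC w2C w3C by (intro check) (auto simp: pl points_def w2_def w3_def)
    have k2: "h w2 = h z \<oplus> h z' \<oplus> h y"
    proof (rule set_eqI)
      fix j
      show "j \<in> h w2 \<longleftrightarrow> j \<in> h z \<oplus> h z' \<oplus> h y"
        using h_cases[of j]
      proof (elim disjE exE)
        assume "\<forall>w\<in>C. j \<notin> h w"
        then show ?thesis using zC yC w2C by simp
      next
        fix i c assume "\<forall>w\<in>C. j \<in> h w \<longleftrightarrow> (i \<in> w) = c"
        then show ?thesis using zC yC w2C by (auto simp: w2_def)
      qed
    qed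
    have k3: "h w3 \<oplus> h z' \<subseteq> h z \<oplus> h y"
    proof
      fix j assume j: "j \<in> h w3 \<oplus> h z'"
      show "j \<in> h z \<oplus> h y"
        using h_cases[of j]
      proof (elim disjE exE)
        assume "\<forall>w\<in>C. j \<notin> h w"
        then show ?thesis using zC w3C j by simp
      next
        fix i c assume "\<forall>w\<in>C. j \<in> h w \<longleftrightarrow> (i \<in> w) = c"
        then show ?thesis using zC yC w3C j by (auto simp: w3_def)
      qed
    qed
    show ?thesis
      unfolding pl passes_def Let_def prod.case using k0 k1 k2 k3
      by (simp add: w2_def w3_def)
  qed
  then show ?thesis
    unfolding accepts_def G_def D h_def by (intro bexI[OF _ hyp]) (simp add: case_prod_unfold)
qed

end

section \<open>Probabilities of the bad events\<close>

definition seed_pmf :: "nat \<Rightarrow> nat \<Rightarrow> nat set set \<Rightarrow> seed pmf" where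
  "seed_pmf n m S = pair_pmf (pair_pmf (pmf_of_set S) (pmf_of_set (Pow {..<m})))
     (pair_pmf (pmf_of_set (Pow {..<n}))
       (pair_pmf (pair_pmf (pmf_of_set S) (pmf_of_set (Pow {..<m}))) (pmf_of_set (Pow {..<m}))))"

lemma Pr_disj_le: "Pr p Q \<le> a \<Longrightarrow> Pr p R \<le> b \<Longrightarrow> Pr p (\<lambda>x. Q x \<or> R x) \<le> a + b"
  using Pr_disj[of p Q R] by linarith

lemma finite_hash_functions: "finite ({..<n :: nat} \<rightarrow>\<^sub>E {..<m :: nat})"
  by (intro finite_PiE) auto

text \<open>Resetting \<open>\<phi> i\<close> to an arbitrary value is injective on colliding
  functions, since the old value can be recovered from \<open>\<phi> i'\<close>.\<close>

lemma collision:
  fixes n m :: nat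
  assumes "i < n" "i' < n" "i \<noteq> i'" "0 < m"
  shows "Pr (pmf_of_set ({..<n} \<rightarrow>\<^sub>E {..<m})) (\<lambda>\<phi>. \<phi> i = \<phi> i') \<le> 1 / m"
proof -
  let ?H = "{..<n} \<rightarrow>\<^sub>E {..<m}"
  let ?E = "{\<phi> \<in> ?H. \<phi> i = \<phi> i'}"
  have fin: "finite ?H" by (rule finite_hash_functions)
  have ne: "?H \<noteq> {}" using assms(4) by (auto simp: PiE_eq_empty_iff)
  have "inj_on (\<lambda>(\<phi>, k). \<phi>(i := k)) (?E \<times> {..<m})"
  proof (rule inj_on_inverseI[where g = "\<lambda>\<psi>. (\<psi>(i := \<psi> i'), \<psi> i)"])
    fix x assume "x \<in> ?E \<times> {..<m}"
    then obtain \<phi> k where x: "x = (\<phi>, k)" "\<phi> i = \<phi> i'" by auto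
    then show "(\<lambda>\<psi>. (\<psi>(i := \<psi> i'), \<psi> i)) ((\<lambda>(\<phi>, k). \<phi>(i := k)) x) = x"
      using assms(3) by (auto simp: fun_eq_iff)
  qed
  then have "card (?E \<times> {..<m}) = card ((\<lambda>(\<phi>, k). \<phi>(i := k)) ` (?E \<times> {..<m}))"
    by (simp add: card_image)
  also have "\<dots> \<le> card ?H"
  proof (rule card_mono[OF fin], rule image_subsetI)
    fix x assume "x \<in> ?E \<times> {..<m}"
    then obtain \<phi> k where x: "x = (\<phi>, k)" "\<phi> \<in> ?H" "k < m"
      unfolding mem_Sigma_iff mem_Collect_eq lessThan_iff by blast
    have "\<phi>(i := k) \<in> ?H"
    proof (rule PiE_I)
      show "(\<phi>(i := k)) u \<in> {..<m}" if "u \<in> {..<n}" for u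
        using x(3) PiE_mem[OF x(2) that] by simp
      show "(\<phi>(i := k)) u = undefined" if "u \<notin> {..<n}" for u
      proof -
        have "u \<noteq> i" using assms(1) that by blast
        then show ?thesis using PiE_arb[OF x(2) that] by simp
      qed
    qed
    then show "(\<lambda>(\<phi>, k). \<phi>(i := k)) x \<in> ?H" by (simp add: x(1))
  qed
  finally have "card ?E * m \<le> card ?H" by (simp add: card_cartesian_product)
  from of_nat_mono[OF this, where 'a = real]
  have le: "real (card ?E) * real m \<le> real (card ?H)" by simp
  have "0 < card ?H" using fin ne by (simp only: card_gt_0_iff) simp
  then have "0 < real (card ?H)" by (simp only: of_nat_0_less_iff)
  with le assms(4) have "real (card ?E) / real (card ?H) \<le> 1 / m"
    by (simp only: divide_le_eq le_divide_eq) (simp add: field_simps)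
  then show ?thesis unfolding Pr_uniform[OF fin ne] .
qed

lemma not_inj:
  fixes n m :: nat
  assumes V: "V \<subseteq> {..<n}" and m: "0 < m" and K: "card V \<le> K"
  shows "Pr (pmf_of_set ({..<n} \<rightarrow>\<^sub>E {..<m})) (\<lambda>\<phi>. \<not> inj_on \<phi> V) \<le> K\<^sup>2 / m"
proof -
  have finV: "finite V" using V by (rule finite_subset) simp
  let ?p = "pmf_of_set ({..<n} \<rightarrow>\<^sub>E {..<m})"
  let ?X = "{x \<in> V \<times> V. fst x \<noteq> snd x}"
  have "Pr ?p (\<lambda>\<phi>. \<not> inj_on \<phi> V) \<le> Pr ?p (\<lambda>\<phi>. \<exists>x\<in>?X. \<phi> (fst x) = \<phi> (snd x))"
    by (rule Pr_mono) (auto simp: inj_on_def)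
  also have "\<dots> \<le> card ?X * (1 / m)"
    by (intro Pr_ex_finite_le collision) (use V finV m in auto)
  also have "\<dots> \<le> K\<^sup>2 * (1 / m)"
  proof (rule mult_right_mono)
    have "card ?X \<le> card (V \<times> V)" using finV by (intro card_mono) auto
    also have "\<dots> \<le> K\<^sup>2" using K by (simp add: card_cartesian_product power2_eq_square mult_mono)
    finally show "real (card ?X) \<le> real (K\<^sup>2)" by (rule of_nat_mono)
  qed simp
  finally show ?thesis by simp
qed

context dl_target
begin

abbreviation "UW \<equiv> pair_pmf US US"
abbreviation "seeds m \<equiv> seed_pmf n m S"

text \<open>The shift depends only on the component independent of \<open>s\<close>, so after
  conditioning on that component it is a fixed translation of a uniform sample.\<close>

lemma shifted_pair_le:
  assumes "finite B"
  shows "Pr (pair_pmf US q) (\<lambda>(s, b). s \<oplus> u b \<in> B) \<le> 2 * card B / card C"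
proof -
  have "Pr (pair_pmf US q) (\<lambda>(s, b). s \<oplus> u b \<in> B) = Pr (pair_pmf q US) (\<lambda>(b, s). s \<oplus> u b \<in> B)"
    by (rule trans[OF Pr_pair_swap]) simp
  also have "\<dots> \<le> 2 * card B / card C"
    by (rule Pr_pair_le) (use US_shift_le[OF assms] in simp)
  finally show ?thesis .
qed

lemma shifted_pair_le':
  assumes "finite B"
  shows "Pr (pair_pmf (pair_pmf US q) q') (\<lambda>((s, b), t). s \<oplus> u b t \<in> B) \<le> 2 * card B / card C"
proof -
  have "Pr (pair_pmf (pair_pmf US q) q') (\<lambda>((s, b), t). s \<oplus> u b t \<in> B)
      = Pr (pair_pmf q' (pair_pmf US q)) (\<lambda>(t, s, b). s \<oplus> u b t \<in> B)"
    by (rule trans[OF Pr_pair_swap]) (simp add: case_prod_unfold)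
  also have "\<dots> \<le> 2 * card B / card C"
    by (rule Pr_pair_le) (use shifted_pair_le[OF assms] in simp)
  finally show ?thesis .
qed

lemma seeds_first_le:
  assumes "finite B"
  shows "Pr (seeds m) (\<lambda>((s, b), r, (s', b'), \<beta>). s \<oplus> u b r s' b' \<beta> \<in> B) \<le> 2 * card B / card C"
  using shifted_pair_le'[OF assms, of "pmf_of_set (Pow {..<m})" _
      "\<lambda>b (r, (s', b'), \<beta>). u b r s' b' \<beta>"]
  unfolding seed_pmf_def by (simp add: case_prod_unfold)

lemma seeds_second_le:
  assumes "finite B"
  shows "Pr (seeds m) (\<lambda>((s, b), r, (s', b'), \<beta>). s' \<oplus> u s b r b' \<beta> \<in> B) \<le> 2 * card B / card C"
  unfolding seed_pmf_def
proof (rule Pr_pair_le, rule Pr_pair_le, goal_cases)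
  case (1 x r)
  show ?case using shifted_pair_le'[OF assms, of _ _ "\<lambda>b' \<beta>. u (fst x) (snd x) r b' \<beta>"]
    by (simp add: case_prod_unfold)
qed

text \<open>Each of the four points is a sample plus a shift independent of that sample:
  \<open>s\<close> for the first three, \<open>s'\<close> for the last, whose mask depends on
  \<open>s\<close>. Each contributes a factor 2.\<close>

lemma points_le:
  assumes "finite B"
  shows "Pr (seeds m) (\<lambda>sd. \<exists>p\<in>points D y (place D sd). p \<in> B) \<le> 8 * card B / card C"
proof -
  let ?c = "2 * card B / card C"
  have "Pr (seeds m) (\<lambda>sd. \<exists>p\<in>points D y (place D sd). p \<in> B)
    = Pr (seeds m) (\<lambda>x. (\<lambda>((s, b), r, (s', b'), \<beta>). s \<oplus> D b \<in> B) x \<or>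
        ((\<lambda>((s, b), r, (s', b'), \<beta>). s \<oplus> (D b \<oplus> D \<beta>) \<in> B) x \<or>
         ((\<lambda>((s, b), r, (s', b'), \<beta>). s \<oplus> (D b \<oplus> (s' \<oplus> D b') \<oplus> y \<oplus> D \<beta>) \<in> B) x \<or>
          (\<lambda>((s, b), r, (s', b'), \<beta>). s' \<oplus> (D b' \<oplus> ((s \<oplus> D b \<oplus> y) \<inter> r) \<oplus> D \<beta>) \<in> B) x)))"
    by (rule Pr_cong) (auto simp: points_def place_def xor_assoc)
  also have "\<dots> \<le> ?c + (?c + (?c + ?c))"
  proof (intro Pr_disj_le)
    show "Pr (seeds m) (\<lambda>((s, b), r, (s', b'), \<beta>). s \<oplus> D b \<in> B) \<le> ?c"
      by (rule seeds_first_le[OF assms, where u = "\<lambda>b r s' b' \<beta>. D b"])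
    show "Pr (seeds m) (\<lambda>((s, b), r, (s', b'), \<beta>). s \<oplus> (D b \<oplus> D \<beta>) \<in> B) \<le> ?c"
      by (rule seeds_first_le[OF assms, where u = "\<lambda>b r s' b' \<beta>. D b \<oplus> D \<beta>"])
    show "Pr (seeds m) (\<lambda>((s, b), r, (s', b'), \<beta>). s \<oplus> (D b \<oplus> (s' \<oplus> D b') \<oplus> y \<oplus> D \<beta>) \<in> B) \<le> ?c"
      by (rule seeds_first_le[OF assms, where u = "\<lambda>b r s' b' \<beta>. D b \<oplus> (s' \<oplus> D b') \<oplus> y \<oplus> D \<beta>"])
    show "Pr (seeds m) (\<lambda>((s, b), r, (s', b'), \<beta>). s' \<oplus> (D b' \<oplus> ((s \<oplus> D b \<oplus> y) \<inter> r) \<oplus> D \<beta>) \<in> B) \<le> ?c"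
      by (rule seeds_second_le[OF assms, where u = "\<lambda>s b r b' \<beta>. D b' \<oplus> ((s \<oplus> D b \<oplus> y) \<inter> r) \<oplus> D \<beta>"])
  qed
  finally show ?thesis by simp
qed

lemma card_Z: "card (Z K) / card C \<le> 1 / 2 ^ K"
proof (cases "K < length L")
  case True
  have "vars (take K L) \<subseteq> {..<n} - R" "distinct (map fst (take K L))"
    using L_sub L_dist set_take_subset[of K L] by (auto simp: take_map[symmetric])
  from card_misses[OF this(2,1)] True have "2 ^ K * card (Z K) = card C" by (simp add: Z_def)
  then have "real (2 ^ K * card (Z K)) = card C" by (rule arg_cong)
  then show ?thesis using card_C by (simp add: field_simps)
next
  case False
  then have "Z K = {}" by (simp add: Z_def)
  then show ?thesis by simp
qed

lemma finite_Z [simp]: "finite (Z K)"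
  by (simp add: Z_def)

text \<open>The summands bound in turn: a collision of relevant variables; a pair with
  \<open>a\<close> or an overwritten point in \<open>Z K\<close>; a tested point in
  \<open>Z K\<close>; a variable with \<open>revealed\<close> at least \<open>\<tau>\<close> that no
  pair shows; a tested point sensitive to a weak variable; and the base point, or a sample in a
  test, lacking the accepting value of a nearly constant first variable.\<close>

lemma accepts_probably:
  fixes K m N1 N2 :: nat and \<tau> :: real
  assumes K: "0 < K" and m: "0 < m" and \<tau>: "0 \<le> \<tau>" "\<tau> \<le> 1"
  shows "Pr (pair_pmf (pmf_of_set ({..<n} \<rightarrow>\<^sub>E {..<m})) (pair_pmf US
             (pair_pmf (replicate_pmf N2 UW) (replicate_pmf N1 (seeds m)))))
           (\<lambda>(\<phi>, y, W, sds). \<not> accepts n m K F \<phi> y W sds)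
     \<le> K\<^sup>2 / m + (N2 * ((2 + 4 * real (m + K)) * (1 / 2 ^ K)) + (N1 * 8 / 2 ^ K +
        (K * (1 - \<tau>) ^ N2 + (K * (N1 * (64 * \<tau>)) + (4 * \<tau> + N1 * (8 * \<tau>))))))"
proof -
  let ?H = "pmf_of_set ({..<n} \<rightarrow>\<^sub>E {..<m})"
  let ?W = "replicate_pmf N2 UW"
  let ?D = "replicate_pmf N1 (seeds m)"
  let ?J = "pair_pmf ?H (pair_pmf US (pair_pmf ?W ?D))"
  define V where "V = vars (take K L)"
  have V: "V \<subseteq> {..<n} - R" using L_sub set_take_subset[of K L] unfolding V_def by blast
  have finV: "finite V" by (simp add: V_def)
  have cardV: "card V \<le> K"
    unfolding V_def by (rule order.trans[OF card_image_le]) (auto intro: order.trans[OF card_length])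
  have H_ne: "{..<n} \<rightarrow>\<^sub>E {..<m} \<noteq> {}" using m by (auto simp: PiE_eq_empty_iff)
  have set_H: "set_pmf ?H = {..<n} \<rightarrow>\<^sub>E {..<m}"
    by (rule set_pmf_of_set[OF H_ne finite_hash_functions])
  have set_sd: "set_pmf (seeds m) \<subseteq> {((s, b), r, (s', b'), \<beta>). s \<in> S \<and> s' \<in> S}"
    by (auto simp: seed_pmf_def)
  define first where "first i c \<longleftrightarrow> (\<exists>rs. L = (i, c, True) # rs) \<and> Pr US (\<lambda>s. (i \<in> s) \<noteq> c) \<le> 4 * \<tau>" for i c
  define bad2 where "bad2 \<phi> = (\<lambda>(a, x). a \<in> Z K \<or> (\<exists>B\<in>block \<phi> ` {..<m} \<union> (\<lambda>i. {i}) ` V. upd a B x \<in> Z K))"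
    for \<phi> :: "nat \<Rightarrow> nat"
  define B1 where "B1 \<phi> \<longleftrightarrow> \<not> inj_on \<phi> V" for \<phi> :: "nat \<Rightarrow> nat"
  define B2 where "B2 \<phi> W \<longleftrightarrow> (\<exists>ax\<in>set W. bad2 \<phi> ax)" for \<phi> :: "nat \<Rightarrow> nat" and W
  define hit where "hit \<phi> y W B sd \<longleftrightarrow> (\<exists>p\<in>points (shift n F \<phi> W) y (place (shift n F \<phi> W) sd). p \<in> B)"
    for \<phi> y W B and sd :: seed
  define B3 where "B3 \<phi> y W sds \<longleftrightarrow> (\<exists>sd\<in>set sds. hit \<phi> y W (Z K) sd)" for \<phi> y W sds
  define B4 where "B4 W \<longleftrightarrow> (\<exists>i\<in>V. \<tau> \<le> revealed i \<and> (\<forall>ax\<in>set W. F (upd (fst ax) {i} (snd ax))))" for W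
  define B5 where "B5 \<phi> y W sds \<longleftrightarrow> (\<exists>i\<in>V. card (Sens i) < 8 * \<tau> * card C \<and> (\<exists>sd\<in>set sds. hit \<phi> y W (Sens i) sd))"
    for \<phi> y W sds
  define B6 where "B6 y \<longleftrightarrow> (\<exists>i c. first i c \<and> (i \<in> y) \<noteq> c)" for y
  define B7 where "B7 sds \<longleftrightarrow> (\<exists>sd\<in>set sds. B6 (fst (fst sd)) \<or> B6 (fst (fst (snd (snd sd)))))" for sds :: "seed list"
  have acc: "accepts n m K F \<phi> y W sds"
    if in_supp: "(\<phi>, y, W, sds) \<in> set_pmf ?J" and good: "\<not> B1 \<phi>" "\<not> B2 \<phi> W" "\<not> B3 \<phi> y W sds"
      "\<not> B4 W" "\<not> B5 \<phi> y W sds" "\<not> B6 y" "\<not> B7 sds" for \<phi> y W sds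
  proof (rule accepts_if[OF K, where \<phi> = \<phi> and D = "shift n F \<phi> W"])
    have supp: "\<phi> \<in> {..<n} \<rightarrow>\<^sub>E {..<m}" "y \<in> S" "set W \<subseteq> S \<times> S" "set sds \<subseteq> set_pmf (seeds m)"
      using in_supp by (auto simp: set_H set_replicate_pmf)
    show "\<phi> i < m" if "i < n" for i using supp(1) that by auto
    show "inj_on \<phi> (vars (take K L))" using good(1) by (simp add: B1_def V_def)
    show "y \<in> S" by (rule supp(2))
    show "a \<in> S \<and> x \<in> S \<and> a \<notin> Z K" if "(a, x) \<in> set W" for a x
      using good(2) supp(3) that unfolding B2_def bad2_def by blast
    show "upd a (block \<phi> j) x \<notin> Z K" if "(a, x) \<in> set W" "j < m" for a x j
      using good(2) that unfolding B2_def bad2_def by blast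
    show "upd a {i} x \<notin> Z K" if "(a, x) \<in> set W" "i \<in> vars (take K L)" for a x i
      using good(2) that unfolding B2_def bad2_def V_def by blast
    show "s \<in> S \<and> s' \<in> S" if "((s, b), r, (s', b'), \<beta>) \<in> set sds" for s b r s' b' \<beta>
      using supp(4) that set_sd by blast
    show "p \<notin> Z K" if "sd \<in> set sds" "p \<in> points (shift n F \<phi> W) y (place (shift n F \<phi> W) sd)" for sd p
      using good(3) that unfolding B3_def hit_def by blast
    show "(\<exists>(a, x)\<in>set W. \<not> F (upd a {i} x)) \<or>
      (\<forall>sd\<in>set sds. \<forall>p\<in>points (shift n F \<phi> W) y (place (shift n F \<phi> W) sd). p \<notin> Sens i) \<or>
      (\<exists>c rs. L = (i, c, True) # rs \<and> (i \<in> y) = c \<and>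
        (\<forall>((s, b), r, (s', b'), \<beta>)\<in>set sds. (i \<in> s) = c \<and> (i \<in> s') = c))"
      if "i \<in> vars (take K L)" for i
    proof -
      have i: "i \<in> V" "i \<in> vars L"
        using that image_mono[OF set_take_subset[of K L], of fst] unfolding V_def by blast+
      have "\<tau> \<le> revealed i \<or> card (Sens i) < 8 * \<tau> * card C \<or> (\<exists>c. first i c)"
      proof (cases "8 * \<tau> * card C \<le> card (Sens i)")
        case True
        from influential_revealed[OF i(2) True \<tau>(1)] show ?thesis unfolding first_def by blast
      qed simp
      then consider "\<tau> \<le> revealed i" | "card (Sens i) < 8 * \<tau> * card C" | c where "first i c"
        by blast
      then show ?thesis
      proof cases
        case 1
        then have "\<not> (\<forall>ax\<in>set W. F (upd (fst ax) {i} (snd ax)))"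
          using good(4) i(1) unfolding B4_def by blast
        then show ?thesis by (simp add: case_prod_unfold)
      next
        case 2
        then have "\<not> hit \<phi> y W (Sens i) sd" if "sd \<in> set sds" for sd
          using good(5) i(1) that unfolding B5_def by blast
        then show ?thesis unfolding hit_def by blast
      next
        case 3
        have bit: "(i \<in> w) = c" if "\<not> B6 w" for w using that 3 unfolding B6_def by blast
        have "\<forall>sd\<in>set sds. \<not> B6 (fst (fst sd)) \<and> \<not> B6 (fst (fst (snd (snd sd))))"
          using good(7) unfolding B7_def by blast
        then have "\<forall>((s, b), r, (s', b'), \<beta>)\<in>set sds. (i \<in> s) = c \<and> (i \<in> s') = c"
          using bit by (simp add: case_prod_unfold)
        moreover obtain rs where "L = (i, c, True) # rs" using 3 unfolding first_def by blast
        ultimately show ?thesis using bit[OF good(6)] by blast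
      qed
    qed
  qed simp
  have P1: "Pr ?J (\<lambda>(\<phi>, y, W, sds). B1 \<phi>) \<le> K\<^sup>2 / m"
  proof -
    have "V \<subseteq> {..<n}" using V by blast
    from not_inj[OF this m cardV] have "Pr ?H B1 \<le> K\<^sup>2 / m" unfolding B1_def by simp
    then show ?thesis using Pr_pair_fst[of ?H "pair_pmf US (pair_pmf ?W ?D)" B1] by (simp add: case_prod_unfold)
  qed
  have P2: "Pr ?J (\<lambda>(\<phi>, y, W, sds). B2 \<phi> W) \<le> N2 * ((2 + 4 * real (m + K)) * (1 / 2 ^ K))"
  proof (rule Pr_pair_le, rule Pr_pair_le, goal_cases)
    case (1 \<phi> y)
    let ?Bs = "block \<phi> ` {..<m} \<union> (\<lambda>i. {i}) ` V"
    have cBs: "card ?Bs \<le> m + K"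
      by (rule order.trans[OF card_Un_le])
         (intro add_mono order.trans[OF card_image_le], use finV cardV in auto)
    have "Pr UW (\<lambda>ax. (case ax of (a, x) \<Rightarrow> a \<in> Z K)
         \<or> (\<exists>B\<in>?Bs. case ax of (a, x) \<Rightarrow> upd a B x \<in> Z K))
       \<le> 2 * card (Z K) / card C + card ?Bs * (4 * card (Z K) / card C)"
    proof (intro Pr_disj_le Pr_ex_finite_le)
      show "Pr UW (\<lambda>(a, x). a \<in> Z K) \<le> 2 * card (Z K) / card C"
        using Pr_pair_fst[of US US "\<lambda>a. a \<in> Z K"] US_le[of "Z K"] by (simp add: case_prod_unfold)
      show "finite ?Bs" using finV by simp
      show "Pr UW (\<lambda>(a, x). upd a B x \<in> Z K) \<le> 4 * card (Z K) / card C" for B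
        by (rule US_upd_le) (auto simp: Z_def)
    qed
    also have "\<dots> = (2 + 4 * real (card ?Bs)) * (card (Z K) / card C)" by (simp add: algebra_simps)
    also have "\<dots> \<le> (2 + 4 * real (m + K)) * (1 / 2 ^ K)"
    proof (intro mult_mono card_Z)
      show "2 + 4 * real (card ?Bs) \<le> 2 + 4 * real (m + K)" using of_nat_mono[OF cBs, where 'a = real] by simp
    qed auto
    finally have bad: "Pr UW (bad2 \<phi>) \<le> (2 + 4 * real (m + K)) * (1 / 2 ^ K)"
      by (simp add: bad2_def case_prod_unfold)
    have "Pr (pair_pmf ?W ?D) (\<lambda>x. B2 \<phi> (fst x)) = Pr ?W (B2 \<phi>)" by (rule Pr_pair_fst)
    also have "\<dots> \<le> N2 * Pr UW (bad2 \<phi>)" unfolding B2_def by (rule Pr_replicate_ex)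
    also have "\<dots> \<le> N2 * ((2 + 4 * real (m + K)) * (1 / 2 ^ K))"
      using bad by (intro mult_left_mono) auto
    finally have "Pr (pair_pmf ?W ?D) (\<lambda>x. B2 \<phi> (fst x)) \<le> N2 * ((2 + 4 * real (m + K)) * (1 / 2 ^ K))" .
    then show ?case unfolding case_prod_unfold fst_conv snd_conv .
  qed
  have hit_le: "Pr ?D (\<lambda>sds. \<exists>sd\<in>set sds. hit \<phi> y W B sd) \<le> N1 * (8 * card B / card C)"
    if "finite B" for \<phi> y W B
    by (rule order.trans[OF Pr_replicate_ex], rule mult_left_mono)
       (use points_le[OF that] in \<open>simp_all add: hit_def\<close>)
  have P3: "Pr ?J (\<lambda>(\<phi>, y, W, sds). B3 \<phi> y W sds) \<le> N1 * 8 / 2 ^ K"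
  proof (rule Pr_pair_le, rule Pr_pair_le, rule Pr_pair_le, goal_cases)
    case (1 \<phi> y W)
    have "Pr ?D (\<lambda>sds. B3 \<phi> y W sds) \<le> N1 * 8 * (card (Z K) / card C)"
      using hit_le[OF finite_Z[of K], of \<phi> y W] by (simp add: B3_def mult.assoc)
    also have "\<dots> \<le> N1 * 8 * (1 / 2 ^ K)" by (intro mult_left_mono card_Z) simp
    finally show ?case by simp
  qed
  have P4: "Pr ?J (\<lambda>(\<phi>, y, W, sds). B4 W) \<le> K * (1 - \<tau>) ^ N2"
  proof (rule Pr_pair_le, rule Pr_pair_le, goal_cases)
    case (1 \<phi> y)
    have "Pr (pair_pmf ?W ?D) (\<lambda>x. B4 (fst x)) = Pr ?W B4" by (rule Pr_pair_fst)
    also have "\<dots> \<le> card V * (1 - \<tau>) ^ N2"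
      unfolding B4_def
    proof (rule Pr_ex_finite_le[OF finV])
      fix i
      show "Pr ?W (\<lambda>W. \<tau> \<le> revealed i \<and> (\<forall>ax\<in>set W. F (upd (fst ax) {i} (snd ax)))) \<le> (1 - \<tau>) ^ N2"
      proof (cases "\<tau> \<le> revealed i")
        case True
        have "Pr UW (\<lambda>ax. F (upd (fst ax) {i} (snd ax))) \<le> 1 - \<tau>"
          using True Pr_not[of UW "\<lambda>ax. F (upd (fst ax) {i} (snd ax))"]
          by (simp add: revealed_def case_prod_unfold)
        then show ?thesis using True by (simp add: Pr_replicate_all power_mono)
      qed (use \<tau> in simp)
    qed
    also have "\<dots> \<le> K * (1 - \<tau>) ^ N2" using cardV \<tau> by (intro mult_right_mono) auto
    finally show ?case by (simp add: case_prod_unfold)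
  qed
  have P5: "Pr ?J (\<lambda>(\<phi>, y, W, sds). B5 \<phi> y W sds) \<le> K * (N1 * (64 * \<tau>))"
  proof (rule Pr_pair_le, rule Pr_pair_le, rule Pr_pair_le, goal_cases)
    case (1 \<phi> y W)
    have "Pr ?D (\<lambda>sds. B5 \<phi> y W sds) \<le> card V * (N1 * (64 * \<tau>))"
      unfolding B5_def
    proof (rule Pr_ex_finite_le[OF finV])
      fix i
      show "Pr ?D (\<lambda>sds. card (Sens i) < 8 * \<tau> * card C \<and> (\<exists>sd\<in>set sds. hit \<phi> y W (Sens i) sd))
          \<le> N1 * (64 * \<tau>)"
      proof (cases "card (Sens i) < 8 * \<tau> * card C")
        case True
        have "Pr ?D (\<lambda>sds. \<exists>sd\<in>set sds. hit \<phi> y W (Sens i) sd) \<le> N1 * (8 * card (Sens i) / card C)"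
          by (rule hit_le) (rule finite_subset[OF Sens_C], simp)
        also have "\<dots> \<le> N1 * (64 * \<tau>)"
          using True card_C by (intro mult_left_mono) (simp_all add: field_simps)
        finally show ?thesis using True by simp
      qed (use \<tau> in simp)
    qed
    also have "\<dots> \<le> K * (N1 * (64 * \<tau>))" using cardV \<tau> by (intro mult_right_mono) auto
    finally show ?case by simp
  qed
  have B6: "Pr US B6 \<le> 4 * \<tau>"
  proof (cases "\<exists>i c. first i c")
    case True
    then obtain i c where ic: "first i c" by blast
    have uniq: "i' = i \<and> c' = c" if "first i' c'" for i' c' using that ic by (auto simp: first_def)
    have "Pr US B6 \<le> Pr US (\<lambda>s. (i \<in> s) \<noteq> c)"
      by (rule Pr_mono) (use uniq in \<open>auto simp: B6_def\<close>)
    also have "\<dots> \<le> 4 * \<tau>" using ic by (simp add: first_def)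
    finally show ?thesis .
  qed (use \<tau> in \<open>simp add: B6_def\<close>)
  have P6: "Pr ?J (\<lambda>(\<phi>, y, W, sds). B6 y) \<le> 4 * \<tau>"
    by (rule Pr_pair_le) (use B6 Pr_pair_fst[of US "pair_pmf ?W ?D" B6] in \<open>simp add: case_prod_unfold\<close>)
  have P7: "Pr ?J (\<lambda>(\<phi>, y, W, sds). B7 sds) \<le> N1 * (8 * \<tau>)"
  proof (rule Pr_pair_le, rule Pr_pair_le, rule Pr_pair_le, goal_cases)
    case (1 \<phi> y W)
    have "Pr (seeds m) (\<lambda>sd. B6 (fst (fst sd)) \<or> B6 (fst (fst (snd (snd sd))))) \<le> 4 * \<tau> + 4 * \<tau>"
    proof (rule Pr_disj_le)
      show "Pr (seeds m) (\<lambda>sd. B6 (fst (fst sd))) \<le> 4 * \<tau>"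
        unfolding seed_pmf_def
        using Pr_pair_fst[where Q = "\<lambda>x. B6 (fst x)"] Pr_pair_fst[where Q = B6] B6 by metis
      show "Pr (seeds m) (\<lambda>sd. B6 (fst (fst (snd (snd sd))))) \<le> 4 * \<tau>"
        unfolding seed_pmf_def
      proof (rule Pr_pair_le, rule Pr_pair_le, goal_cases)
        case (1 x r)
        have "Pr (pair_pmf (pair_pmf US (pmf_of_set (Pow {..<m}))) (pmf_of_set (Pow {..<m})))
          (\<lambda>y. B6 (fst (fst y))) \<le> 4 * \<tau>"
          using Pr_pair_fst[where Q = "\<lambda>x. B6 (fst x)"] Pr_pair_fst[where Q = B6] B6 by metis
        then show ?case by simp
      qed
    qed
    then have "N1 * Pr (seeds m) (\<lambda>sd. B6 (fst (fst sd)) \<or> B6 (fst (fst (snd (snd sd))))) \<le> N1 * (8 * \<tau>)"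
      by (intro mult_left_mono) auto
    moreover have "Pr ?D B7 \<le> N1 * Pr (seeds m) (\<lambda>sd. B6 (fst (fst sd)) \<or> B6 (fst (fst (snd (snd sd)))))"
      unfolding B7_def by (rule Pr_replicate_ex)
    ultimately show ?case by simp
  qed
  have "Pr ?J (\<lambda>(\<phi>, y, W, sds). \<not> accepts n m K F \<phi> y W sds)
    \<le> Pr ?J (\<lambda>x. (case x of (\<phi>, y, W, sds) \<Rightarrow> B1 \<phi>) \<or> ((case x of (\<phi>, y, W, sds) \<Rightarrow> B2 \<phi> W) \<or>
       ((case x of (\<phi>, y, W, sds) \<Rightarrow> B3 \<phi> y W sds) \<or> ((case x of (\<phi>, y, W, sds) \<Rightarrow> B4 W) \<or>
       ((case x of (\<phi>, y, W, sds) \<Rightarrow> B5 \<phi> y W sds) \<or> ((case x of (\<phi>, y, W, sds) \<Rightarrow> B6 y) \<or>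
        (case x of (\<phi>, y, W, sds) \<Rightarrow> B7 sds)))))))"
    by (rule Pr_mono) (use acc in blast)
  also have "\<dots> \<le> K\<^sup>2 / m + (N2 * ((2 + 4 * real (m + K)) * (1 / 2 ^ K)) + (N1 * 8 / 2 ^ K +
        (K * (1 - \<tau>) ^ N2 + (K * (N1 * (64 * \<tau>)) + (4 * \<tau> + N1 * (8 * \<tau>))))))"
    by (intro Pr_disj_le P1 P2 P3 P4 P5 P6 P7)
  finally show ?thesis .
qed

end

section \<open>The tester as a query algorithm\<close>

definition to_set :: "bool list \<Rightarrow> nat set" where
  "to_set x = {i. i < length x \<and> x ! i}"

definition to_list :: "nat \<Rightarrow> nat set \<Rightarrow> bool list" where
  "to_list n A = map (\<lambda>i. i \<in> A) [0..<n]"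

lemma to_list_cube [simp]: "to_list n A \<in> cube n"
  by (simp add: to_list_def cube_def)

lemma to_list_to_set: "x \<in> cube n \<Longrightarrow> to_list n (to_set x) = x"
  by (auto simp: to_list_def to_set_def cube_def intro: nth_equalityI)

lemma to_set_to_list: "A \<subseteq> {..<n} \<Longrightarrow> to_set (to_list n A) = A"
  by (auto simp: to_list_def to_set_def)

lemma to_set_sub: "x \<in> cube n \<Longrightarrow> to_set x \<subseteq> {..<n}"
  by (auto simp: to_set_def cube_def)

lemma bij_to_list: "bij_betw (to_list n) (Pow {..<n}) (cube n)"
  by (rule bij_betw_byWitness[where f' = to_set])
     (auto simp: to_set_to_list to_list_to_set dest: to_set_sub)

lemma eval_list_to_list:
  assumes "vars rs \<subseteq> {..<n}"
  shows "eval_list rs d (to_list n A) = ev rs d A"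
  using assms by (induction rs) (auto simp: to_list_def)

definition calls :: "nat \<Rightarrow> (bool list \<Rightarrow> bool) \<Rightarrow> query_alg \<Rightarrow> nat \<Rightarrow> bool" where
  "calls n f A k \<longleftrightarrow> (\<forall>x\<in>set_pmf (run n f A). snd x \<le> k)"

lemma calls_simps [simp]:
  "calls n f (Output b) k"
  "calls n f (MQ x c) (Suc k) \<longleftrightarrow> calls n f (c (f x)) k"
  by (auto simp: calls_def)

lemma calls_Samp:
  assumes "ones n f \<noteq> {}"
  shows "calls n f (Samp c) (Suc k) \<longleftrightarrow> (\<forall>x\<in>ones n f. calls n f (c x) k)"
proof -
  have "finite (ones n f)" using finite_cube by (simp add: ones_def)
  then show ?thesis using assms by (auto simp: calls_def set_pmf_of_set)
qed

lemma calls_Rand: "calls n f (Rand j c) k \<longleftrightarrow> (\<forall>x\<le>j. calls n f (c x) k)"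
  by (auto simp: calls_def set_pmf_of_set)

lemma verdict_simps:
  "verdict n f (Output b) = return_pmf b"
  "verdict n f (MQ x c) = verdict n f (c (f x))"
  "verdict n f (Samp cs) = bind_pmf (pmf_of_set (ones n f)) (\<lambda>x. verdict n f (cs x))"
  "verdict n f (Rand k cr) = bind_pmf (pmf_of_set {..k}) (\<lambda>x. verdict n f (cr x))"
  by (simp_all add: verdict_def map_bind_pmf pmf.map_comp)

text \<open>A program in continuation-passing style that draws from \<open>p\<close> at the price of \<open>k\<close> calls.\<close>

definition draws :: "nat \<Rightarrow> (bool list \<Rightarrow> bool) \<Rightarrow> (('a \<Rightarrow> query_alg) \<Rightarrow> query_alg) \<Rightarrow> 'a pmf \<Rightarrow> nat \<Rightarrow> bool"
  where "draws n f P p k \<longleftrightarrow>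
    (\<forall>c. verdict n f (P c) = bind_pmf p (\<lambda>a. verdict n f (c a))) \<and>
    (\<forall>c t. (\<forall>a\<in>set_pmf p. calls n f (c a) t) \<longrightarrow> calls n f (P c) (k + t))"

definition enum_set :: "'a set \<Rightarrow> nat \<Rightarrow> 'a" where
  "enum_set X = (SOME g. bij_betw g {..<card X} X)"

lemma bij_enum_set: "finite X \<Longrightarrow> bij_betw (enum_set X) {..<card X} X"
  unfolding enum_set_def using ex_bij_betw_nat_finite[of X] someI_ex[of "\<lambda>g. bij_betw g {..<card X} X"]
  by (simp add: atLeast0LessThan)

text \<open>\<open>Rand k\<close> has \<open>k + 1\<close> outcomes, hence
  \<open>card X - 1\<close>.\<close>

definition uniform :: "'a set \<Rightarrow> ('a \<Rightarrow> query_alg) \<Rightarrow> query_alg" where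
  "uniform X c = Rand (card X - 1) (\<lambda>i. c (enum_set X i))"

lemma draws_uniform:
  assumes "finite X" "X \<noteq> {}"
  shows "draws n f (uniform X) (pmf_of_set X) 0"
proof -
  have pos: "0 < card X" using assms by (simp add: card_gt_0_iff)
  then have eq: "{..card X - 1} = {..<card X}" by auto
  have bij: "bij_betw (enum_set X) {..card X - 1} X" unfolding eq by (rule bij_enum_set[OF assms(1)])
  have "map_pmf (enum_set X) (pmf_of_set {..card X - 1}) = pmf_of_set X"
    by (rule map_pmf_of_set_bij_betw[OF bij]) auto
  then have "pmf_of_set X = map_pmf (enum_set X) (pmf_of_set {..card X - 1})" ..
  then have "verdict n f (uniform X c) = bind_pmf (pmf_of_set X) (\<lambda>a. verdict n f (c a))" for c
    by (simp add: uniform_def verdict_simps bind_map_pmf)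
  moreover have "calls n f (uniform X c) t" if "\<forall>a\<in>set_pmf (pmf_of_set X). calls n f (c a) t" for c t
    using that assms bij_betwE[OF bij] by (auto simp: uniform_def calls_Rand set_pmf_of_set)
  ultimately show ?thesis by (simp add: draws_def)
qed

definition set_ones :: "nat \<Rightarrow> (bool list \<Rightarrow> bool) \<Rightarrow> nat set set" where
  "set_ones n f = {A \<in> Pow {..<n}. f (to_list n A)}"

lemma ones_to_list: "ones n f = to_list n ` set_ones n f"
proof (intro equalityI subsetI)
  fix x assume x: "x \<in> ones n f"
  then have "x = to_list n (to_set x)" "to_set x \<subseteq> {..<n}"
    by (auto simp: ones_def to_list_to_set dest: to_set_sub)
  with x show "x \<in> to_list n ` set_ones n f"
    by (intro image_eqI[of _ _ "to_set x"]) (auto simp: set_ones_def ones_def)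
qed (auto simp: set_ones_def ones_def)

lemma inj_to_list: "inj_on (to_list n) (set_ones n f)"
  using bij_betw_imp_inj_on[OF bij_to_list] by (rule inj_on_subset) (auto simp: set_ones_def)

lemma finite_set_ones [simp]: "finite (set_ones n f)"
  by (simp add: set_ones_def)

lemma card_ones: "card (ones n f) = card (set_ones n f)"
  unfolding ones_to_list by (intro card_image inj_to_list)

definition sample :: "(nat set \<Rightarrow> query_alg) \<Rightarrow> query_alg" where
  "sample c = Samp (\<lambda>x. c (to_set x))"

lemma draws_sample:
  assumes "set_ones n f \<noteq> {}"
  shows "draws n f sample (pmf_of_set (set_ones n f)) 1"
proof -
  have ne: "ones n f \<noteq> {}" using assms by (simp add: ones_to_list)
  have fin: "finite (ones n f)" by (simp add: ones_to_list)
  have inv: "to_set (to_list n A) = A" if "A \<in> set_ones n f" for A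
    using that by (simp add: set_ones_def to_set_to_list)
  have "inj_on to_set (ones n f)"
    unfolding ones_to_list by (intro inj_onI) (auto simp: inv)
  then have "map_pmf to_set (pmf_of_set (ones n f)) = pmf_of_set (to_set ` ones n f)"
    using ne fin by (rule map_pmf_of_set_inj)
  also have "to_set ` ones n f = set_ones n f"
    unfolding ones_to_list by (force simp: image_image inv)
  finally have eq: "pmf_of_set (set_ones n f) = map_pmf to_set (pmf_of_set (ones n f))" ..
  then have "verdict n f (sample c) = bind_pmf (pmf_of_set (set_ones n f)) (\<lambda>a. verdict n f (c a))" for c
    by (simp add: sample_def verdict_simps bind_map_pmf)
  moreover have "calls n f (sample c) (Suc t)"
    if "\<forall>a\<in>set_pmf (pmf_of_set (set_ones n f)). calls n f (c a) t" for c t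
    using that assms inv by (auto simp: sample_def calls_Samp[OF ne] ones_to_list set_pmf_of_set)
  ultimately show ?thesis by (simp add: draws_def)
qed

definition both where "both P Q c = P (\<lambda>a. Q (\<lambda>b. c (a, b)))"

lemma draws_both:
  assumes "draws n f P p k" "draws n f Q q l"
  shows "draws n f (both P Q) (pair_pmf p q) (k + l)"
proof -
  have "calls n f (both P Q c) (k + (l + t))"
    if c: "\<forall>x\<in>set_pmf (pair_pmf p q). calls n f (c x) t" for c t
    using assms c unfolding draws_def both_def by simp
  then show ?thesis
    using assms unfolding draws_def
    by (simp add: both_def pair_pmf_def bind_assoc_pmf bind_return_pmf add.assoc)
qed

primrec repeat_draw :: "nat \<Rightarrow> (('a \<Rightarrow> query_alg) \<Rightarrow> query_alg) \<Rightarrow> ('a list \<Rightarrow> query_alg) \<Rightarrow> query_alg" where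
  "repeat_draw 0 P c = c []"
| "repeat_draw (Suc k) P c = P (\<lambda>x. repeat_draw k P (\<lambda>xs. c (x # xs)))"

lemma draws_repeat:
  assumes "draws n f P p l"
  shows "draws n f (repeat_draw k P) (replicate_pmf k p) (k * l)"
proof (induction k)
  case 0
  show ?case by (simp add: draws_def bind_return_pmf)
next
  case (Suc k)
  have "calls n f (repeat_draw (Suc k) P c) (l + (k * l + t))"
    if c: "\<forall>xs\<in>set_pmf (replicate_pmf (Suc k) p). calls n f (c xs) t" for c t
  proof -
    have "calls n f (repeat_draw k P (\<lambda>xs. c (x # xs))) (k * l + t)" if "x \<in> set_pmf p" for x
      using Suc.IH c that unfolding draws_def by simp
    then show ?thesis using assms unfolding draws_def by simp
  qed
  then show ?case
    using assms Suc.IH unfolding draws_def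
    by (simp add: bind_assoc_pmf bind_return_pmf add.assoc)
qed

section \<open>Two rounds of queries\<close>

text \<open>The continuation gets a table that is correct at the listed points and keeps the values
  of \<open>g\<close> elsewhere. That the verdict ignores the other values is shown by the
  congruence lemmas.\<close>

primrec ask :: "bool list list \<Rightarrow> (bool list \<Rightarrow> bool) \<Rightarrow> ((bool list \<Rightarrow> bool) \<Rightarrow> query_alg) \<Rightarrow> query_alg" where
  "ask [] g c = c g"
| "ask (x # xs) g c = MQ x (\<lambda>b. ask xs (g(x := b)) c)"

lemma ask_answers: "\<exists>g'. (\<forall>x. g' x = (if x \<in> set xs then f x else g x)) \<and>
    verdict n f (ask xs g c) = verdict n f (c g') \<and>
    (\<forall>t. calls n f (c g') t \<longrightarrow> calls n f (ask xs g c) (length xs + t))"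
proof (induction xs arbitrary: g)
  case (Cons x xs)
  from Cons.IH[of "g(x := f x)"] obtain g' where g':
    "\<forall>u. g' u = (if u \<in> set xs then f u else (g(x := f x)) u)"
    "verdict n f (ask xs (g(x := f x)) c) = verdict n f (c g')"
    "\<forall>t. calls n f (c g') t \<longrightarrow> calls n f (ask xs (g(x := f x)) c) (length xs + t)" by blast
  have "\<forall>u. g' u = (if u \<in> set (x # xs) then f u else g u)"
  proof
    fix u
    from g'(1) have "g' u = (if u \<in> set xs then f u else (g(x := f x)) u)" by (rule spec)
    then show "g' u = (if u \<in> set (x # xs) then f u else g u)" by (cases "u = x") simp_all
  qed
  moreover have "verdict n f (ask (x # xs) g c) = verdict n f (c g')"
    unfolding ask.simps verdict_simps(2) by (rule g'(2))
  moreover have "calls n f (ask (x # xs) g c) (length (x # xs) + t)" if "calls n f (c g') t" for t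
    using g'(3) that by simp
  ultimately show ?case by blast
qed auto

text \<open>A separate first round, because the points of the second round depend on which pairs are
  witnesses.\<close>

definition first_queries :: "nat \<Rightarrow> (nat \<Rightarrow> nat) \<Rightarrow> (nat set \<times> nat set) list \<Rightarrow> nat set list" where
  "first_queries m \<phi> W = concat (map (\<lambda>(a, x). map (\<lambda>j. upd a (block \<phi> j) x) [0..<m]) W)"

definition hash_points where
  "hash_points y = (\<lambda>(z, r, z', \<beta>). [z, z', z \<oplus> z' \<oplus> y, z' \<oplus> ((z \<oplus> y) \<inter> r), y])"

definition point_list where
  "point_list D y = (\<lambda>(z, r, z', \<beta>). [z, z \<oplus> D \<beta>, z \<oplus> z' \<oplus> y \<oplus> D \<beta>, z' \<oplus> ((z \<oplus> y) \<inter> r) \<oplus> D \<beta>])"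

text \<open>A block without a witness gets the dummy query \<open>{}\<close>, so that the number of
  queries does not depend on the answers.\<close>

definition hash_queries where
  "hash_queries m F \<phi> W w = map (\<lambda>j. case witness F \<phi> W j of None \<Rightarrow> {}
     | Some (a, x) \<Rightarrow> upd a (block \<phi> j) w) [0..<m]"

definition seed_queries where
  "seed_queries n m F \<phi> y W sd = (let D = shift n F \<phi> W; t = place D sd in
     point_list D y t @ concat (map (hash_queries m F \<phi> W) (hash_points y t)))"

definition second_queries where
  "second_queries n m F \<phi> y W sds = concat (map (seed_queries n m F \<phi> y W) sds)"

lemma in_concat: "a \<in> set xs \<Longrightarrow> x \<in> set (f a) \<Longrightarrow> x \<in> set (concat (map f xs))"
  by auto

lemma length_concat_const:
  assumes "\<And>x. x \<in> set xs \<Longrightarrow> length (f x) = k"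
  shows "length (concat (map f xs)) = length xs * k"
  using assms by (induction xs) auto

lemma length_first_queries: "length (first_queries m \<phi> W) = length W * m"
  unfolding first_queries_def by (rule length_concat_const) auto

lemma length_second_queries: "length (second_queries n m F \<phi> y W sds) = length sds * (4 + 5 * m)"
  unfolding second_queries_def
proof (rule length_concat_const)
  fix sd :: seed
  have "length (hash_queries m F \<phi> W w) = m" for w by (simp add: hash_queries_def)
  then show "length (seed_queries n m F \<phi> y W sd) = 4 + 5 * m"
    by (simp add: seed_queries_def Let_def point_list_def hash_points_def case_prod_unfold)
qed

lemma witness_cong:
  assumes "\<And>A. A \<in> set (first_queries m \<phi> W) \<Longrightarrow> F A = F' A" "j < m"
  shows "witness F \<phi> W j = witness F' \<phi> W j"
  unfolding witness_def
proof (rule find_cong[OF refl])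
  fix ax assume ax: "ax \<in> set W"
  have "upd (fst ax) (block \<phi> j) (snd ax) \<in> set (first_queries m \<phi> W)"
    using ax assms(2) by (force simp: first_queries_def)
  then show "(case ax of (a, x) \<Rightarrow> \<not> F (upd a (block \<phi> j) x)) = (case ax of (a, x) \<Rightarrow> \<not> F' (upd a (block \<phi> j) x))"
    using assms(1) by (simp add: case_prod_unfold)
qed

lemma passes_cong:
  assumes "\<And>p. p \<in> set (point_list D y t) \<Longrightarrow> F p = F' p"
    and "\<And>w. w \<in> set (hash_points y t) \<Longrightarrow> h w = h' w"
  shows "passes F D h y G t = passes F' D h' y G t"
proof -
  obtain z r z' \<beta> where t: "t = (z, r, z', \<beta>)" by (cases t)
  show ?thesis using assms unfolding t passes_def point_list_def hash_points_def Let_def by simp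
qed

lemma shift_cong:
  assumes "\<And>A. A \<in> set (first_queries m \<phi> W) \<Longrightarrow> F A = F' A" "\<And>i. i < n \<Longrightarrow> \<phi> i < m"
  shows "shift n F \<phi> W = shift n F' \<phi> W"
proof
  fix b
  have "witness F \<phi> W (\<phi> i) = witness F' \<phi> W (\<phi> i)" if "i < n" for i
    by (rule witness_cong[OF assms(1) assms(2)[OF that]])
  then show "shift n F \<phi> W b = shift n F' \<phi> W b"
    unfolding shift_def by (intro Collect_cong) (simp cong: conj_cong)
qed

text \<open>The verdict reads the function only at the points of the two rounds, so the table of
  answers can stand in for it.\<close>

lemma accepts_cong:
  assumes 1: "\<And>A. A \<in> set (first_queries m \<phi> W) \<Longrightarrow> F A = F' A"
    and 2: "\<And>A. A \<in> set (second_queries n m F \<phi> y W sds) \<Longrightarrow> F A = F' A"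
    and \<phi>: "\<And>i. i < n \<Longrightarrow> \<phi> i < m"
  shows "accepts n m K F \<phi> y W sds = accepts n m K F' \<phi> y W sds"
proof -
  define D where "D = shift n F \<phi> W"
  have D': "shift n F' \<phi> W = D" unfolding D_def by (rule shift_cong[OF 1 \<phi>, symmetric])
  have "passes F D (hash m F \<phi> W) y G (place D sd) = passes F' D (hash m F' \<phi> W) y G (place D sd)"
    if sd: "sd \<in> set sds" for sd G
  proof (rule passes_cong)
    fix p assume "p \<in> set (point_list D y (place D sd))"
    then have "p \<in> set (seed_queries n m F \<phi> y W sd)"
      by (simp add: seed_queries_def Let_def D_def)
    from in_concat[where f = "seed_queries n m F \<phi> y W", OF sd this] have "p \<in> set (second_queries n m F \<phi> y W sds)"
      unfolding second_queries_def .
    then show "F p = F' p" by (rule 2)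
  next
    fix w assume w: "w \<in> set (hash_points y (place D sd))"
    have eq: "F (upd a (block \<phi> j) w) = F' (upd a (block \<phi> j) w)"
      if j: "j < m" and ax: "witness F \<phi> W j = Some (a, x)" for j a x
    proof (rule 2)
      have "upd a (block \<phi> j) w \<in> set (hash_queries m F \<phi> W w)"
        unfolding hash_queries_def set_map by (rule image_eqI[of _ _ j]) (use j ax in simp_all)
      from in_concat[where f = "hash_queries m F \<phi> W", OF w this] have "upd a (block \<phi> j) w \<in> set (seed_queries n m F \<phi> y W sd)"
        unfolding seed_queries_def Let_def D_def set_append by blast
      from in_concat[where f = "seed_queries n m F \<phi> y W", OF sd this] show "upd a (block \<phi> j) w \<in> set (second_queries n m F \<phi> y W sds)"
        unfolding second_queries_def .
    qed
    show "hash m F \<phi> W w = hash m F' \<phi> W w"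
      unfolding hash_def
    proof (intro Collect_cong conj_cong refl)
      fix j assume "j \<in> {..<m}"
      then have j: "j < m" by simp
      have wit: "witness F' \<phi> W j = witness F \<phi> W j" by (rule witness_cong[OF 1 j, symmetric])
      show "(case witness F \<phi> W j of None \<Rightarrow> False | Some (a, x) \<Rightarrow> F (upd a (block \<phi> j) w))
        = (case witness F' \<phi> W j of None \<Rightarrow> False | Some (a, x) \<Rightarrow> F' (upd a (block \<phi> j) w))"
      proof (cases "witness F \<phi> W j")
        case (Some ax)
        then show ?thesis using eq[OF j, of "fst ax" "snd ax"] by (simp add: wit case_prod_unfold)
      qed (simp add: wit)
    qed
  qed
  then show ?thesis unfolding accepts_def D' D_def[symmetric] by (simp add: case_prod_unfold)
qed

definition decide :: "nat \<Rightarrow> nat \<Rightarrow> nat \<Rightarrow> (nat \<Rightarrow> nat) \<Rightarrow> nat set \<Rightarrow> (nat set \<times> nat set) list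
    \<Rightarrow> seed list \<Rightarrow> query_alg" where
  "decide n m K \<phi> y W sds = ask (map (to_list n) (first_queries m \<phi> W)) (\<lambda>_. False)
     (\<lambda>g. ask (map (to_list n) (second_queries n m (\<lambda>A. g (to_list n A)) \<phi> y W sds)) g
       (\<lambda>g'. Output (accepts n m K (\<lambda>A. g' (to_list n A)) \<phi> y W sds)))"

lemma decide:
  assumes \<phi>: "\<And>i. i < n \<Longrightarrow> \<phi> i < m"
  shows "verdict n f (decide n m K \<phi> y W sds)
      = return_pmf (accepts n m K (\<lambda>A. f (to_list n A)) \<phi> y W sds) \<and>
    calls n f (decide n m K \<phi> y W sds) (length W * m + length sds * (4 + 5 * m))"
proof -
  let ?F = "\<lambda>A. f (to_list n A)"
  define c' where "c' g' = Output (accepts n m K (\<lambda>A. g' (to_list n A)) \<phi> y W sds)" for g'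
  define c where "c g = ask (map (to_list n) (second_queries n m (\<lambda>A. g (to_list n A)) \<phi> y W sds)) g c'" for g
  have dec: "decide n m K \<phi> y W sds = ask (map (to_list n) (first_queries m \<phi> W)) (\<lambda>_. False) c"
    unfolding decide_def c_def[abs_def] c'_def[abs_def] ..
  obtain g where g: "\<forall>x. g x = (if x \<in> set (map (to_list n) (first_queries m \<phi> W)) then f x else False)"
    "verdict n f (decide n m K \<phi> y W sds) = verdict n f (c g)"
    "\<And>t. calls n f (c g) t \<Longrightarrow> calls n f (decide n m K \<phi> y W sds) (length W * m + t)"
    using ask_answers[of "map (to_list n) (first_queries m \<phi> W)" f "\<lambda>_. False" n c]
    unfolding dec[symmetric] length_map length_first_queries by blast
  let ?G = "\<lambda>A. g (to_list n A)"
  obtain g' where g': "\<forall>x. g' x = (if x \<in> set (map (to_list n) (second_queries n m ?G \<phi> y W sds)) then f x else g x)"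
    "verdict n f (c g) = verdict n f (c' g')"
    "\<And>t. calls n f (c' g') t \<Longrightarrow> calls n f (c g) (length sds * (4 + 5 * m) + t)"
    using ask_answers[of "map (to_list n) (second_queries n m ?G \<phi> y W sds)" f g n c']
    unfolding c_def[symmetric] length_map length_second_queries by blast
  let ?G' = "\<lambda>A. g' (to_list n A)"
  have G1: "?G A = ?F A" if "A \<in> set (first_queries m \<phi> W)" for A using g(1) that by simp
  have G'1: "?F A = ?G' A" if "A \<in> set (first_queries m \<phi> W)" for A
    using g'(1) G1[OF that] by simp
  have G'2: "?G' A = ?F A" if "A \<in> set (second_queries n m ?G \<phi> y W sds)" for A
    using g'(1) that by simp
  \<comment> \<open>The second round was computed from the answers to the first; it must be the same
    list that the function itself would give.\<close>
  have wit: "witness ?G \<phi> W j = witness ?F \<phi> W j" if "j < m" for j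
    by (rule witness_cong[OF G1 that])
  have "shift n ?G \<phi> W = shift n ?F \<phi> W" by (rule shift_cong[OF G1 \<phi>])
  moreover have "hash_queries m ?G \<phi> W = hash_queries m ?F \<phi> W"
    by (rule ext) (unfold hash_queries_def, intro map_cong refl, simp add: wit)
  ultimately have "second_queries n m ?G \<phi> y W sds = second_queries n m ?F \<phi> y W sds"
    unfolding second_queries_def seed_queries_def by simp
  then have "accepts n m K ?F \<phi> y W sds = accepts n m K ?G' \<phi> y W sds"
    using G'1 G'2 \<phi> by (intro accepts_cong) simp_all
  moreover have "calls n f (decide n m K \<phi> y W sds) (length W * m + (length sds * (4 + 5 * m) + 0))"
    by (intro g(3) g'(3)) (simp add: c'_def)
  ultimately show ?thesis using g(2) g'(2) by (simp add: c'_def verdict_simps)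
qed

definition tester :: "nat \<Rightarrow> nat \<Rightarrow> nat \<Rightarrow> nat \<Rightarrow> nat \<Rightarrow> query_alg" where
  "tester n m K N1 N2 = both (uniform ({..<n} \<rightarrow>\<^sub>E {..<m})) (both sample
     (both (repeat_draw N2 (both sample sample))
       (repeat_draw N1 (both (both sample (uniform (Pow {..<m})))
         (both (uniform (Pow {..<n})) (both (both sample (uniform (Pow {..<m}))) (uniform (Pow {..<m}))))))))
     (\<lambda>(\<phi>, y, W, sds). decide n m K \<phi> y W sds)"

lemma tester:
  fixes n m K N1 N2 :: nat and f :: "bool list \<Rightarrow> bool"
  defines "S \<equiv> set_ones n f"
  defines "J \<equiv> pair_pmf (pmf_of_set ({..<n} \<rightarrow>\<^sub>E {..<m})) (pair_pmf (pmf_of_set S)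
      (pair_pmf (replicate_pmf N2 (pair_pmf (pmf_of_set S) (pmf_of_set S)))
         (replicate_pmf N1 (seed_pmf n m S))))"
  assumes ne: "S \<noteq> {}" and m: "0 < m"
  shows "verdict n f (tester n m K N1 N2)
       = map_pmf (\<lambda>(\<phi>, y, W, sds). accepts n m K (\<lambda>A. f (to_list n A)) \<phi> y W sds) J"
    and "calls n f (tester n m K N1 N2) (1 + 2 * N2 + 2 * N1 + N2 * m + N1 * (4 + 5 * m))"
proof -
  let ?P = "both (uniform ({..<n} \<rightarrow>\<^sub>E {..<m})) (both sample
     (both (repeat_draw N2 (both sample sample))
       (repeat_draw N1 (both (both sample (uniform (Pow {..<m})))
         (both (uniform (Pow {..<n})) (both (both sample (uniform (Pow {..<m}))) (uniform (Pow {..<m}))))))))"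
  have H_ne: "{..<n} \<rightarrow>\<^sub>E {..<m} \<noteq> {}" using m by (auto simp: PiE_eq_empty_iff)
  have smp: "draws n f sample (pmf_of_set S) 1" unfolding S_def using ne by (intro draws_sample) (simp add: S_def)
  have pow: "draws n f (uniform (Pow {..<k})) (pmf_of_set (Pow {..<k})) 0" for k :: nat
    by (rule draws_uniform) auto
  \<comment> \<open>One sample for \<open>y\<close> and two for each pair and each seed; hash
    functions, masks and flips are internal randomness and cost nothing.\<close>
  have P: "draws n f ?P J (0 + (1 + (N2 * (1 + 1) + N1 * ((1 + 0) + (0 + ((1 + 0) + 0))))))"
    unfolding J_def seed_pmf_def
    by (intro draws_both draws_repeat draws_uniform finite_hash_functions H_ne smp pow) auto
  define c where "c = (\<lambda>(\<phi>, y, W, sds). decide n m K \<phi> y W sds)"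
  have t: "tester n m K N1 N2 = ?P c" by (simp add: tester_def c_def)
  have c: "verdict n f (c x) = return_pmf (case x of (\<phi>, y, W, sds) \<Rightarrow> accepts n m K (\<lambda>A. f (to_list n A)) \<phi> y W sds)"
    "calls n f (c x) (N2 * m + N1 * (4 + 5 * m))" if "x \<in> set_pmf J" for x
  proof -
    obtain \<phi> y W sds where x: "x = (\<phi>, y, W, sds)" by (cases x)
    have "\<phi> \<in> {..<n} \<rightarrow>\<^sub>E {..<m}" "length W = N2" "length sds = N1"
      using that by (auto simp: J_def x set_pmf_of_set[OF H_ne finite_hash_functions] set_replicate_pmf)
    moreover from this have "\<phi> i < m" if "i < n" for i using that by auto
    ultimately show "verdict n f (c x) = return_pmf (case x of (\<phi>, y, W, sds) \<Rightarrow> accepts n m K (\<lambda>A. f (to_list n A)) \<phi> y W sds)"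
      "calls n f (c x) (N2 * m + N1 * (4 + 5 * m))"
      using decide[of n \<phi> m f K y W sds] by (simp_all add: c_def x)
  qed
  have "verdict n f (?P c) = bind_pmf J (\<lambda>x. verdict n f (c x))" using P unfolding draws_def by blast
  also have "\<dots> = bind_pmf J (\<lambda>x. return_pmf (case x of (\<phi>, y, W, sds) \<Rightarrow> accepts n m K (\<lambda>A. f (to_list n A)) \<phi> y W sds))"
    using c(1) by (intro bind_pmf_cong) auto
  finally show "verdict n f (tester n m K N1 N2)
       = map_pmf (\<lambda>(\<phi>, y, W, sds). accepts n m K (\<lambda>A. f (to_list n A)) \<phi> y W sds) J"
    unfolding t map_pmf_def by (simp add: case_prod_unfold)
  have "calls n f (?P c) ((0 + (1 + (N2 * (1 + 1) + N1 * ((1 + 0) + (0 + ((1 + 0) + 0)))))) + (N2 * m + N1 * (4 + 5 * m)))"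
    using P c(2) unfolding draws_def by blast
  then show "calls n f (tester n m K N1 N2) (1 + 2 * N2 + 2 * N1 + N2 * m + N1 * (4 + 5 * m))"
    unfolding t by (simp add: algebra_simps)
qed

section \<open>Rejection of far functions\<close>

text \<open>Placed seeds follow exactly the law of a single test in
  \<open>tester_run\<close>.\<close>

lemma map_place:
  "map_pmf (place D) (seed_pmf n m S) =
     pair_pmf (map_pmf (\<lambda>(s, b). s \<oplus> D b) (pair_pmf (pmf_of_set S) (pmf_of_set (Pow {..<m}))))
       (pair_pmf (pmf_of_set (Pow {..<n}))
         (pair_pmf (map_pmf (\<lambda>(s, b). s \<oplus> D b) (pair_pmf (pmf_of_set S) (pmf_of_set (Pow {..<m}))))
           (pmf_of_set (Pow {..<m}))))"
  unfolding place_def seed_pmf_def pair_pmf_def map_pmf_def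
  by (simp add: bind_assoc_pmf bind_return_pmf)

lemma passes_imp_close:
  fixes f :: "bool list \<Rightarrow> bool" and \<phi> :: "nat \<Rightarrow> nat" and n m K :: nat and \<delta> :: real
  defines "S \<equiv> set_ones n f" and "F \<equiv> \<lambda>A. f (to_list n A)"
  assumes hyp: "(rs, d) \<in> hypotheses m K" and ne: "S \<noteq> {}" and y: "y \<subseteq> {..<n}"
    and \<delta>: "0 < \<delta>" "\<delta> \<le> 1 / 10 ^ 7"
    and fail: "Pr (seed_pmf n m S) (\<lambda>sd. \<not> passes F (shift n F \<phi> W) (hash m F \<phi> W) y (ev rs d)
       (place (shift n F \<phi> W) sd)) \<le> \<delta>"
  shows "\<exists>g\<in>decision_lists n. rel_dist n f g \<le> 12808 * \<delta>"
proof -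
  define D where "D = shift n F \<phi> W"
  define h where "h = hash m F \<phi> W"
  have S_eq: "S = {A \<in> Pow {..<n}. F A}" by (simp add: S_def F_def set_ones_def)
  have S_ones: "S = set_ones n f" by (simp add: S_def)
  interpret tester_run n m F D h y "ev rs d" S
    "map_pmf (\<lambda>(s, b). s \<oplus> D b) (pair_pmf (pmf_of_set S) (pmf_of_set (Pow {..<m})))" \<delta>
  proof unfold_locales
    \<comment> \<open>Whether \<open>i\<close> is moved depends on \<open>b\<close> only through
      \<open>\<phi> i \<in> b\<close>; the condition on the witness is the same for all
      \<open>b\<close>, so additivity holds for every \<open>F\<close>.\<close>
    show "D (b \<oplus> b') = D b \<oplus> D b'" for b b' by (auto simp: D_def shift_def)
    show "D b \<subseteq> {..<n}" for b by (auto simp: D_def shift_def)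
    show "h w \<subseteq> {..<m}" for w by (auto simp: h_def hash_def)
    show "2 ^ m \<le> 2 * card {b \<in> Pow {..<m}. ev rs d b}" using hyp by (simp add: hypotheses_def)
    show "{A \<in> Pow {..<n}. F A} \<noteq> {}" using ne unfolding S_eq .
    let ?S = "{A \<in> Pow {..<n}. F A}"
    let ?P = "map_pmf (\<lambda>(s, b). s \<oplus> D b) (pair_pmf (pmf_of_set ?S) (pmf_of_set (Pow {..<m})))"
    show "Pr (pair_pmf ?P (pair_pmf (pmf_of_set (Pow {..<n}))
         (pair_pmf ?P (pmf_of_set (Pow {..<m}))))) (\<lambda>x. \<not> passes F D h y (ev rs d) x) \<le> \<delta>"
      unfolding S_eq[symmetric] map_place[symmetric] Pr_map D_def h_def by (rule fail)
    show "S \<equiv> ?S" by (rule eq_reflection[OF S_eq])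
  qed (use y \<delta> in simp_all)
  obtain I A where A: "\<And>j. A j \<subseteq> I" "\<And>j a a'. a \<in> A j \<Longrightarrow> a' \<in> A j \<Longrightarrow> a = a'" and I: "I \<subseteq> {..<n}"
    and close: "card (sym_diff S {w \<in> Pow {..<n}. w \<oplus> y \<subseteq> I \<and>
        ev rs d ({j. A j \<inter> (w \<oplus> y) \<noteq> {}} \<oplus> h y)}) \<le> 12808 * \<delta> * card S"
    by (rule close_to_literals) (rule that; (assumption | iprover))
  have "A j \<subseteq> {..<n}" for j using A(1)[of j] I by blast
  then have "\<exists>rs' d'. vars rs' \<subseteq> {..<n} \<and> (\<forall>w. w \<subseteq> {..<n} \<longrightarrow>
     ev rs' d' w = (w \<oplus> y \<subseteq> I \<and> ev rs d ({j. A j \<inter> (w \<oplus> y) \<noteq> {}} \<oplus> h y)))"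
    by (intro ev_subcube) (use y A(2) in auto)
  then obtain rs' d' where rs': "vars rs' \<subseteq> {..<n}" "\<And>w. w \<subseteq> {..<n} \<Longrightarrow>
     ev rs' d' w = (w \<oplus> y \<subseteq> I \<and> ev rs d ({j. A j \<inter> (w \<oplus> y) \<noteq> {}} \<oplus> h y))" by blast
  define g where "g = restrict (eval_list rs' d') (cube n)"
  have "g \<in> decision_lists n" using rs'(1) unfolding decision_lists_def g_def by fastforce
  moreover have "rel_dist n f g \<le> 12808 * \<delta>"
  proof -
    have g_ev: "g (to_list n w) = ev rs' d' w" for w
      by (simp add: g_def eval_list_to_list[OF rs'(1)])
    define B where "B = set_ones n g"
    have B: "B = {w \<in> Pow {..<n}. w \<oplus> y \<subseteq> I \<and> ev rs d ({j. A j \<inter> (w \<oplus> y) \<noteq> {}} \<oplus> h y)}"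
      unfolding B_def set_ones_def g_ev using rs'(2) by blast
    have inj: "inj_on (to_list n) (Pow {..<n})" using bij_to_list by (rule bij_betw_imp_inj_on)
    have sub: "S \<subseteq> Pow {..<n}" "B \<subseteq> Pow {..<n}" by (auto simp: S_ones B_def set_ones_def)
    have "sym_diff (ones n f) (ones n g) = to_list n ` (S - B) \<union> to_list n ` (B - S)"
      unfolding ones_to_list S_ones[symmetric] B_def[symmetric]
      using inj_on_image_set_diff[OF inj, of S B] inj_on_image_set_diff[OF inj, of B S] sub
      by (simp add: Diff_subset[THEN order.trans])
    also have "\<dots> = to_list n ` sym_diff S B" by (simp add: image_Un)
    finally have "card (sym_diff (ones n f) (ones n g)) = card (to_list n ` sym_diff S B)" by simp
    also have "\<dots> = card (sym_diff S B)"
      by (intro card_image inj_on_subset[OF inj]) (use sub in blast)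
    finally have "rel_dist n f g = card (sym_diff S B) / card S"
      by (simp add: rel_dist_def card_ones S_ones)
    also have "\<dots> \<le> 12808 * \<delta>" using close card_S unfolding B by (simp add: pos_divide_le_eq)
    finally show ?thesis .
  qed
  ultimately show ?thesis by blast
qed

lemma sum_powers_le: "(\<Sum>i\<le>k. a ^ i) \<le> (a + 1) ^ k" for a :: nat
proof (induction k)
  case (Suc k)
  have "a ^ k \<le> (a + 1) ^ k" by (rule power_mono) auto
  then have "a * a ^ k \<le> a * (a + 1) ^ k" by (rule mult_le_mono2)
  with Suc have "(\<Sum>i\<le>k. a ^ i) + a * a ^ k \<le> (a + 1) ^ k + a * (a + 1) ^ k" by (rule add_mono)
  then show ?case by simp
qed simp

text \<open>There are \<open>4 * m\<close> possible rules; the added 1 absorbs shorter lists, and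
  the factor 2 is the default.\<close>

lemma card_hypotheses: "finite (hypotheses m K) \<and> card (hypotheses m K) \<le> 2 * (4 * m + 1) ^ K"
proof -
  let ?A = "{..<m} \<times> (UNIV :: (bool \<times> bool) set)"
  let ?X = "{rs. set rs \<subseteq> ?A \<and> length rs \<le> K} \<times> (UNIV :: bool set)"
  have fin: "finite ?A" by simp
  have sub: "hypotheses m K \<subseteq> ?X" by (auto simp: hypotheses_def)
  have finX: "finite ?X" using finite_lists_length_le[OF fin, of K] by simp
  have cA: "card ?A = 4 * m" by (simp add: card_cartesian_product flip: UNIV_Times_UNIV)
  have "card (hypotheses m K) \<le> card ?X" using sub finX by (rule card_mono[rotated])
  also have "\<dots> = card {rs. set rs \<subseteq> ?A \<and> length rs \<le> K} * 2" by (simp add: card_cartesian_product)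
  also have "card {rs. set rs \<subseteq> ?A \<and> length rs \<le> K} = (\<Sum>i\<le>K. card ?A ^ i)"
    by (rule card_lists_length_le[OF fin])
  also have "\<dots> \<le> (4 * m + 1) ^ K" unfolding cA by (rule sum_powers_le)
  finally have "card (hypotheses m K) \<le> 2 * (4 * m + 1) ^ K" by simp
  then show ?thesis using finite_subset[OF sub finX] by blast
qed

text \<open>Conditionally on \<open>\<phi>\<close>, \<open>y\<close> and \<open>W\<close> the tests
  are independent and a fixed hypothesis fails each with probability above \<open>\<delta>\<close>,
  since otherwise \<open>passes_imp_close\<close> would give a close decision list. The rest is a
  union bound over the hypotheses.\<close>

lemma accepts_rarely:
  fixes f :: "bool list \<Rightarrow> bool" and n m K N1 :: nat and \<delta> :: real
  defines "S \<equiv> set_ones n f" and "F \<equiv> \<lambda>A. f (to_list n A)"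
  assumes ne: "S \<noteq> {}" and \<delta>: "0 < \<delta>" "\<delta> \<le> 1 / 10 ^ 7"
    and far: "\<And>g. g \<in> decision_lists n \<Longrightarrow> 12808 * \<delta> < rel_dist n f g"
  shows "Pr (pair_pmf H (pair_pmf (pmf_of_set S) (pair_pmf UW (replicate_pmf N1 (seed_pmf n m S)))))
     (\<lambda>(\<phi>, y, W, sds). accepts n m K F \<phi> y W sds) \<le> 2 * (4 * m + 1) ^ K * (1 - \<delta>) ^ N1"
proof (rule Pr_pair_le, rule Pr_pair_le, rule Pr_pair_le, goal_cases)
  case (1 \<phi> y W)
  let ?D = "shift n F \<phi> W"
  let ?ok = "\<lambda>G sd. passes F ?D (hash m F \<phi> W) y G (place ?D sd)"
  have y: "y \<subseteq> {..<n}" using 1(2) ne by (auto simp: S_def set_ones_def set_pmf_of_set)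
  have "Pr (replicate_pmf N1 (seed_pmf n m S)) (accepts n m K F \<phi> y W)
     = Pr (replicate_pmf N1 (seed_pmf n m S)) (\<lambda>sds. \<exists>G\<in>hypotheses m K. \<forall>sd\<in>set sds. ?ok (ev (fst G) (snd G)) sd)"
    by (simp add: accepts_def case_prod_unfold)
  also have "\<dots> \<le> card (hypotheses m K) * (1 - \<delta>) ^ N1"
  proof (rule Pr_ex_finite_le)
    show "finite (hypotheses m K)" using card_hypotheses by blast
    fix G assume G: "G \<in> hypotheses m K"
    have "\<delta> < Pr (seed_pmf n m S) (\<lambda>sd. \<not> ?ok (ev (fst G) (snd G)) sd)"
    proof (rule ccontr)
      assume "\<not> ?thesis"
      then have "\<exists>g\<in>decision_lists n. rel_dist n f g \<le> 12808 * \<delta>"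
        using G ne y \<delta> unfolding S_def F_def
        by (intro passes_imp_close[where rs = "fst G" and d = "snd G"]) (simp_all add: not_less)
      then show False using far by fastforce
    qed
    then have "Pr (seed_pmf n m S) (?ok (ev (fst G) (snd G))) \<le> 1 - \<delta>"
      using Pr_not[of "seed_pmf n m S" "?ok (ev (fst G) (snd G))"] by simp
    then show "Pr (replicate_pmf N1 (seed_pmf n m S)) (\<lambda>sds. \<forall>sd\<in>set sds. ?ok (ev (fst G) (snd G)) sd) \<le> (1 - \<delta>) ^ N1"
      unfolding Pr_replicate_all by (intro power_mono) auto
  qed
  also have "\<dots> \<le> real (2 * (4 * m + 1) ^ K) * (1 - \<delta>) ^ N1"
    using card_hypotheses[of m K] \<delta> by (intro mult_right_mono of_nat_mono) auto
  finally show ?case by simp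
qed

section \<open>Choice of the parameters\<close>

text \<open>Chosen so that \<open>2 ^ depth l\<close> dominates
  \<open>10 ^ 17 * 2 ^ l * depth l ^ 7\<close>: as \<open>depth l \<le> 120 * 2 ^ l\<close>, the
  powers of \<open>2 ^ l\<close> are covered by slope 8, and
  \<open>10 ^ 17 * 120 ^ 7 \<le> 2 ^ 120\<close>.\<close>

definition depth :: "nat \<Rightarrow> nat" where "depth l = 8 * l + 120"
text \<open>Makes the collision probability at most \<open>1 / 20\<close>.\<close>

definition blocks :: "nat \<Rightarrow> nat" where "blocks l = 20 * (depth l)\<^sup>2"
text \<open>\<open>10 ^ 7 * 2 ^ l\<close> is at least \<open>1 / \<delta>\<close>; the last factor
  dominates the logarithm of the number of hypotheses with some room to spare.\<close>

definition tests :: "nat \<Rightarrow> nat" where "tests l = 10 ^ 7 * 2 ^ l * (4 * blocks l * depth l + 3)"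
text \<open>With \<open>\<tau> = 1 / (2000 * K * N1)\<close> this gives
  \<open>\<tau> * N2 = 20 * K\<close>, enough to reveal \<open>K\<close> variables
  simultaneously.\<close>

definition pairs :: "nat \<Rightarrow> nat" where "pairs l = 40000 * (depth l)\<^sup>2 * tests l"
definition total :: "nat \<Rightarrow> nat" where
  "total l = 1 + 2 * pairs l + 2 * tests l + pairs l * blocks l + tests l * (4 + 5 * blocks l)"

lemma parameters_pos: "0 < depth l" "0 < blocks l" "0 < tests l"
  by (simp_all add: depth_def blocks_def tests_def)

lemma tests_le: "tests l \<le> 83 * 10 ^ 7 * 2 ^ l * depth l ^ 3"
proof -
  have "1 \<le> depth l ^ 3" using parameters_pos(1)[of l] by simp
  then have "4 * blocks l * depth l + 3 \<le> 83 * depth l ^ 3"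
    by (simp add: blocks_def power2_eq_square power3_eq_cube)
  then have "10 ^ 7 * 2 ^ l * (4 * blocks l * depth l + 3) \<le> 10 ^ 7 * 2 ^ l * (83 * depth l ^ 3)"
    by (rule mult_le_mono2)
  then show ?thesis by (simp add: tests_def)
qed

lemma pairs_le: "pairs l \<le> 4 * 83 * 10 ^ 11 * 2 ^ l * depth l ^ 5"
proof -
  have "pairs l \<le> 40000 * (depth l)\<^sup>2 * (83 * 10 ^ 7 * 2 ^ l * depth l ^ 3)"
    unfolding pairs_def using tests_le by (rule mult_le_mono2)
  also have "\<dots> = (40000 * (83 * 10 ^ 7)) * 2 ^ l * ((depth l)\<^sup>2 * depth l ^ 3)"
    by (simp only: mult_ac)
  also have "(depth l)\<^sup>2 * depth l ^ 3 = depth l ^ 5" by (simp flip: power_add)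
  also have "(40000 * (83 * 10 ^ 7) :: nat) = 4 * 83 * 10 ^ 11" by simp
  finally show ?thesis .
qed

lemma total_le: "total l \<le> 43 * 10 ^ 14 * 2 ^ l * depth l ^ 7"
proof -
  have d1: "1 \<le> (depth l)\<^sup>2" using parameters_pos(1)[of l] by simp
  have 1: "tests l \<le> pairs l" unfolding pairs_def using d1 by simp
  have "tests l * (4 + 5 * blocks l) \<le> pairs l * (4 + 5 * blocks l)" using 1 by (rule mult_le_mono1)
  then have "total l \<le> pairs l * (9 + 6 * blocks l)"
    unfolding total_def using 1 parameters_pos(3)[of l] by (simp add: algebra_simps)
  also have "\<dots> \<le> pairs l * (129 * (depth l)\<^sup>2)"
    using d1 by (intro mult_le_mono2) (simp add: blocks_def)
  also have "\<dots> \<le> (4 * 83 * 10 ^ 11 * 2 ^ l * depth l ^ 5) * (129 * (depth l)\<^sup>2)"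
    using pairs_le by (rule mult_le_mono1)
  also have "\<dots> = (4 * 83 * 10 ^ 11 * 129) * 2 ^ l * (depth l ^ 5 * (depth l)\<^sup>2)"
    by (simp only: mult_ac)
  also have "depth l ^ 5 * (depth l)\<^sup>2 = depth l ^ 7" by (simp flip: power_add)
  also have "4 * 83 * 10 ^ 11 * 129 * 2 ^ l * depth l ^ 7 \<le> 43 * 10 ^ 14 * 2 ^ l * depth l ^ 7"
    by (intro mult_le_mono1) simp
  finally show ?thesis .
qed

lemma depth_power: "10 ^ 17 * 2 ^ l * depth l ^ 7 \<le> 2 ^ depth l"
proof -
  have "l + 1 \<le> 2 ^ l" using Suc_leI[OF less_exp[of l]] by simp
  moreover have "depth l \<le> 120 * (l + 1)" by (simp add: depth_def)
  ultimately have "depth l \<le> 120 * 2 ^ l" by (meson mult_le_mono2 order.trans)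
  then have "depth l ^ 7 \<le> (120 * 2 ^ l) ^ 7" by (rule power_mono) simp
  then have "10 ^ 17 * 2 ^ l * depth l ^ 7 \<le> 10 ^ 17 * 2 ^ l * (120 * 2 ^ l) ^ 7"
    by (rule mult_le_mono2)
  also have "\<dots> = (10 ^ 17 * 120 ^ 7) * (2 ^ l * (2 ^ l) ^ 7)"
    unfolding power_mult_distrib by (simp only: mult_ac)
  also have "2 ^ l * (2 ^ l) ^ 7 = ((2 ^ l) ^ 8 :: nat)" by (simp flip: power_Suc)
  also have "(10 ^ 17 * 120 ^ 7) * (2 ^ l) ^ 8 \<le> 2 ^ 120 * ((2 ^ l) ^ 8 :: nat)"
    by (rule mult_le_mono1) simp
  also have "\<dots> = 2 ^ depth l" by (simp add: depth_def power_add power_mult[symmetric] mult.commute)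
  finally show ?thesis .
qed

lemma exp_bound_power:
  fixes x :: real
  assumes "0 \<le> x" "x \<le> 1"
  shows "(1 - x) ^ k \<le> exp (- (x * k))"
proof -
  have "1 - x \<le> exp (- x)" using exp_ge_add_one_self[of "- x"] by simp
  then have "(1 - x) ^ k \<le> exp (- x) ^ k" using assms by (intro power_mono) auto
  also have "\<dots> = exp (- (x * k))" by (simp add: exp_of_nat_mult[symmetric] mult.commute)
  finally show ?thesis .
qed

text \<open>Six groups of at most \<open>1 / 20\<close> each. The threshold \<open>\<tau>\<close> is
  small enough that \<open>N1\<close> tests do not notice the up to \<open>K\<close> weak variables,
  and large enough that \<open>N2\<close> pairs reveal the strong ones.\<close>

lemma failure_bound:
  fixes l :: nat
  defines "K \<equiv> depth l" and "m \<equiv> blocks l" and "N1 \<equiv> tests l" and "N2 \<equiv> pairs l"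
  defines "\<tau> \<equiv> 1 / (2000 * real K * real N1)"
  shows "K\<^sup>2 / m + (N2 * ((2 + 4 * real (m + K)) * (1 / 2 ^ K)) + (N1 * 8 / 2 ^ K +
        (K * (1 - \<tau>) ^ N2 + (K * (N1 * (64 * \<tau>)) + (4 * \<tau> + N1 * (8 * \<tau>)))))) \<le> 3 / 10"
proof -
  have K: "1 \<le> real K" and N1: "1 \<le> real N1" and m: "real m = 20 * (real K)\<^sup>2"
    using parameters_pos[of l] by (simp_all add: K_def N1_def m_def blocks_def Suc_le_eq)
  have N2: "real N2 = 40000 * (real K)\<^sup>2 * real N1" by (simp add: N2_def pairs_def K_def N1_def)
  have KN: "1 \<le> real K * real N1" using mult_mono[OF K N1] by simp
  have \<tau>: "0 < \<tau>" "\<tau> \<le> 1" using KN by (simp_all add: \<tau>_def field_simps)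
  have exp_le: "10 ^ 17 * 2 ^ l * (real K) ^ 7 \<le> 2 ^ K"
    using of_nat_mono[OF depth_power[of l], where 'a = real] by (simp add: K_def)
  have 1: "(real K)\<^sup>2 / m \<le> 1 / 20" using K by (simp add: m)
  have 2: "N2 * ((2 + 4 * real (m + K)) * (1 / 2 ^ K)) \<le> 1 / 20"
  proof -
    have N2_le: "real N2 \<le> 4 * 83 * 10 ^ 11 * 2 ^ l * (real K) ^ 5"
      using of_nat_mono[OF pairs_le[of l], where 'a = real] by (simp add: N2_def K_def)
    have "real K \<le> (real K)\<^sup>2" "1 \<le> (real K)\<^sup>2"
      using K by (rule self_le_power, simp) (rule one_le_power[OF K])
    moreover have "2 + 4 * (20 * q + x) \<le> 86 * q" if "x \<le> q" "1 \<le> q" for q x :: real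
      using that by simp
    ultimately have "2 + 4 * real (m + K) \<le> 86 * (real K)\<^sup>2" unfolding of_nat_add m by blast
    with N2_le have "N2 * (2 + 4 * real (m + K)) \<le> (4 * 83 * 10 ^ 11 * 2 ^ l * (real K) ^ 5) * (86 * (real K)\<^sup>2)"
      by (intro mult_mono) simp_all
    also have "\<dots> = (4 * 83 * 10 ^ 11 * 86) * (2 ^ l * ((real K) ^ 5 * (real K)\<^sup>2))" by (simp only: mult_ac)
    also have "(real K) ^ 5 * (real K)\<^sup>2 = (real K) ^ 7" by (simp flip: power_add)
    also have "(4 * 83 * 10 ^ 11 * 86) * (2 ^ l * (real K) ^ 7) \<le> (10 ^ 17 / 20) * (2 ^ l * (real K) ^ 7)"
      by (intro mult_right_mono) simp_all
    also have "\<dots> \<le> 2 ^ K / 20" using exp_le by simp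
    finally have "N2 * (2 + 4 * real (m + K)) \<le> 2 ^ K / 20" .
    then show ?thesis by (simp add: field_simps)
  qed
  have 3: "real N1 * 8 / 2 ^ K \<le> 1 / 20"
  proof -
    have "real N1 \<le> 83 * 10 ^ 7 * 2 ^ l * (real K) ^ 3"
      using of_nat_mono[OF tests_le[of l], where 'a = real] by (simp add: N1_def K_def)
    also have "\<dots> \<le> 83 * 10 ^ 7 * 2 ^ l * (real K) ^ 7"
      using K by (intro mult_left_mono power_increasing) simp_all
    finally have "real N1 * 160 \<le> 83 * 10 ^ 7 * 160 * (2 ^ l * (real K) ^ 7)" by simp
    also have "\<dots> \<le> 10 ^ 17 * (2 ^ l * (real K) ^ 7)" by (intro mult_right_mono) simp_all
    also have "\<dots> \<le> 2 ^ K" using exp_le by simp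
    finally show ?thesis by (simp add: field_simps)
  qed
  have 4: "K * (1 - \<tau>) ^ N2 \<le> 1 / 20"
  proof -
    have "\<tau> * N2 = 20 * K" using K N1 by (simp add: \<tau>_def N2 power2_eq_square)
    then have "(1 - \<tau>) ^ N2 \<le> exp (- (20 * K))" using exp_bound_power[of \<tau> N2] \<tau> by simp
    also have "\<dots> \<le> 1 / (20 * K)"
    proof -
      have "20 * real K \<le> exp (20 * real K)" using exp_ge_add_one_self[of "20 * real K"] by linarith
      then show ?thesis using K by (simp add: exp_minus field_simps)
    qed
    finally have "K * (1 - \<tau>) ^ N2 \<le> K * (1 / (20 * K))" by (intro mult_left_mono) auto
    then show ?thesis using K by simp
  qed
  have 5: "K * (N1 * (64 * \<tau>)) \<le> 1 / 20" using K N1 by (simp add: \<tau>_def)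
  have 6: "4 * \<tau> + N1 * (8 * \<tau>) \<le> 1 / 20"
  proof -
    have "\<tau> \<le> 1 / 2000" using KN by (simp add: \<tau>_def field_simps)
    moreover have "N1 * \<tau> \<le> 1 / 2000" using K N1 by (simp add: \<tau>_def field_simps)
    ultimately show ?thesis by simp
  qed
  have "(real K)\<^sup>2 / m + (N2 * ((2 + 4 * real (m + K)) * (1 / 2 ^ K)) + (real N1 * 8 / 2 ^ K +
      (K * (1 - \<tau>) ^ N2 + (K * (N1 * (64 * \<tau>)) + (4 * \<tau> + N1 * (8 * \<tau>))))))
    \<le> 1 / 20 + (1 / 20 + (1 / 20 + (1 / 20 + (1 / 20 + 1 / 20))))"
    by (intro add_mono[OF 1] add_mono[OF 2] add_mono[OF 3] add_mono[OF 4] add_mono[OF 5] 6)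
  then show ?thesis by simp
qed

text \<open>\<open>(4 * m + 1) ^ K\<close> is at most \<open>exp (4 * m * K)\<close>, which the
  tests cancel; the summand 3 leaves \<open>exp (- 3) \<le> 1 / 6\<close>, and doubling it gives
  \<open>1 / 3\<close>.\<close>

lemma tests_suffice:
  fixes \<delta> :: real
  assumes "1 \<le> \<delta> * (10 ^ 7 * 2 ^ l)" "\<delta> \<le> 1"
  shows "2 * (4 * real (blocks l) + 1) ^ depth l * (1 - \<delta>) ^ tests l \<le> 1 / 3"
proof -
  have \<delta>: "0 \<le> \<delta>"
  proof (rule ccontr)
    assume "\<not> 0 \<le> \<delta>"
    then have "\<delta> * (10 ^ 7 * 2 ^ l) \<le> 0" by (intro mult_nonpos_nonneg) auto
    with assms(1) show False by simp
  qed
  define k where "k = 4 * real (blocks l) * real (depth l)"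
  have "k + 3 = 1 * (k + 3)" by simp
  also have "\<dots> \<le> \<delta> * (10 ^ 7 * 2 ^ l) * (k + 3)"
    using assms(1) by (intro mult_right_mono) (simp_all add: k_def)
  also have "\<dots> = \<delta> * tests l" by (simp add: tests_def k_def algebra_simps)
  finally have "(1 - \<delta>) ^ tests l \<le> exp (- (k + 3))"
    by (intro order.trans[OF exp_bound_power[OF \<delta> assms(2)]]) simp
  moreover have "(4 * real (blocks l) + 1) ^ depth l \<le> exp k"
  proof -
    have "4 * real (blocks l) + 1 \<le> exp (4 * real (blocks l))"
      using exp_ge_add_one_self[of "4 * real (blocks l)"] by linarith
    then have "(4 * real (blocks l) + 1) ^ depth l \<le> exp (4 * real (blocks l)) ^ depth l"
      by (rule power_mono) simp
    then show ?thesis by (simp add: k_def exp_of_nat_mult[symmetric] mult.commute)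
  qed
  ultimately have "(4 * real (blocks l) + 1) ^ depth l * (1 - \<delta>) ^ tests l \<le> exp k * exp (- (k + 3))"
    using assms(2) by (intro mult_mono) auto
  also have "\<dots> = exp (- 3)" by (simp flip: exp_add)
  also have "\<dots> \<le> 1 / 6"
  proof -
    have "exp (real 3 * 1) = exp 1 ^ 3" by (rule exp_of_nat_mult)
    moreover have "(2::real) \<le> exp 1" using exp_ge_add_one_self[of 1] by linarith
    then have "(2::real) ^ 3 \<le> exp 1 ^ 3" by (rule power_mono) simp
    ultimately have "6 \<le> exp (3::real)" by simp
    then show ?thesis by (simp add: exp_minus field_simps)
  qed
  finally show ?thesis by simp
qed

definition scale :: "real \<Rightarrow> nat" where "scale \<epsilon> = nat \<lceil>log 2 (1 / \<epsilon>)\<rceil>"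

lemma scale:
  assumes "0 < \<epsilon>" "\<epsilon> \<le> 1"
  shows "1 / \<epsilon> \<le> 2 ^ scale \<epsilon>" "2 ^ scale \<epsilon> \<le> 2 / \<epsilon>" "real (scale \<epsilon>) \<le> log 2 (1 / \<epsilon>) + 1"
proof -
  have "0 \<le> log 2 (1 / \<epsilon>)" using assms by (subst zero_le_log_cancel_iff) (auto simp: field_simps)
  then have s: "real (scale \<epsilon>) = \<lceil>log 2 (1 / \<epsilon>)\<rceil>" by (simp add: scale_def)
  then have up: "log 2 (1 / \<epsilon>) \<le> real (scale \<epsilon>)" and lo: "real (scale \<epsilon>) \<le> log 2 (1 / \<epsilon>) + 1"
    by linarith+
  show "real (scale \<epsilon>) \<le> log 2 (1 / \<epsilon>) + 1" by (rule lo)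
  have inv: "2 powr log 2 (1 / \<epsilon>) = 1 / \<epsilon>" by (rule powr_log_cancel) (use assms in auto)
  have "2 powr log 2 (1 / \<epsilon>) \<le> 2 powr real (scale \<epsilon>)" using up by (intro powr_mono) auto
  then have "1 / \<epsilon> \<le> 2 powr real (scale \<epsilon>)" unfolding inv .
  then show "1 / \<epsilon> \<le> 2 ^ scale \<epsilon>" by (simp add: powr_realpow)
  have "2 powr real (scale \<epsilon>) \<le> 2 powr (log 2 (1 / \<epsilon>) + 1)" using lo by (intro powr_mono) auto
  also have "\<dots> = 2 / \<epsilon>" unfolding powr_add inv by simp
  finally show "2 ^ scale \<epsilon> \<le> 2 / \<epsilon>" by (simp add: powr_realpow)
qed

definition budget :: "real \<Rightarrow> real" where
  "budget \<epsilon> = (if \<epsilon> > 1 then 0 else real (total (scale \<epsilon>)))"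

lemma soft_O_budget: "soft_O_inverse budget"
  unfolding soft_O_inverse_def
proof (intro exI allI impI)
  fix \<epsilon> :: real assume \<epsilon>: "0 < \<epsilon>"
  have ln_pos: "0 \<le> ln (2 + 1 / \<epsilon>)" using \<epsilon> by (intro ln_ge_zero) simp
  \<comment> \<open>\<open>43 * 10 ^ 14\<close> comes from \<open>total_le\<close>, the 2 from
    rounding \<open>1 / \<epsilon>\<close> up to a power of two, and \<open>480 = 120 * 4\<close>
    from bounding the depth by the logarithm.\<close>
  show "budget \<epsilon> \<le> (43 * 10 ^ 14 * 2 * 480 ^ 7) * (1 / \<epsilon>) * ln (2 + 1 / \<epsilon>) ^ 7"
  proof (cases "\<epsilon> > 1")
    case True
    then show ?thesis using \<epsilon> ln_pos by (simp add: budget_def)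
  next
    case False
    then have \<epsilon>1: "\<epsilon> \<le> 1" by simp
    note s = scale[OF \<epsilon> \<epsilon>1]
    define t where "t = ln (2 + 1 / \<epsilon>)"
    have one: "1 \<le> 1 / \<epsilon>" using \<epsilon> \<epsilon>1 by simp
    have "exp 1 \<le> (3::real)" by (rule exp_le)
    also have "\<dots> \<le> 2 + 1 / \<epsilon>" using one by simp
    finally have t1: "1 \<le> t" unfolding t_def using \<epsilon> by (subst ln_ge_iff) (auto intro: add_pos_pos)
    have "ln (1 / \<epsilon>) \<le> t" unfolding t_def using \<epsilon> by (subst ln_le_cancel_iff) (auto intro: add_pos_pos)
    moreover have "exp (1 / 2) \<le> (2::real)" using exp_bound[of "1 / 2"] by (simp add: power2_eq_square)
    then have "1 / 2 \<le> ln (2::real)" by (subst ln_ge_iff) simp_all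
    then have "ln (1 / \<epsilon>) / ln 2 \<le> ln (1 / \<epsilon>) / (1 / 2)"
      using one by (intro divide_left_mono) (auto intro!: ln_ge_zero mult_pos_pos)
    then have "log 2 (1 / \<epsilon>) \<le> 2 * ln (1 / \<epsilon>)" unfolding log_def by simp
    ultimately have st: "real (scale \<epsilon>) + 1 \<le> 4 * t" using s(3) t1 by linarith
    have "real (depth (scale \<epsilon>)) \<le> 120 * (real (scale \<epsilon>) + 1)" by (simp add: depth_def)
    also have "\<dots> \<le> 120 * (4 * t)" using st by (rule mult_left_mono) simp
    finally have "real (depth (scale \<epsilon>)) \<le> 480 * t" by simp
    then have d: "real (depth (scale \<epsilon>)) ^ 7 \<le> (480 * t) ^ 7" by (rule power_mono) simp
    have "budget \<epsilon> = real (total (scale \<epsilon>))" using False by (simp add: budget_def)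
    also have "\<dots> \<le> 43 * 10 ^ 14 * 2 ^ scale \<epsilon> * real (depth (scale \<epsilon>)) ^ 7"
      using of_nat_mono[OF total_le[of "scale \<epsilon>"], where 'a = real] by simp
    also have "\<dots> \<le> 43 * 10 ^ 14 * (2 / \<epsilon>) * (480 * t) ^ 7"
      using s(2) d \<epsilon> by (intro mult_mono) auto
    also have "\<dots> = (43 * 10 ^ 14 * 2 * 480 ^ 7) * (1 / \<epsilon>) * t ^ 7"
      by (simp add: power_mult_distrib)
    finally show ?thesis by (simp only: t_def)
  qed
qed

text \<open>For \<open>\<epsilon> > 1\<close> nothing has to be rejected, because the constant
  \<open>False\<close> is a decision list at relative distance 1 from every function with a
  satisfying point.\<close>

definition dl_tester :: "nat \<Rightarrow> real \<Rightarrow> query_alg" where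
  "dl_tester n \<epsilon> = (if \<epsilon> > 1 then Output True else
     tester n (blocks (scale \<epsilon>)) (depth (scale \<epsilon>)) (tests (scale \<epsilon>)) (pairs (scale \<epsilon>)))"

lemma rel_dist_class_le:
  assumes "g \<in> decision_lists n"
  shows "rel_dist_class n f (decision_lists n) \<le> rel_dist n f g"
  unfolding rel_dist_class_def using assms finite_decision_lists by (intro Min_le) auto

lemma rel_dist_class_le_1:
  assumes "ones n f \<noteq> {}"
  shows "rel_dist_class n f (decision_lists n) \<le> 1"
proof -
  let ?g = "restrict (eval_list [] False) (cube n)"
  have "?g \<in> decision_lists n"
    unfolding decision_lists_def by (intro CollectI exI[of _ "[]"] exI[of _ False]) simp
  moreover have "ones n ?g = {}" by (auto simp: ones_def)
  then have "rel_dist n f ?g = 1"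
    using assms finite_cube[of n] by (simp add: rel_dist_def ones_def)
  ultimately show ?thesis using rel_dist_class_le by metis
qed

lemma decision_list_accepted:
  assumes f: "f \<in> decision_lists n" and ne: "ones n f \<noteq> {}"
  shows "2 / 3 \<le> pmf (verdict n f (tester n (blocks l) (depth l) (tests l) (pairs l))) True"
proof -
  let ?F = "\<lambda>A. f (to_list n A)"
  obtain rs0 d0 where f_eq: "f = restrict (eval_list rs0 d0) (cube n)"
    and vars0: "\<forall>(i, b, v)\<in>set rs0. i < n"
    using f unfolding decision_lists_def by blast
  have sub0: "vars rs0 \<subseteq> {..<n}" using vars0 by fastforce
  have F_ev: "?F A = ev rs0 d0 A" for A by (simp add: f_eq eval_list_to_list[OF sub0])
  have Sne: "set_ones n f \<noteq> {}" using ne by (simp add: ones_to_list)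
  then obtain w0 where w0: "w0 \<subseteq> {..<n}" "ev rs0 d0 w0" using F_ev by (auto simp: set_ones_def)
  obtain R L d where R: "R \<subseteq> vars rs0" and L: "vars L \<subseteq> vars rs0 - R" "distinct (map fst L)"
    and ev0: "\<And>w. ev rs0 d0 w \<longleftrightarrow> w \<inter> R = w0 \<inter> R \<and> ev L d w"
    and first: "L = [] \<and> d \<or> (\<exists>i b rs. L = (i, b, True) # rs)"
    using w0(2) by (rule decision_list_structure) (rule that; (assumption | iprover))
  interpret dl_target n ?F R w0 L d "set_ones n f" "{A \<in> Pow {..<n}. A \<inter> R = w0 \<inter> R}"
  proof unfold_locales
    show "R \<subseteq> {..<n}" using R sub0 by blast
    show "w0 \<subseteq> {..<n}" by (rule w0(1))
    show "vars L \<subseteq> {..<n} - R" using L(1) sub0 by blast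
    show "distinct (map fst L)" by (rule L(2))
    show "?F w \<longleftrightarrow> w \<inter> R = w0 \<inter> R \<and> ev L d w" for w unfolding F_ev by (rule ev0)
    show "L = [] \<and> d \<or> (\<exists>i b rs. L = (i, b, True) # rs)" by (rule first)
    show "set_ones n f \<equiv> {A \<in> Pow {..<n}. f (to_list n A)}" by (simp add: set_ones_def)
  qed simp_all
  define \<tau> where "\<tau> = 1 / (2000 * real (depth l) * real (tests l))"
  have KN: "1 \<le> real (depth l) * real (tests l)"
    using mult_mono[of 1 "real (depth l)" 1 "real (tests l)"] parameters_pos[of l] by simp
  have \<tau>: "0 \<le> \<tau>" "\<tau> \<le> 1" using KN by (simp_all add: \<tau>_def field_simps)
  let ?J = "pair_pmf (pmf_of_set ({..<n} \<rightarrow>\<^sub>E {..<blocks l})) (pair_pmf US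
     (pair_pmf (replicate_pmf (pairs l) UW) (replicate_pmf (tests l) (seeds (blocks l)))))"
  have "Pr ?J (\<lambda>(\<phi>, y, W, sds). \<not> accepts n (blocks l) (depth l) ?F \<phi> y W sds) \<le> 3 / 10"
    by (rule order.trans[OF accepts_probably[OF parameters_pos(1,2) \<tau>]])
       (use failure_bound[of l] in \<open>simp only: \<tau>_def of_nat_power of_nat_mult of_nat_numeral\<close>)
  then have "7 / 10 \<le> Pr ?J (\<lambda>(\<phi>, y, W, sds). accepts n (blocks l) (depth l) ?F \<phi> y W sds)"
    using Pr_not[of ?J "\<lambda>(\<phi>, y, W, sds). accepts n (blocks l) (depth l) ?F \<phi> y W sds"]
    by (simp add: case_prod_unfold)
  also have "\<dots> = pmf (verdict n f (tester n (blocks l) (depth l) (tests l) (pairs l))) True"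
    unfolding tester(1)[OF Sne parameters_pos(2)] pmf_map by (simp add: vimage_def)
  finally show ?thesis by simp
qed

lemma far_rejected:
  assumes \<epsilon>: "0 < \<epsilon>" "\<epsilon> \<le> 1" and ne: "ones n f \<noteq> {}"
    and far: "\<epsilon> \<le> rel_dist_class n f (decision_lists n)"
  defines "l \<equiv> scale \<epsilon>"
  shows "2 / 3 \<le> pmf (verdict n f (tester n (blocks l) (depth l) (tests l) (pairs l))) False"
proof -
  let ?F = "\<lambda>A. f (to_list n A)"
  let ?A = "\<lambda>(\<phi>, y, W, sds). accepts n (blocks l) (depth l) ?F \<phi> y W sds"
  have Sne: "set_ones n f \<noteq> {}" using ne by (simp add: ones_to_list)
  \<comment> \<open>Small enough for \<open>12808 * \<delta> < \<epsilon>\<close> and, as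
    \<open>\<epsilon> \<le> 1\<close>, for the bound \<open>1 / 10 ^ 7\<close> required by
    soundness.\<close>
  define \<delta> where "\<delta> = \<epsilon> / 10 ^ 7"
  have \<delta>: "0 < \<delta>" "\<delta> \<le> 1 / 10 ^ 7" using \<epsilon> by (simp_all add: \<delta>_def)
  have "1 \<le> \<epsilon> * 2 ^ l" using scale(1)[OF \<epsilon>] \<epsilon> by (simp add: l_def field_simps)
  then have \<delta>l: "1 \<le> \<delta> * (10 ^ 7 * 2 ^ l)" by (simp add: \<delta>_def)
  have far': "12808 * \<delta> < rel_dist n f g" if "g \<in> decision_lists n" for g
  proof -
    have "12808 * \<delta> < \<epsilon>" using \<epsilon> by (simp add: \<delta>_def)
    also have "\<dots> \<le> rel_dist n f g" using far rel_dist_class_le[OF that] by (rule order.trans)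
    finally show ?thesis .
  qed
  let ?S = "set_ones n f"
  let ?J = "pair_pmf (pmf_of_set ({..<n} \<rightarrow>\<^sub>E {..<blocks l})) (pair_pmf (pmf_of_set ?S)
      (pair_pmf (replicate_pmf (pairs l) (pair_pmf (pmf_of_set ?S) (pmf_of_set ?S)))
         (replicate_pmf (tests l) (seed_pmf n (blocks l) ?S))))"
  have "Pr ?J ?A \<le> 2 * (4 * real (blocks l) + 1) ^ depth l * (1 - \<delta>) ^ tests l"
    by (rule order.trans[OF accepts_rarely[OF Sne \<delta> far']]) (simp_all add: add.commute)
  also have "\<dots> \<le> 1 / 3" using \<delta>l \<delta>(2) by (intro tests_suffice) simp_all
  finally have "2 / 3 \<le> Pr ?J (\<lambda>x. \<not> ?A x)" using Pr_not[of ?J ?A] by simp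
  also have "\<dots> = pmf (verdict n f (tester n (blocks l) (depth l) (tests l) (pairs l))) False"
    unfolding tester(1)[OF Sne parameters_pos(2)] pmf_map by (simp add: vimage_def)
  finally show ?thesis .
qed

theorem theorem1p3:
  "\<exists>(A :: nat \<Rightarrow> real \<Rightarrow> query_alg) (T :: real \<Rightarrow> real).
     soft_O_inverse T \<and>
     (\<forall>(n :: nat) (\<epsilon> :: real). \<epsilon> > 0 \<longrightarrow>
        rel_error_tester n \<epsilon> (decision_lists n) (A n \<epsilon>) \<and>
        calls_at_most n (A n \<epsilon>) (T \<epsilon>))"
proof (intro exI conjI allI impI)
  show "soft_O_inverse budget" by (rule soft_O_budget)
  fix n :: nat and \<epsilon> :: real assume \<epsilon>: "\<epsilon> > 0"
  show "rel_error_tester n \<epsilon> (decision_lists n) (dl_tester n \<epsilon>)"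
  proof (cases "\<epsilon> > 1")
    case True
    then show ?thesis
      using rel_dist_class_le_1[of n] unfolding rel_error_tester_def
      by (fastforce simp: dl_tester_def verdict_simps)
  next
    case False
    then show ?thesis
      using decision_list_accepted far_rejected[OF \<epsilon>] unfolding rel_error_tester_def
      by (simp add: dl_tester_def)
  qed
  show "calls_at_most n (dl_tester n \<epsilon>) (budget \<epsilon>)"
    unfolding calls_at_most_def
  proof (intro ballI impI)
    fix f x assume ne: "ones n f \<noteq> {}" and x: "x \<in> set_pmf (run n f (dl_tester n \<epsilon>))"
    have Sne: "set_ones n f \<noteq> {}" using ne by (simp add: ones_to_list)
    show "case x of (b, q) \<Rightarrow> real q \<le> budget \<epsilon>"
    proof (cases "\<epsilon> > 1")
      case True
      then show ?thesis using x by (simp add: dl_tester_def budget_def)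
    next
      case False
      then have "snd x \<le> total (scale \<epsilon>)"
        using tester(2)[OF Sne parameters_pos(2)] x unfolding calls_def total_def dl_tester_def by auto
      then show ?thesis using False by (simp add: budget_def case_prod_unfold)
    qed
  qed
qed

end
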